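(* For every integer $l\geq 3$, the Acyclic Matching problem is NP-hard when the input graph is restricted to planar perfect elimination bipartite graphs with maximum degree three and girth at least $l$.
   Context: All graphs are finite, simple, undirected and loopless. A matching $M$ in a graph $G$ is a set of pairwise nonadjacent edges (no common endpoint); $V(M)$ denotes the set of endpoints of edges of $M$ and $G[M]$ the subgraph of $G$ induced on $V(M)$. A matching $M$ is acyclic if $G[M]$ is acyclic (a forest). The Acyclic Matching problem: given a graph $G$ and a positive integer $k$, decide whether $G$ has an acyclic matching $M$ with $|M|=k$. For a bipartite graph $G$ with bipartition $(X,Y)$, an edge $xy$ is bisimplicial if the subgraph induced on $N[x]\cup N[y]$ is a complete bipartite graph. An ordering $(x_1y_1,\dots,x_ky_k)$ of pairwise nonadjacent edges of $G$ is a perfect edge elimination ordering if, writing $A_j=\{x_1,\dots,x_j,y_1,\dots,y_j\}$ ($A_0=\emptyset$), the edge $x_{j+1}y_{j+1}$ is bisimplicial in $G[(X\cup Y)\setminus A_j]$ for $j=0,\dots,k-1$, and $G[(X\cup Y)\setminus A_k]$ has no edge. A perfect elimination bipartite graph is a bipartite graph admitting a perfect edge elimination ordering. *)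

theory Defs
  imports
    "HOL-Analysis.Analysis"
    "HOL-Computational_Algebra.Polynomial"
    "HOL-Library.Extended_Nat"
begin

section \<open>Turing machines, polynomial time, NP-hardness\<close>

text \<open>
  Nondeterministic Turing machines with finitely many two-way infinite tapes. States and tape
  symbols are initial segments of the naturals; the start state is 0, the blank is 0, and the
  input bits False and True are the symbols 1 and 2. A transition gives the new state and, for
  every tape, the symbol to write and the head move (-1, 0 or 1). A machine halts when no
  transition applies.
\<close>

record ntm =
  tapes :: nat
  states :: nat
  symbols :: nat
  accepting :: "nat set"
  delta :: "nat \<Rightarrow> nat list \<Rightarrow> (nat \<times> (nat \<times> int) list) set"

definition wf_ntm :: "ntm \<Rightarrow> bool" where
  "wf_ntm M \<longleftrightarrow> tapes M \<ge> 1 \<and> states M \<ge> 1 \<and> symbols M \<ge> 3 \<and>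
     (\<forall>q < states M. \<forall>s. length s = tapes M \<and> set s \<subseteq> {..<symbols M} \<longrightarrow>
        (\<forall>(q', a) \<in> delta M q s. q' < states M \<and> length a = tapes M \<and>
           set a \<subseteq> {..<symbols M} \<times> {-1, 0, 1}))"

definition deterministic :: "ntm \<Rightarrow> bool" where
  "deterministic M \<longleftrightarrow>
     (\<forall>q s. \<forall>r \<in> delta M q s. \<forall>r' \<in> delta M q s. r = r')"

text \<open>A tape is given by its head position and its contents.\<close>

type_synonym tape = "int \<times> (int \<Rightarrow> nat)"
type_synonym config = "nat \<times> tape list"

definition read :: "tape \<Rightarrow> nat" where
  "read t = snd t (fst t)"

definition act :: "nat \<times> int \<Rightarrow> tape \<Rightarrow> tape" where
  "act a t = (fst t + snd a, (snd t)(fst t := fst a))"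

definition step :: "ntm \<Rightarrow> config \<Rightarrow> config \<Rightarrow> bool" where
  "step M c c' \<longleftrightarrow>
     (\<exists>(q', a) \<in> delta M (fst c) (map read (snd c)). c' = (q', map2 act a (snd c)))"

definition halted :: "ntm \<Rightarrow> config \<Rightarrow> bool" where
  "halted M c \<longleftrightarrow> \<not> (\<exists>c'. step M c c')"

definition word_contents :: "bool list \<Rightarrow> int \<Rightarrow> nat" where
  "word_contents x i =
     (if 0 \<le> i \<and> i < int (length x) then (if x ! nat i then 2 else 1) else 0)"

definition init_config :: "ntm \<Rightarrow> bool list \<Rightarrow> config" where
  "init_config M x = (0, (0, word_contents x) # replicate (tapes M - 1) (0, \<lambda>_. 0))"

text \<open>The input is on the first tape, the output of a computed function on the last one.\<close>

definition poly_time_computable :: "(bool list \<Rightarrow> bool list) \<Rightarrow> bool" where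
  "poly_time_computable f \<longleftrightarrow>
     (\<exists>M (p :: nat poly). wf_ntm M \<and> deterministic M \<and>
        (\<forall>x. \<exists>t \<le> poly p (length x). \<exists>c. (step M ^^ t) (init_config M x) c \<and>
           halted M c \<and> snd (last (snd c)) = word_contents (f x)))"

definition NP :: "bool list set set" where
  "NP = {L. \<exists>M (p :: nat poly). wf_ntm M \<and>
     (\<forall>x t c. (step M ^^ t) (init_config M x) c \<longrightarrow> t \<le> poly p (length x)) \<and>
     (\<forall>x. x \<in> L \<longleftrightarrow>
        (\<exists>t c. (step M ^^ t) (init_config M x) c \<and> halted M c \<and> fst c \<in> accepting M))}"

text \<open>
  A decision problem whose inputs are restricted to a class of instances is given by the set of
  codes of its yes-instances and the set of codes of its no-instances. A reduction to it has to
  produce an instance of the restricted class on every input.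
\<close>

type_synonym problem = "bool list set \<times> bool list set"

definition NP_hard :: "problem \<Rightarrow> bool" where
  "NP_hard P \<longleftrightarrow>
     (\<forall>L \<in> NP. \<exists>f. poly_time_computable f \<and>
        (\<forall>x. (x \<in> L \<longrightarrow> f x \<in> fst P) \<and> (x \<notin> L \<longrightarrow> f x \<in> snd P)))"

section \<open>Graphs\<close>

record 'a graph =
  verts :: "'a set"
  edges :: "'a set set"

definition simple_graph :: "'a graph \<Rightarrow> bool" where
  "simple_graph G \<longleftrightarrow> finite (verts G) \<and> (\<forall>e \<in> edges G. e \<subseteq> verts G \<and> card e = 2)"

definition induced :: "'a graph \<Rightarrow> 'a set \<Rightarrow> 'a graph" where
  "induced G W = \<lparr>verts = verts G \<inter> W, edges = {e \<in> edges G. e \<subseteq> W}\<rparr>"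

definition nbhd :: "'a graph \<Rightarrow> 'a \<Rightarrow> 'a set" where
  "nbhd G v = {u. {v, u} \<in> edges G}"

definition closed_nbhd :: "'a graph \<Rightarrow> 'a \<Rightarrow> 'a set" where
  "closed_nbhd G v = insert v (nbhd G v)"

definition vdegree :: "'a graph \<Rightarrow> 'a \<Rightarrow> nat" where
  "vdegree G v = card (nbhd G v)"

definition max_degree :: "'a graph \<Rightarrow> nat" where
  "max_degree G = Max (insert 0 (vdegree G ` verts G))"

definition is_cycle :: "'a graph \<Rightarrow> 'a list \<Rightarrow> bool" where
  "is_cycle G c \<longleftrightarrow> length c \<ge> 3 \<and> distinct c \<and>
     (\<forall>i < length c. {c ! i, c ! (Suc i mod length c)} \<in> edges G)"

definition acyclic_graph :: "'a graph \<Rightarrow> bool" where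
  "acyclic_graph G \<longleftrightarrow> \<not> (\<exists>c. is_cycle G c)"

text \<open>The girth of an acyclic graph is infinite.\<close>

definition girth :: "'a graph \<Rightarrow> enat" where
  "girth G = (INF c \<in> {c. is_cycle G c}. enat (length c))"

text \<open>Planarity: a drawing in the plane by simple arcs that meet only in common end vertices.\<close>

definition planar :: "'a graph \<Rightarrow> bool" where
  "planar G \<longleftrightarrow> (\<exists>(p :: 'a \<Rightarrow> complex) (\<gamma> :: 'a set \<Rightarrow> real \<Rightarrow> complex).
     inj_on p (verts G) \<and>
     (\<forall>e \<in> edges G. arc (\<gamma> e) \<and> {pathstart (\<gamma> e), pathfinish (\<gamma> e)} = p ` e \<and>
        path_image (\<gamma> e) \<inter> p ` verts G = p ` e) \<and>
     (\<forall>e \<in> edges G. \<forall>f \<in> edges G. e \<noteq> f \<longrightarrow>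
        path_image (\<gamma> e) \<inter> path_image (\<gamma> f) = p ` (e \<inter> f)))"

definition bipartition :: "'a graph \<Rightarrow> 'a set \<Rightarrow> 'a set \<Rightarrow> bool" where
  "bipartition G X Y \<longleftrightarrow> X \<inter> Y = {} \<and> X \<union> Y = verts G \<and>
     (\<forall>e \<in> edges G. \<exists>x \<in> X. \<exists>y \<in> Y. e = {x, y})"

definition complete_bipartite :: "'a graph \<Rightarrow> bool" where
  "complete_bipartite G \<longleftrightarrow>
     (\<exists>A B. bipartition G A B \<and> (\<forall>a \<in> A. \<forall>b \<in> B. {a, b} \<in> edges G))"

definition bisimplicial :: "'a graph \<Rightarrow> 'a \<Rightarrow> 'a \<Rightarrow> bool" where
  "bisimplicial G x y \<longleftrightarrow> {x, y} \<in> edges G \<and>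
     complete_bipartite (induced G (closed_nbhd G x \<union> closed_nbhd G y))"

definition eliminated :: "('a \<times> 'a) list \<Rightarrow> nat \<Rightarrow> 'a set" where
  "eliminated es j = (\<Union>(x, y) \<in> set (take j es). {x, y})"

definition perfect_edge_elimination_ordering ::
  "'a graph \<Rightarrow> 'a set \<Rightarrow> 'a set \<Rightarrow> ('a \<times> 'a) list \<Rightarrow> bool" where
  "perfect_edge_elimination_ordering G X Y es \<longleftrightarrow>
     (\<forall>(x, y) \<in> set es. x \<in> X \<and> y \<in> Y \<and> {x, y} \<in> edges G) \<and>
     (\<forall>i < length es. \<forall>j < length es. i \<noteq> j \<longrightarrow>
        {fst (es ! i), snd (es ! i)} \<inter> {fst (es ! j), snd (es ! j)} = {}) \<and>
     (\<forall>j < length es.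
        bisimplicial (induced G ((X \<union> Y) - eliminated es j)) (fst (es ! j)) (snd (es ! j))) \<and>
     edges (induced G ((X \<union> Y) - eliminated es (length es))) = {}"

definition perfect_elimination_bipartite :: "'a graph \<Rightarrow> bool" where
  "perfect_elimination_bipartite G \<longleftrightarrow>
     (\<exists>X Y. bipartition G X Y \<and> (\<exists>es. perfect_edge_elimination_ordering G X Y es))"

definition matching :: "'a graph \<Rightarrow> 'a set set \<Rightarrow> bool" where
  "matching G M \<longleftrightarrow> M \<subseteq> edges G \<and> (\<forall>e \<in> M. \<forall>f \<in> M. e \<noteq> f \<longrightarrow> e \<inter> f = {})"

definition acyclic_matching :: "'a graph \<Rightarrow> 'a set set \<Rightarrow> bool" where
  "acyclic_matching G M \<longleftrightarrow> matching G M \<and> acyclic_graph (induced G (\<Union>M))"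

section \<open>The Acyclic Matching problem\<close>

fun bits :: "nat \<Rightarrow> bool list" where
  "bits k = (if k = 0 then [] else odd k # bits (k div 2))"

declare bits.simps [simp del]

lemma bits_inject: "bits k = bits k' \<Longrightarrow> k = k'"
proof (induction k arbitrary: k' rule: less_induct)
  case (less k)
  show ?case
  proof (cases "k = 0 \<or> k' = 0")
    case True
    then show ?thesis
      using less.prems by (auto simp: bits.simps[of k] bits.simps[of k'] split: if_splits)
  next
    case False
    then have "odd k = odd k'" "bits (k div 2) = bits (k' div 2)"
      using less.prems by (auto simp: bits.simps[of k] bits.simps[of k'])
    moreover from this(2) have "k div 2 = k' div 2"
      using less.IH[of "k div 2" "k' div 2"] False by simp
    ultimately show ?thesis
      by (metis odd_iff_mod_2_eq_one parity_cases div_mult_mod_eq)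
  qed
qed

text \<open>
  An instance with vertex set \<open>{0, \<dots>, n - 1}\<close> is encoded by \<open>n\<close> in unary, the adjacency matrix
  row by row, and \<open>k\<close> in binary (least significant bit first).
\<close>

definition encode :: "nat \<Rightarrow> nat set set \<Rightarrow> nat \<Rightarrow> bool list" where
  "encode n E k = replicate n True @ [False] @
     concat (map (\<lambda>i. map (\<lambda>j. {i, j} \<in> E) [0..<n]) [0..<n]) @ bits k"

lemma encode_inject:
  assumes "encode n E k = encode n' E' k'"
    and "simple_graph \<lparr>verts = {..<n}, edges = E\<rparr>"
    and "simple_graph \<lparr>verts = {..<n'}, edges = E'\<rparr>"
  shows "n = n' \<and> E = E' \<and> k = k'"
proof -
  have unary: "length (takeWhile (\<lambda>b. b) (encode m F j)) = m" for m F j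
    unfolding encode_def by (subst takeWhile_append2) auto
  have n: "n = n'"
    using unary[of n E k] unary[of n' E' k'] assms(1) by simp
  have len: "length (concat (map (\<lambda>i. map (\<lambda>j. {i, j} \<in> F) [0..<m]) [0..<m])) = m * m"
    for F :: "nat set set" and m
    by (simp add: length_concat comp_def sum_list_triv)
  have mat: "concat (map (\<lambda>i. map (\<lambda>j. {i, j} \<in> E) [0..<n]) [0..<n]) =
      concat (map (\<lambda>i. map (\<lambda>j. {i, j} \<in> E') [0..<n]) [0..<n])"
    and k: "bits k = bits k'"
    using assms(1) n by (simp_all add: encode_def append_eq_append_conv len)
  have "map (\<lambda>i. map (\<lambda>j. {i, j} \<in> E) [0..<n]) [0..<n] =
      map (\<lambda>i. map (\<lambda>j. {i, j} \<in> E') [0..<n]) [0..<n]"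
    by (rule concat_injective[OF mat]) (auto simp: set_zip)
  then have ij: "{i, j} \<in> E \<longleftrightarrow> {i, j} \<in> E'" if "i < n" "j < n" for i j
    using that by simp
  have "e \<in> E \<longleftrightarrow> e \<in> E'" for e
    using assms(2,3) ij n unfolding simple_graph_def card_2_iff
    by (metis graph.select_convs insert_subset lessThan_iff)
  then show ?thesis
    using n bits_inject[OF k] by blast
qed

definition acyclic_matching_problem :: "nat graph set \<Rightarrow> problem" where
  "acyclic_matching_problem \<C> =
     ({encode n E k | n E k. let G = \<lparr>verts = {..<n}, edges = E\<rparr> in
         simple_graph G \<and> G \<in> \<C> \<and> k > 0 \<and> (\<exists>M. acyclic_matching G M \<and> card M = k)},
      {encode n E k | n E k. let G = \<lparr>verts = {..<n}, edges = E\<rparr> in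
         simple_graph G \<and> G \<in> \<C> \<and> k > 0 \<and> \<not> (\<exists>M. acyclic_matching G M \<and> card M = k)})"

end

theory Submission
  imports Defs
begin

text \<open>
  A computation of a polynomial-time machine is described by a tableau of letters, one for each time
  and tape cell, subject to conflicts between pairs of letters. Numbering all pairs (site, letter) as
  rows, one has to select a row in every group of rows belonging to one site, while every column (a
  pair of conflicting rows) keeps an unselected row among those tapped in it.

  This is a feedback vertex set problem in a planar maze of unit walls on the lattice. Every cell of
  the maze, at the crossing of a row and a column, has at most four disjoint blocks, each of which
  contains a cycle, so a feedback set needs at least one point per block; a set of exactly that size
  chooses one point in each block. These choices carry the selection bits along the rows and, along
  each column, a bit saying whether an unselected tapped row has been met. At the east border a room
  for each group forces a selected row.

  Finally every lattice point is replaced by an edge, every wall by a path with a pendant vertex at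
  each inner vertex. A largest acyclic matching contains all pendant edges, and the edges of the
  lattice points it can keep are those outside a feedback set. Long vertical paths give large girth,
  the pendant edges come first in the perfect edge elimination ordering, and a sheared drawing of the
  graph in the lattice shows planarity.

  The instance is polynomial-time computable because each bit of its code is given by an arithmetic
  expression with bounded sums, and these are evaluated by counter machines.
\<close>

section \<open>Bounded arithmetic expressions and counter programs\<close>

text \<open>The planar obstacle is that each row bit has to cross each column bit. The crossover is
  the central four-cycle of a cell: with one point to be removed, its four corners are the four
  combinations of a horizontal and a vertical bit. Further cycles tie up to three blocks together;
  each of them must be hit by a point of a block, so a miss on one side forces the choice on the
  other. Bits are thus passed on only as implications: a row selected at its east end acts as
  selected in every cell to the west, and a column bit that starts at the top and is never absorbed
  would need a block below row 0, where there is none. Absorption is possible only at a tapped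
  unselected row.

  With one column per ordered pair of rows, any pair of letters can be forbidden, near or far; so
  all cells of one time can be made to name the same transition.

  All values of the expressions are polynomially bounded, so registers can be kept in unary as head
  positions. This is also why powers of two are recognised by their divisors instead of being
  computed.\<close>

datatype aexp =
  Var nat | Cst nat | Add aexp aexp | Mul aexp aexp | Sub aexp aexp | Inp aexp | Len | BSum nat aexp aexp

fun aval :: "bool list \<Rightarrow> (nat \<Rightarrow> nat) \<Rightarrow> aexp \<Rightarrow> nat" where
  "aval x \<rho> (Var v) = \<rho> v"
| "aval x \<rho> (Cst n) = n"
| "aval x \<rho> (Add a b) = aval x \<rho> a + aval x \<rho> b"
| "aval x \<rho> (Mul a b) = aval x \<rho> a * aval x \<rho> b"
| "aval x \<rho> (Sub a b) = aval x \<rho> a - aval x \<rho> b"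
| "aval x \<rho> (Inp a) = word_contents x (int (aval x \<rho> a))"
| "aval x \<rho> Len = length x"
| "aval x \<rho> (BSum v a b) = (\<Sum>i<aval x \<rho> a. aval x (\<rho>(v := i)) b)"

fun vars_below :: "nat \<Rightarrow> aexp \<Rightarrow> bool" where
  "vars_below B (Var v) \<longleftrightarrow> v < B"
| "vars_below B (Cst n) \<longleftrightarrow> True"
| "vars_below B (Add a b) \<longleftrightarrow> vars_below B a \<and> vars_below B b"
| "vars_below B (Mul a b) \<longleftrightarrow> vars_below B a \<and> vars_below B b"
| "vars_below B (Sub a b) \<longleftrightarrow> vars_below B a \<and> vars_below B b"
| "vars_below B (Inp a) \<longleftrightarrow> vars_below B a"
| "vars_below B Len \<longleftrightarrow> True"
| "vars_below B (BSum v a b) \<longleftrightarrow> v < B \<and> vars_below B a \<and> vars_below B b"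

lemma vars_below_mono: "vars_below B e \<Longrightarrow> B \<le> B' \<Longrightarrow> vars_below B' e"
  by (induction e) auto

lemma vars_below_exists: "\<exists>B. vars_below B e"
proof (induction e)
  case (Var v) then show ?case by (auto intro: exI[of _ "Suc v"])
next
  case (Add a b) then show ?case
    by (metis vars_below.simps(3) vars_below_mono max.cobounded1 max.cobounded2)
next
  case (Mul a b) then show ?case
    by (metis vars_below.simps(4) vars_below_mono max.cobounded1 max.cobounded2)
next
  case (Sub a b) then show ?case
    by (metis vars_below.simps(5) vars_below_mono max.cobounded1 max.cobounded2)
next
  case (BSum v a b)
  then obtain B1 B2 where "vars_below B1 a" "vars_below B2 b" by blast
  then have "vars_below (max (Suc v) (max B1 B2)) (BSum v a b)"
    by (auto intro: vars_below_mono)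
  then show ?case by blast
qed auto

lemma aval_cong: "vars_below B e \<Longrightarrow> (\<And>v. v < B \<Longrightarrow> \<rho> v = \<rho>' v) \<Longrightarrow> aval x \<rho> e = aval x \<rho>' e"
proof (induction e arbitrary: \<rho> \<rho>')
  case (BSum v a b)
  have "aval x \<rho> a = aval x \<rho>' a" using BSum.prems by (intro BSum.IH(1)) auto
  moreover have "aval x (\<rho>(v := i)) b = aval x (\<rho>'(v := i)) b" for i
    using BSum.prems by (intro BSum.IH) auto
  ultimately show ?case by simp
next
  case (Add a b)
  then have "aval x \<rho> a = aval x \<rho>' a" "aval x \<rho> b = aval x \<rho>' b" by (metis vars_below.simps(3))+
  then show ?case by simp
next
  case (Mul a b)
  then have "aval x \<rho> a = aval x \<rho>' a" "aval x \<rho> b = aval x \<rho>' b" by (metis vars_below.simps(4))+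
  then show ?case by simp
next
  case (Sub a b)
  then have "aval x \<rho> a = aval x \<rho>' a" "aval x \<rho> b = aval x \<rho>' b" by (metis vars_below.simps(5))+
  then show ?case by simp
next
  case (Inp a)
  then have "aval x \<rho> a = aval x \<rho>' a" by (metis vars_below.simps(6))
  then show ?case by simp
qed auto

datatype test = NZ nat | InNZ | In2

datatype com = Skip | Inc nat | Dec nat | IR | IL | Out bool
  | Seq com com | Cond test com com | While test com

type_synonym st = "(nat \<Rightarrow> nat) \<times> int \<times> bool list"

fun holds :: "bool list \<Rightarrow> test \<Rightarrow> st \<Rightarrow> bool" where
  "holds x (NZ v) (\<rho>, p, out) \<longleftrightarrow> \<rho> v \<noteq> 0"
| "holds x InNZ (\<rho>, p, out) \<longleftrightarrow> word_contents x p \<noteq> 0"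
| "holds x In2 (\<rho>, p, out) \<longleftrightarrow> word_contents x p = 2"

text \<open>The costs are the exact step counts of the compiled code: a conditional pays for its
  test and, in the then-branch, for the jump over the else-branch; each loop round pays for the test
  at the top and for the jump back.\<close>

inductive big :: "bool list \<Rightarrow> com \<Rightarrow> st \<Rightarrow> nat \<Rightarrow> st \<Rightarrow> bool" for x where
  Skip: "big x Skip s 0 s"
| Inc: "big x (Inc v) (\<rho>, p, out) 1 (\<rho>(v := Suc (\<rho> v)), p, out)"
| Dec: "big x (Dec v) (\<rho>, p, out) 1 (\<rho>(v := \<rho> v - 1), p, out)"
| IR: "big x IR (\<rho>, p, out) 1 (\<rho>, p + 1, out)"
| IL: "big x IL (\<rho>, p, out) 1 (\<rho>, p - 1, out)"
| Out: "big x (Out b) (\<rho>, p, out) 1 (\<rho>, p, out @ [b])"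
| Seq: "big x c s t s' \<Longrightarrow> big x c' s' t' s'' \<Longrightarrow> big x (Seq c c') s (t + t') s''"
| IfT: "holds x b s \<Longrightarrow> big x c s t s' \<Longrightarrow> big x (Cond b c c') s (t + 2) s'"
| IfF: "\<not> holds x b s \<Longrightarrow> big x c' s t s' \<Longrightarrow> big x (Cond b c c') s (t + 1) s'"
| WhileF: "\<not> holds x b s \<Longrightarrow> big x (While b c) s 1 s"
| WhileT: "holds x b s \<Longrightarrow> big x c s t s' \<Longrightarrow> big x (While b c) s' t' s'' \<Longrightarrow>
    big x (While b c) s (t + 2 + t') s''"

definition runs :: "bool list \<Rightarrow> com \<Rightarrow> st \<Rightarrow> nat \<Rightarrow> st \<Rightarrow> bool" where
  "runs x c s T s' \<longleftrightarrow> (\<exists>t\<le>T. big x c s t s')"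

lemma runs_basic:
  "runs x Skip s 0 s"
  "runs x (Inc v) (\<rho>, p, out) 1 (\<rho>(v := Suc (\<rho> v)), p, out)"
  "runs x (Dec v) (\<rho>, p, out) 1 (\<rho>(v := \<rho> v - 1), p, out)"
  "runs x IR (\<rho>, p, out) 1 (\<rho>, p + 1, out)"
  "runs x IL (\<rho>, p, out) 1 (\<rho>, p - 1, out)"
  "runs x (Out b) (\<rho>, p, out) 1 (\<rho>, p, out @ [b])"
  unfolding runs_def by (blast intro: big.intros)+

lemma runs_mono: "runs x c s T s' \<Longrightarrow> T \<le> T' \<Longrightarrow> runs x c s T' s'"
  unfolding runs_def by (meson le_trans)

lemma runs_Seq: "runs x c s T s' \<Longrightarrow> runs x c' s' T' s'' \<Longrightarrow> runs x (Seq c c') s (T + T') s''"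
  unfolding runs_def by (meson Seq add_mono)

lemma runs_Cond:
  assumes "holds x b s \<Longrightarrow> runs x c s T s'" "\<not> holds x b s \<Longrightarrow> runs x c' s T s'"
  shows "runs x (Cond b c c') s (T + 2) s'"
proof (cases "holds x b s")
  case True
  then obtain t where "t \<le> T" "big x c s t s'" using assms(1) unfolding runs_def by blast
  then show ?thesis using IfT[OF True] unfolding runs_def by (intro exI[of _ "t + 2"]) auto
next
  case False
  then obtain t where "t \<le> T" "big x c' s t s'" using assms(2) unfolding runs_def by blast
  then show ?thesis using IfF[OF False] unfolding runs_def by (intro exI[of _ "t + 1"]) auto
qed

lemma runs_While:
  assumes "\<And>i. i < n \<Longrightarrow> holds x b (\<sigma> i)" "\<not> holds x b (\<sigma> n)"
    "\<And>i. i < n \<Longrightarrow> runs x c (\<sigma> i) T (\<sigma> (Suc i))"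
  shows "runs x (While b c) (\<sigma> 0) (n * (T + 2) + 1) (\<sigma> n)"
proof -
  have "k \<le> n \<Longrightarrow> runs x (While b c) (\<sigma> (n - k)) (k * (T + 2) + 1) (\<sigma> n)" for k
  proof (induction k)
    case 0
    then show ?case using WhileF[OF assms(2)] unfolding runs_def by auto
  next
    case (Suc k)
    let ?i = "n - Suc k"
    have S: "Suc ?i = n - k" and i: "?i < n" using Suc.prems by auto
    obtain t where t: "t \<le> T" "big x c (\<sigma> ?i) t (\<sigma> (n - k))"
      using assms(3)[OF i] S unfolding runs_def by auto
    obtain t' where t': "t' \<le> k * (T + 2) + 1" "big x (While b c) (\<sigma> (n - k)) t' (\<sigma> n)"
      using Suc unfolding runs_def by auto
    have "big x (While b c) (\<sigma> ?i) (t + 2 + t') (\<sigma> n)"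
      by (rule WhileT[OF assms(1)[OF i] t(2) t'(2)])
    moreover have "t + 2 + t' \<le> Suc k * (T + 2) + 1" using t(1) t'(1) by simp
    ultimately show ?case unfolding runs_def by blast
  qed
  from this[of n] show ?thesis by simp
qed

lemma runs_While':
  assumes "\<And>i. i < n \<Longrightarrow> holds x b (\<sigma> i)" "\<not> holds x b (\<sigma> n)"
    "\<And>i. i < n \<Longrightarrow> runs x c (\<sigma> i) T (\<sigma> (Suc i))" "s = \<sigma> 0" "s' = \<sigma> n" "n * (T + 2) + 1 \<le> T'"
  shows "runs x (While b c) s T' s'"
  using runs_While[OF assms(1-3)] assms(4-6) runs_mono by metis

lemma runs_conv: "runs x c s T s'' \<Longrightarrow> s'' = s' \<Longrightarrow> T \<le> T' \<Longrightarrow> runs x c s T' s'"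
  using runs_mono by metis

lemma runs_Seq': "runs x c s T s' \<Longrightarrow> runs x c' s' T' s'' \<Longrightarrow> T + T' \<le> U \<Longrightarrow> runs x (Seq c c') s U s''"
  using runs_Seq runs_mono by metis

fun incs :: "nat \<Rightarrow> nat \<Rightarrow> com" where
  "incs d 0 = Skip"
| "incs d (Suc n) = Seq (incs d n) (Inc d)"

text \<open>The code adds the value of the expression to register \<open>d\<close>; registers from \<open>f\<close> on are
  zero before and after.\<close>

fun acode :: "aexp \<Rightarrow> nat \<Rightarrow> nat \<Rightarrow> com" where
  "acode (Var v) d f = Seq (While (NZ v) (Seq (Dec v) (Seq (Inc d) (Inc f))))
     (While (NZ f) (Seq (Dec f) (Inc v)))"
| "acode (Cst n) d f = incs d n"
| "acode (Add a b) d f = Seq (acode a d f) (acode b d f)"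
| "acode (Mul a b) d f = Seq (acode a f (Suc f)) (While (NZ f) (Seq (Dec f) (acode b d (Suc f))))"
| "acode (Sub a b) d f = Seq (acode a f (Suc f)) (Seq (acode b (Suc f) (Suc (Suc f)))
     (Seq (While (NZ (Suc f)) (Seq (Dec (Suc f)) (Dec f))) (While (NZ f) (Seq (Dec f) (Inc d)))))"
| "acode (Inp a) d f = Seq (acode a f (Suc f)) (Seq (While (NZ f) (Seq (Dec f) (Seq (Inc (Suc f)) IR)))
     (Seq (Cond InNZ (Inc d) Skip) (Seq (Cond In2 (Inc d) Skip)
       (While (NZ (Suc f)) (Seq (Dec (Suc f)) IL)))))"
| "acode Len d f = Seq (While InNZ (Seq IR (Inc f))) (While (NZ f) (Seq (Dec f) (Seq (Inc d) IL)))"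
| "acode (BSum v a b) d f = Seq (acode a f (Suc f))
     (Seq (While (NZ v) (Seq (Dec v) (Inc (Suc f))))
     (Seq (While (NZ f) (Seq (Dec f) (Seq (acode b d (Suc (Suc f))) (Inc v))))
     (Seq (While (NZ v) (Dec v)) (While (NZ (Suc f)) (Seq (Dec (Suc f)) (Inc v))))))"

text \<open>This makes unary registers affordable: every operation, including a sum up to a computed
  value, keeps the bound polynomial.\<close>

lemma aval_bound: "\<exists>p. \<forall>x \<rho> m. length x \<le> m \<longrightarrow> (\<forall>v. \<rho> v \<le> m) \<longrightarrow> aval x \<rho> e \<le> poly p m"
proof (induction e)
  case (Var v) then show ?case by (intro exI[of _ "[:0, 1:]"]) auto
next
  case (Cst n) then show ?case by (intro exI[of _ "[:n:]"]) auto
next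
  case (Add a b)
  then obtain p q where "\<forall>x \<rho> m. length x \<le> m \<longrightarrow> (\<forall>v. \<rho> v \<le> m) \<longrightarrow> aval x \<rho> a \<le> poly p m"
    "\<forall>x \<rho> m. length x \<le> m \<longrightarrow> (\<forall>v. \<rho> v \<le> m) \<longrightarrow> aval x \<rho> b \<le> poly q m" by blast
  then show ?case by (intro exI[of _ "p + q"]) (auto intro: add_mono)
next
  case (Mul a b)
  then obtain p q where "\<forall>x \<rho> m. length x \<le> m \<longrightarrow> (\<forall>v. \<rho> v \<le> m) \<longrightarrow> aval x \<rho> a \<le> poly p m"
    "\<forall>x \<rho> m. length x \<le> m \<longrightarrow> (\<forall>v. \<rho> v \<le> m) \<longrightarrow> aval x \<rho> b \<le> poly q m" by blast
  then show ?case by (intro exI[of _ "p * q"]) (auto intro: mult_mono)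
next
  case (Sub a b)
  then obtain p where "\<forall>x \<rho> m. length x \<le> m \<longrightarrow> (\<forall>v. \<rho> v \<le> m) \<longrightarrow> aval x \<rho> a \<le> poly p m" by blast
  then show ?case by (intro exI[of _ p]) (auto intro: le_trans[OF diff_le_self])
next
  case (Inp a)
  show ?case by (intro exI[of _ "[:2:]"]) (auto simp: word_contents_def)
next
  case Len then show ?case by (intro exI[of _ "[:0, 1:]"]) auto
next
  case (BSum v a b)
  then obtain p q where p: "\<And>x \<rho> m. length x \<le> m \<Longrightarrow> (\<forall>v. \<rho> v \<le> m) \<Longrightarrow> aval x \<rho> a \<le> poly p m"
    and q: "\<And>x \<rho> m. length x \<le> m \<Longrightarrow> (\<forall>v. \<rho> v \<le> m) \<Longrightarrow> aval x \<rho> b \<le> poly q m" by blast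
  show ?case
  \<comment> \<open>There are at most \<open>p(m)\<close> summands, and the index stays below
    \<open>p(m)\<close>, so the summand is evaluated under a valuation bounded by
    \<open>m + p(m)\<close>.\<close>
  proof (intro exI[of _ "p * pcompose q ([:0, 1:] + p)"] allI impI)
    fix x :: "bool list" and \<rho> :: "nat \<Rightarrow> nat" and m
    assume m: "length x \<le> m" "\<forall>v. \<rho> v \<le> m"
    have "aval x (\<rho>(v := i)) b \<le> poly q (m + poly p m)" if "i < aval x \<rho> a" for i
      using p[OF m] that m by (intro q) (auto simp: trans_le_add1)
    then have "(\<Sum>i<aval x \<rho> a. aval x (\<rho>(v := i)) b) \<le> (\<Sum>i<aval x \<rho> a. poly q (m + poly p m))"
      by (intro sum_mono) auto
    also have "\<dots> \<le> poly p m * poly q (m + poly p m)" using p[OF m] by simp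
    finally show "aval x \<rho> (BSum v a b) \<le> poly (p * pcompose q ([:0, 1:] + p)) m"
      by (simp add: poly_pcompose)
  qed
qed

text \<open>Only the variables below \<open>B\<close> are bounded by \<open>m\<close>. The registers
  from \<open>B\<close> up to \<open>f\<close> hold accumulators of enclosing computations, which
  may be larger and must not enter the time bound.\<close>

definition computes :: "nat \<Rightarrow> aexp \<Rightarrow> nat poly \<Rightarrow> bool" where
  "computes B e q \<longleftrightarrow> (\<forall>x \<rho> m d f out. length x \<le> m \<longrightarrow> (\<forall>v<B. \<rho> v \<le> m) \<longrightarrow> B \<le> d \<longrightarrow> d < f \<longrightarrow>
     (\<forall>v\<ge>f. \<rho> v = 0) \<longrightarrow>
     runs x (acode e d f) (\<rho>, 0, out) (poly q m) (\<rho>(d := \<rho> d + aval x \<rho> e), 0, out))"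

lemma aval_bound':
  assumes "vars_below B e"
  obtains p where "\<And>x \<rho> m. length x \<le> m \<Longrightarrow> (\<And>v. v < B \<Longrightarrow> \<rho> v \<le> m) \<Longrightarrow> aval x \<rho> e \<le> poly p m"
proof -
  obtain p where p: "\<And>x \<rho> m. length x \<le> m \<Longrightarrow> (\<forall>v. \<rho> v \<le> m) \<Longrightarrow> aval x \<rho> e \<le> poly p m"
    using aval_bound[of e] by blast
  have "aval x \<rho> e \<le> poly p m" if "length x \<le> m" "\<And>v. v < B \<Longrightarrow> \<rho> v \<le> m" for x \<rho> m
  proof -
    have "aval x \<rho> e = aval x (\<lambda>v. if v < B then \<rho> v else 0) e"
      by (rule aval_cong[OF assms]) auto
    then show ?thesis using p[of x m "\<lambda>v. if v < B then \<rho> v else 0"] that by auto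
  qed
  then show ?thesis using that by blast
qed


lemma computesI:
  assumes "\<And>x \<rho> m d f out. length x \<le> m \<Longrightarrow> (\<And>v. v < B \<Longrightarrow> \<rho> v \<le> m) \<Longrightarrow> B \<le> d \<Longrightarrow> d < f \<Longrightarrow>
     (\<And>v. v \<ge> f \<Longrightarrow> \<rho> v = 0) \<Longrightarrow>
     runs x (acode e d f) (\<rho>, 0, out) (poly q m) (\<rho>(d := \<rho> d + aval x \<rho> e), 0, out)"
  shows "computes B e q"
  using assms unfolding computes_def by simp

lemma computesD:
  assumes "computes B e q" "length x \<le> m" "\<And>v. v < B \<Longrightarrow> \<rho> v \<le> m" "B \<le> d" "d < f"
     "\<And>v. v \<ge> f \<Longrightarrow> \<rho> v = 0" "r = \<rho> d + aval x \<rho> e"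
   shows "runs x (acode e d f) (\<rho>, 0, out) (poly q m) (\<rho>(d := r), 0, out)"
  using assms unfolding computes_def by simp

text \<open>Reading a counter destroys it: \<open>v\<close> is drained into both \<open>d\<close>
  and the scratch register \<open>f\<close>, then refilled from \<open>f\<close>.\<close>

lemma computes_V: 
  assumes v: "v < B" 
  shows "computes B (Var v) [:10, 10:]"
proof (rule computesI)
    fix x :: "bool list" and \<rho> :: "nat \<Rightarrow> nat" and m d f and out :: "bool list"
    assume m: "length x \<le> m" "\<And>v. v < B \<Longrightarrow> \<rho> v \<le> m" "B \<le> d" "d < f" "\<And>v. v \<ge> f \<Longrightarrow> \<rho> v = 0"
    let ?n = "\<rho> v"
    let ?s = "\<lambda>i. (\<rho>(v := ?n - i, d := \<rho> d + i, f := i), 0::int, out)"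
    let ?s2 = "\<lambda>i. (\<rho>(v := i, d := \<rho> d + ?n, f := ?n - i), 0::int, out)"
    have ne: "v \<noteq> d" "v \<noteq> f" "d \<noteq> f" "\<rho> f = 0" "d \<noteq> v" "f \<noteq> v" "f \<noteq> d" using v m by auto
    have b1: "runs x (Seq (Dec v) (Seq (Inc d) (Inc f))) (?s i) 3 (?s (Suc i))" if "i < ?n" for i
      by (rule runs_conv, (rule runs_Seq runs_basic)+) (use that ne in \<open>auto simp: fun_eq_iff\<close>)
    have w1: "runs x (While (NZ v) (Seq (Dec v) (Seq (Inc d) (Inc f)))) (?s 0) (5 * m + 1) (?s ?n)"
      by (rule runs_While'[where \<sigma> = ?s and n = ?n and T = 3]) (use b1 ne m(2)[OF v] in auto)
    have b2: "runs x (Seq (Dec f) (Inc v)) (?s2 i) 2 (?s2 (Suc i))" if "i < ?n" for i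
      by (rule runs_conv, (rule runs_Seq runs_basic)+) (use that ne in \<open>auto simp: fun_eq_iff\<close>)
    have w2: "runs x (While (NZ f) (Seq (Dec f) (Inc v))) (?s2 0) (4 * m + 1) (?s2 ?n)"
      by (rule runs_While'[where \<sigma> = ?s2 and n = ?n and T = 2]) (use b2 ne m(2)[OF v] in auto)
    have e: "?s ?n = ?s2 0" "?s 0 = (\<rho>, 0, out)" "?s2 ?n = (\<rho>(d := \<rho> d + ?n), 0, out)"
      using ne by (auto simp: fun_eq_iff)
    show "runs x (acode (Var v) d f) (\<rho>, 0, out) (poly [:10, 10:] m) (\<rho>(d := \<rho> d + aval x \<rho> (Var v)), 0, out)"
      using runs_Seq'[OF w1[unfolded e(1)] w2, of "10 + 10 * m"] unfolding e by (simp add: mult.commute)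
qed

lemma computes_K: "computes B (Cst n) [:n:]"
proof -
  have "runs x (incs d n) (\<rho>, 0, out) n (\<rho>(d := \<rho> d + n), 0, out)" for x d \<rho> out
  proof (induction n)
    case 0 then show ?case using runs_basic(1) by simp
  next
    case (Suc n)
    show ?case unfolding incs.simps
      by (rule runs_conv, rule runs_Seq[OF Suc runs_basic(2)]) auto
  qed
  then show ?thesis by (intro computesI) simp
qed

lemma computes_Plus:
  assumes "computes B a p" "computes B b q" "vars_below B a" "vars_below B b"
  shows "computes B (Add a b) (p + q)"
proof (rule computesI)
  fix x :: "bool list" and \<rho> :: "nat \<Rightarrow> nat" and m d f and out :: "bool list"
  assume m: "length x \<le> m" "\<And>v. v < B \<Longrightarrow> \<rho> v \<le> m" "B \<le> d" "d < f" "\<And>v. v \<ge> f \<Longrightarrow> \<rho> v = 0"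
  let ?r = "\<rho>(d := \<rho> d + aval x \<rho> a)"
  have eb: "aval x ?r b = aval x \<rho> b" using m(3) by (intro aval_cong[OF assms(4)]) auto
  have 1: "runs x (acode a d f) (\<rho>, 0, out) (poly p m) (?r, 0, out)"
    by (rule computesD[OF assms(1)]) (use m in auto)
  have 2: "runs x (acode b d f) (?r, 0, out) (poly q m) (?r(d := \<rho> d + aval x \<rho> a + aval x \<rho> b), 0, out)"
    by (rule computesD[OF assms(2)]) (use m eb in auto)
  show "runs x (acode (Add a b) d f) (\<rho>, 0, out) (poly (p + q) m) (\<rho>(d := \<rho> d + aval x \<rho> (Add a b)), 0, out)"
    unfolding acode.simps by (rule runs_conv[OF runs_Seq[OF 1 2]]) (auto simp: add.assoc)
qed

lemma computes_Times:
  assumes "computes B a p" "computes B b q" "vars_below B a" "vars_below B b"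
  shows "\<exists>r. computes B (Mul a b) r"
proof -
  obtain pa where pa: "\<And>x \<rho> m. length x \<le> m \<Longrightarrow> (\<And>v. v < B \<Longrightarrow> \<rho> v \<le> m) \<Longrightarrow> aval x \<rho> a \<le> poly pa m"
    using aval_bound'[OF assms(3)] by blast
  have "computes B (Mul a b) (p + pa * (q + [:3:]) + [:1:])"
  proof (rule computesI)
    fix x :: "bool list" and \<rho> :: "nat \<Rightarrow> nat" and m d f and out :: "bool list"
    assume m: "length x \<le> m" "\<And>v. v < B \<Longrightarrow> \<rho> v \<le> m" "B \<le> d" "d < f" "\<And>v. v \<ge> f \<Longrightarrow> \<rho> v = 0"
    let ?n = "aval x \<rho> a" let ?k = "aval x \<rho> b"
    let ?s = "\<lambda>i. (\<rho>(f := ?n - i, d := \<rho> d + i * ?k), 0::int, out)"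
    have 1: "runs x (acode a f (Suc f)) (\<rho>, 0, out) (poly p m) (\<rho>(f := ?n), 0, out)"
      by (rule computesD[OF assms(1)]) (use m in auto)
    have b1: "runs x (Seq (Dec f) (acode b d (Suc f))) (?s i) (1 + poly q m) (?s (Suc i))" if "i < ?n" for i
    proof -
      let ?r = "(\<rho>(f := ?n - i, d := \<rho> d + i * ?k))(f := ?n - i - 1)"
      have eb: "aval x ?r b = aval x \<rho> b" using m(3,4) by (intro aval_cong[OF assms(4)]) auto
      have A: "runs x (Dec f) (?s i) 1 (?r, 0, out)"
        by (rule runs_conv, rule runs_basic) (use m in auto)
      have "runs x (acode b d (Suc f)) (?r, 0, out) (poly q m) (?r(d := \<rho> d + Suc i * ?k), 0, out)"
        by (rule computesD[OF assms(2)]) (use m eb in auto)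
      from runs_Seq[OF A this] show ?thesis
        by (rule runs_conv) (use m in \<open>auto simp: fun_eq_iff\<close>)
    qed
    have w1: "runs x (While (NZ f) (Seq (Dec f) (acode b d (Suc f)))) (?s 0) (?n * (poly q m + 3) + 1) (?s ?n)"
      by (rule runs_While'[where \<sigma> = ?s and n = ?n and T = "1 + poly q m"]) (use b1 m in \<open>auto simp: algebra_simps\<close>)
    have e: "?s 0 = (\<rho>(f := ?n), 0, out)" "?s ?n = (\<rho>(d := \<rho> d + aval x \<rho> (Mul a b)), 0, out)"
      using m by (auto simp: fun_eq_iff)
    have "?n * (poly q m + 3) \<le> poly pa m * (poly q m + 3)"
      using pa[of x m \<rho>] m by (intro mult_right_mono) auto
    then show "runs x (acode (Mul a b) d f) (\<rho>, 0, out) (poly (p + pa * (q + [:3:]) + [:1:]) m)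
       (\<rho>(d := \<rho> d + aval x \<rho> (Mul a b)), 0, out)"
      unfolding acode.simps by (intro runs_Seq'[OF 1 w1[unfolded e]]) simp
  qed
  then show ?thesis by blast
qed

lemma computes_Minus:
  assumes "computes B a p" "computes B b q" "vars_below B a" "vars_below B b"
  shows "\<exists>r. computes B (Sub a b) r"
proof -
  obtain pa where pa: "\<And>x \<rho> m. length x \<le> m \<Longrightarrow> (\<And>v. v < B \<Longrightarrow> \<rho> v \<le> m) \<Longrightarrow> aval x \<rho> a \<le> poly pa m"
    using aval_bound'[OF assms(3)] by blast
  obtain pb where pb: "\<And>x \<rho> m. length x \<le> m \<Longrightarrow> (\<And>v. v < B \<Longrightarrow> \<rho> v \<le> m) \<Longrightarrow> aval x \<rho> b \<le> poly pb m"
    using aval_bound'[OF assms(4)] by blast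
  have "computes B (Sub a b) (p + q + [:4:] * pb + [:4:] * pa + [:2:])"
  proof (rule computesI)
    fix x :: "bool list" and \<rho> :: "nat \<Rightarrow> nat" and m d f and out :: "bool list"
    assume m: "length x \<le> m" "\<And>v. v < B \<Longrightarrow> \<rho> v \<le> m" "B \<le> d" "d < f" "\<And>v. v \<ge> f \<Longrightarrow> \<rho> v = 0"
    let ?n = "aval x \<rho> a" let ?k = "aval x \<rho> b"
    have 1: "runs x (acode a f (Suc f)) (\<rho>, 0, out) (poly p m) (\<rho>(f := ?n), 0, out)"
      by (rule computesD[OF assms(1)]) (use m in auto)
    have eb: "aval x (\<rho>(f := ?n)) b = aval x \<rho> b" using m(3,4) by (intro aval_cong[OF assms(4)]) auto
    have 2: "runs x (acode b (Suc f) (Suc (Suc f))) (\<rho>(f := ?n), 0, out) (poly q m) (\<rho>(f := ?n, Suc f := ?k), 0, out)"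
      by (rule computesD[OF assms(2)]) (use m eb in auto)
    \<comment> \<open>\<open>Dec\<close> leaves 0 unchanged, so the loop computes the truncated
      difference even if \<open>?k\<close> exceeds \<open>?n\<close>.\<close>
    let ?s = "\<lambda>i. (\<rho>(f := ?n - i, Suc f := ?k - i), 0::int, out)"
    have b1: "runs x (Seq (Dec (Suc f)) (Dec f)) (?s i) 2 (?s (Suc i))" if "i < ?k" for i
      by (rule runs_conv, (rule runs_Seq runs_basic)+) (use that in \<open>auto simp: fun_eq_iff\<close>)
    have w1: "runs x (While (NZ (Suc f)) (Seq (Dec (Suc f)) (Dec f))) (?s 0) (?k * 4 + 1) (?s ?k)"
      by (rule runs_While'[where \<sigma> = ?s and n = ?k and T = 2]) (use b1 m in auto)
    let ?t = "\<lambda>i. (\<rho>(f := ?n - ?k - i, d := \<rho> d + i), 0::int, out)"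
    have b2: "runs x (Seq (Dec f) (Inc d)) (?t i) 2 (?t (Suc i))" if "i < ?n - ?k" for i
      by (rule runs_conv, (rule runs_Seq runs_basic)+) (use that m in \<open>auto simp: fun_eq_iff\<close>)
    have w2: "runs x (While (NZ f) (Seq (Dec f) (Inc d))) (?t 0) ((?n - ?k) * 4 + 1) (?t (?n - ?k))"
      by (rule runs_While'[where \<sigma> = ?t and n = "?n - ?k" and T = 2]) (use b2 m in auto)
    have e: "?s 0 = (\<rho>(f := ?n, Suc f := ?k), 0, out)" "?s ?k = ?t 0"
      "?t (?n - ?k) = (\<rho>(d := \<rho> d + aval x \<rho> (Sub a b)), 0, out)"
      using m by (auto simp: fun_eq_iff)
    have le: "?n - ?k \<le> poly pa m" "?k \<le> poly pb m"
      using pa[of x m \<rho>] pb[of x m \<rho>] m by (auto intro: le_trans[OF diff_le_self])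
    have "poly p m + (poly q m + ((?k * 4 + 1) + ((?n - ?k) * 4 + 1))) \<le> poly (p + q + [:4:] * pb + [:4:] * pa + [:2:]) m"
      using mult_le_mono1[OF le(1), of 4] mult_le_mono1[OF le(2), of 4] by (simp del: diff_mult_distrib)
    then show "runs x (acode (Sub a b) d f) (\<rho>, 0, out) (poly (p + q + [:4:] * pb + [:4:] * pa + [:2:]) m)
       (\<rho>(d := \<rho> d + aval x \<rho> (Sub a b)), 0, out)"
      unfolding acode.simps
      by (rule runs_mono[OF runs_Seq[OF 1 runs_Seq[OF 2 runs_Seq[OF w1[unfolded e(1,2)] w2[unfolded e(3)]]]]])
  qed
  then show ?thesis by blast
qed

lemma computes_Inp:
  assumes "computes B a p" "vars_below B a"
  shows "\<exists>r. computes B (Inp a) r"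
proof -
  obtain pa where pa: "\<And>x \<rho> m. length x \<le> m \<Longrightarrow> (\<And>v. v < B \<Longrightarrow> \<rho> v \<le> m) \<Longrightarrow> aval x \<rho> a \<le> poly pa m"
    using aval_bound'[OF assms(2)] by blast
  have "computes B (Inp a) (p + [:9:] * pa + [:8:])"
  proof (rule computesI)
    fix x :: "bool list" and \<rho> :: "nat \<Rightarrow> nat" and m d f and out :: "bool list"
    assume m: "length x \<le> m" "\<And>v. v < B \<Longrightarrow> \<rho> v \<le> m" "B \<le> d" "d < f" "\<And>v. v \<ge> f \<Longrightarrow> \<rho> v = 0"
    let ?n = "aval x \<rho> a"
    let ?c = "word_contents x (int ?n)"
    have 1: "runs x (acode a f (Suc f)) (\<rho>, 0, out) (poly p m) (\<rho>(f := ?n), 0, out)"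
      by (rule computesD[OF assms(1)]) (use m in auto)
    let ?s = "\<lambda>i. (\<rho>(f := ?n - i, Suc f := i), int i, out)"
    have b1: "runs x (Seq (Dec f) (Seq (Inc (Suc f)) IR)) (?s i) 3 (?s (Suc i))" if "i < ?n" for i
      by (rule runs_conv, (rule runs_Seq runs_basic)+) (use that in \<open>auto simp: fun_eq_iff\<close>)
    have w1: "runs x (While (NZ f) (Seq (Dec f) (Seq (Inc (Suc f)) IR))) (?s 0) (?n * 5 + 1) (?s ?n)"
      by (rule runs_While'[where \<sigma> = ?s and n = ?n and T = 3]) (use b1 m in auto)
    let ?r = "\<lambda>k. (\<rho>(Suc f := ?n, d := \<rho> d + k), int ?n, out)"
    have e0: "?s ?n = ?r 0" using m by (auto simp: fun_eq_iff)
    \<comment> \<open>One unit for a nonblank symbol and another one for the symbol 2 add up to the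
      symbol itself, 0, 1 or 2.\<close>
    have c1: "runs x (Cond InNZ (Inc d) Skip) (?r 0) 3 (?r (if ?c \<noteq> 0 then 1 else 0))"
      by (rule runs_conv, rule runs_Cond[where T = 1]; (rule runs_conv, rule runs_basic)?)
        (use m in \<open>auto simp: fun_eq_iff\<close>)
    have c2: "runs x (Cond In2 (Inc d) Skip) (?r (if ?c \<noteq> 0 then 1 else 0)) 3 (?r ?c)"
      by (rule runs_conv, rule runs_Cond[where T = 1]; (rule runs_conv, rule runs_basic)?)
        (use m in \<open>auto simp: fun_eq_iff word_contents_def split: if_splits\<close>)
    let ?t = "\<lambda>i. (\<rho>(Suc f := ?n - i, d := \<rho> d + ?c), int (?n - i), out)"
    have b2: "runs x (Seq (Dec (Suc f)) IL) (?t i) 2 (?t (Suc i))" if "i < ?n" for i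
      by (rule runs_conv, (rule runs_Seq runs_basic)+) (use that m in \<open>auto simp: fun_eq_iff\<close>)
    have w2: "runs x (While (NZ (Suc f)) (Seq (Dec (Suc f)) IL)) (?t 0) (?n * 4 + 1) (?t ?n)"
      by (rule runs_While'[where \<sigma> = ?t and n = ?n and T = 2]) (use b2 m in auto)
    have e: "?s 0 = (\<rho>(f := ?n), 0, out)" "?r ?c = ?t 0"
      "?t ?n = (\<rho>(d := \<rho> d + aval x \<rho> (Inp a)), 0, out)"
      using m by (auto simp: fun_eq_iff)
    have "?n \<le> poly pa m" using pa[of x m \<rho>] m by auto
    then show "runs x (acode (Inp a) d f) (\<rho>, 0, out) (poly (p + [:9:] * pa + [:8:]) m)
       (\<rho>(d := \<rho> d + aval x \<rho> (Inp a)), 0, out)"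
      unfolding acode.simps
      by (intro runs_mono[OF runs_Seq[OF 1 runs_Seq[OF w1[unfolded e(1) e0] runs_Seq[OF c1 runs_Seq[OF c2[unfolded e(2)] w2[unfolded e(3)]]]]]])
        simp
  qed
  then show ?thesis by blast
qed

lemma computes_Len: "computes B Len [:2, 9:]"
proof (rule computesI)
  fix x :: "bool list" and \<rho> :: "nat \<Rightarrow> nat" and m d f and out :: "bool list"
  assume m: "length x \<le> m" "\<And>v. v < B \<Longrightarrow> \<rho> v \<le> m" "B \<le> d" "d < f" "\<And>v. v \<ge> f \<Longrightarrow> \<rho> v = 0"
  let ?n = "length x"
  let ?s = "\<lambda>i. (\<rho>(f := i), int i, out)"
  have b1: "runs x (Seq IR (Inc f)) (?s i) 2 (?s (Suc i))" if "i < ?n" for i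
    by (rule runs_conv, (rule runs_Seq runs_basic)+) (use that in \<open>auto simp: fun_eq_iff\<close>)
  \<comment> \<open>Input bits are the nonblank symbols 1 and 2, so the first blank lies at position
    \<open>length x\<close>.\<close>
  have w1: "runs x (While InNZ (Seq IR (Inc f))) (?s 0) (?n * 4 + 1) (?s ?n)"
    by (rule runs_While'[where \<sigma> = ?s and n = ?n and T = 2]) (use b1 m in \<open>auto simp: word_contents_def\<close>)
  let ?t = "\<lambda>i. (\<rho>(f := ?n - i, d := \<rho> d + i), int (?n - i), out)"
  have b2: "runs x (Seq (Dec f) (Seq (Inc d) IL)) (?t i) 3 (?t (Suc i))" if "i < ?n" for i
    by (rule runs_conv, (rule runs_Seq runs_basic)+) (use that m in \<open>auto simp: fun_eq_iff\<close>)
  have w2: "runs x (While (NZ f) (Seq (Dec f) (Seq (Inc d) IL))) (?t 0) (?n * 5 + 1) (?t ?n)"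
    by (rule runs_While'[where \<sigma> = ?t and n = ?n and T = 3]) (use b2 m in auto)
  have e: "?s 0 = (\<rho>, 0, out)" "?s ?n = ?t 0" "?t ?n = (\<rho>(d := \<rho> d + aval x \<rho> Len), 0, out)"
    using m by (auto simp: fun_eq_iff)
  show "runs x (acode Len d f) (\<rho>, 0, out) (poly [:2, 9:] m) (\<rho>(d := \<rho> d + aval x \<rho> Len), 0, out)"
    unfolding acode.simps
    by (intro runs_mono[OF runs_Seq[OF w1[unfolded e] w2[unfolded e]]]) (use m in auto)
qed

lemma computes_Sum:
  assumes "computes B a p" "computes B b q" "vars_below B a" "vars_below B b" and v: "v < B"
  shows "\<exists>r. computes B (BSum v a b) r"
proof -
  obtain pa where pa: "\<And>x \<rho> m. length x \<le> m \<Longrightarrow> (\<And>v. v < B \<Longrightarrow> \<rho> v \<le> m) \<Longrightarrow> aval x \<rho> a \<le> poly pa m"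
    using aval_bound'[OF assms(3)] by blast
  let ?q = "pcompose q ([:0, 1:] + pa)"
  have "computes B (BSum v a b) (p + pa * (?q + [:4:]) + [:0, 8:] + [:3:] * pa + [:4:])"
  proof (rule computesI)
    fix x :: "bool list" and \<rho> :: "nat \<Rightarrow> nat" and m d f and out :: "bool list"
    assume m: "length x \<le> m" "\<And>v. v < B \<Longrightarrow> \<rho> v \<le> m" "B \<le> d" "d < f" "\<And>v. v \<ge> f \<Longrightarrow> \<rho> v = 0"
    let ?n = "aval x \<rho> a" let ?k = "\<rho> v"
    have ne: "v \<noteq> d" "v \<noteq> f" "d \<noteq> f" "\<rho> f = 0" "d \<noteq> v" "f \<noteq> v" "f \<noteq> d" "v \<noteq> Suc f" "Suc f \<noteq> v" "Suc f \<noteq> d" "d \<noteq> Suc f"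
      "\<rho> (Suc f) = 0"
      using v m by auto
    have n: "?n \<le> poly pa m" using pa[of x m \<rho>] m by auto
    have 1: "runs x (acode a f (Suc f)) (\<rho>, 0, out) (poly p m) (\<rho>(f := ?n), 0, out)"
      by (rule computesD[OF assms(1)]) (use m in auto)
    \<comment> \<open>The summation variable may carry an outer value, which is parked in
      \<open>Suc f\<close> while \<open>v\<close> runs upwards through the range and
      \<open>f\<close> counts down.\<close>
    let ?s = "\<lambda>i. (\<rho>(f := ?n, v := ?k - i, Suc f := i), 0::int, out)"
    have b1: "runs x (Seq (Dec v) (Inc (Suc f))) (?s i) 2 (?s (Suc i))" if "i < ?k" for i
      by (rule runs_conv, (rule runs_Seq runs_basic)+) (use that ne in \<open>auto simp: fun_eq_iff\<close>)
    have w1: "runs x (While (NZ v) (Seq (Dec v) (Inc (Suc f)))) (?s 0) (?k * 4 + 1) (?s ?k)"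
      by (rule runs_While'[where \<sigma> = ?s and n = ?k and T = 2]) (use b1 m ne in auto)
    let ?S = "\<lambda>i. \<Sum>j<i. aval x (\<rho>(v := j)) b"
    let ?t = "\<lambda>i. (\<rho>(f := ?n - i, v := i, Suc f := ?k, d := \<rho> d + ?S i), 0::int, out)"
    have b2: "runs x (Seq (Dec f) (Seq (acode b d (Suc (Suc f))) (Inc v))) (?t i) (1 + (poly q (m + poly pa m) + 1)) (?t (Suc i))"
      if i: "i < ?n" for i
    proof -
      let ?r = "(\<rho>(f := ?n - i, v := i, Suc f := ?k, d := \<rho> d + ?S i))(f := ?n - i - 1)"
      have eb: "aval x ?r b = aval x (\<rho>(v := i)) b" using m(3,4) v by (intro aval_cong[OF assms(4)]) auto
      have A: "runs x (Dec f) (?t i) 1 (?r, 0, out)"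
        by (rule runs_conv, rule runs_basic) (use ne in auto)
      have le: "?r u \<le> m + poly pa m" if "u < B" for u
        using m(2)[OF that] that m(3,4) i n by (auto simp: trans_le_add1)
      have z: "?r w = 0" if "w \<ge> Suc (Suc f)" for w
        using that m(3-5) v by auto
      have Bb: "runs x (acode b d (Suc (Suc f))) (?r, 0, out) (poly q (m + poly pa m)) (?r(d := \<rho> d + ?S (Suc i)), 0, out)"
        by (rule computesD[OF assms(2)]) (use m eb ne le z in auto)
      show ?thesis
        by (rule runs_conv[OF runs_Seq[OF A runs_Seq[OF Bb runs_basic(2)]]]) (use ne in \<open>auto simp: fun_eq_iff\<close>)
    qed
    have w2: "runs x (While (NZ f) (Seq (Dec f) (Seq (acode b d (Suc (Suc f))) (Inc v)))) (?t 0) (?n * (poly q (m + poly pa m) + 4) + 1) (?t ?n)"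
    proof (rule runs_While'[where \<sigma> = ?t and n = ?n and T = "1 + (poly q (m + poly pa m) + 1)"])
      show "holds x (NZ f) (?t i)" if "i < ?n" for i using that ne by simp
      show "\<not> holds x (NZ f) (?t ?n)" using ne by simp
      show "?n * (1 + (poly q (m + poly pa m) + 1) + 2) + 1 \<le> ?n * (poly q (m + poly pa m) + 4) + 1"
        by (simp add: algebra_simps)
    qed (use b2 in simp_all)
    let ?u = "\<lambda>i. (\<rho>(v := ?n - i, Suc f := ?k, d := \<rho> d + ?S ?n), 0::int, out)"
    have b3: "runs x (Dec v) (?u i) 1 (?u (Suc i))" if "i < ?n" for i
      by (rule runs_conv, rule runs_basic) (use that ne in \<open>auto simp: fun_eq_iff\<close>)
    have w3: "runs x (While (NZ v) (Dec v)) (?u 0) (?n * 3 + 1) (?u ?n)"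
      by (rule runs_While'[where \<sigma> = ?u and n = ?n and T = 1]) (use b3 m ne in auto)
    let ?w = "\<lambda>i. (\<rho>(v := i, Suc f := ?k - i, d := \<rho> d + ?S ?n), 0::int, out)"
    have b4: "runs x (Seq (Dec (Suc f)) (Inc v)) (?w i) 2 (?w (Suc i))" if "i < ?k" for i
      by (rule runs_conv, (rule runs_Seq runs_basic)+) (use that ne in \<open>auto simp: fun_eq_iff\<close>)
    have w4: "runs x (While (NZ (Suc f)) (Seq (Dec (Suc f)) (Inc v))) (?w 0) (?k * 4 + 1) (?w ?k)"
      by (rule runs_While'[where \<sigma> = ?w and n = ?k and T = 2]) (use b4 m ne in auto)
    have e: "?s 0 = (\<rho>(f := ?n), 0, out)" "?s ?k = ?t 0" "?t ?n = ?u 0" "?u ?n = ?w 0"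
      "?w ?k = (\<rho>(d := \<rho> d + aval x \<rho> (BSum v a b)), 0, out)"
      using ne by (auto simp: fun_eq_iff)
    have "?n * (poly q (m + poly pa m) + 4) \<le> poly pa m * (poly q (m + poly pa m) + 4)"
      using n by (intro mult_right_mono) auto
    moreover have "?k \<le> m" using m v by auto
    ultimately show "runs x (acode (BSum v a b) d f) (\<rho>, 0, out)
       (poly (p + pa * (?q + [:4:]) + [:0, 8:] + [:3:] * pa + [:4:]) m)
       (\<rho>(d := \<rho> d + aval x \<rho> (BSum v a b)), 0, out)"
      unfolding acode.simps using n
      by (intro runs_mono[OF runs_Seq[OF 1 runs_Seq[OF w1[unfolded e(1,2)]
          runs_Seq[OF w2[unfolded e(3)] runs_Seq[OF w3[unfolded e(4)] w4[unfolded e(5)]]]]]])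
        (simp add: poly_pcompose algebra_simps)
  qed
  then show ?thesis by blast
qed

lemma computes_exists: "vars_below B e \<Longrightarrow> \<exists>q. computes B e q"
proof (induction e)
  case (Add a b) then show ?case using computes_Plus by fastforce
next
  case (Mul a b) then show ?case using computes_Times by fastforce
next
  case (Sub a b) then show ?case using computes_Minus by fastforce
next
  case (Inp a) then show ?case using computes_Inp by fastforce
next
  case (BSum v a b) then show ?case using computes_Sum by fastforce
next
  case (Var v) then show ?case using computes_V[of v B] by auto
next
  case (Cst n) then show ?case using computes_K by blast
next
  case Len then show ?case using computes_Len by blast
qed

section \<open>Turing machines simulating counter programs\<close>

datatype instr = IInc nat | IDec nat | IIR | IIL | IOut bool | IBr test nat nat

text \<open>The second argument is the address of the first instruction, since jump targets are
  absolute. A branch with two equal targets serves as an unconditional jump.\<close>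

fun code :: "com \<Rightarrow> nat \<Rightarrow> instr list" where
  "code Skip a = []"
| "code (Inc v) a = [IInc v]"
| "code (Dec v) a = [IDec v]"
| "code IR a = [IIR]"
| "code IL a = [IIL]"
| "code (Out b) a = [IOut b]"
| "code (Seq c c') a = (let k = code c a in k @ code c' (a + length k))"
| "code (Cond b c c') a = (let k = code c (Suc a); e = Suc (Suc (a + length k)); k' = code c' e in
     IBr b (Suc a) e # k @ IBr b (e + length k') (e + length k') # k')"
| "code (While b c) a = (let k = code c (Suc a) in
     IBr b (Suc a) (Suc (Suc (a + length k))) # k @ [IBr b a a])"

fun regs_below :: "nat \<Rightarrow> com \<Rightarrow> bool" where
  "regs_below R (Inc v) \<longleftrightarrow> v < R"
| "regs_below R (Dec v) \<longleftrightarrow> v < R"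
| "regs_below R (Seq c c') \<longleftrightarrow> regs_below R c \<and> regs_below R c'"
| "regs_below R (Cond b c c') \<longleftrightarrow> (\<forall>v. b = NZ v \<longrightarrow> v < R) \<and> regs_below R c \<and> regs_below R c'"
| "regs_below R (While b c) \<longleftrightarrow> (\<forall>v. b = NZ v \<longrightarrow> v < R) \<and> regs_below R c"
| "regs_below R _ \<longleftrightarrow> True"

lemma regs_below_mono: "regs_below R c \<Longrightarrow> R \<le> R' \<Longrightarrow> regs_below R' c"
  by (induction R c rule: regs_below.induct) auto

lemma regs_below_exists: "\<exists>R. regs_below R c"
proof (induction c)
  case (Inc v) then show ?case by (auto intro: exI[of _ "Suc v"])
next
  case (Dec v) then show ?case by (auto intro: exI[of _ "Suc v"])
next
  case (Seq c c')
  then obtain R R' where "regs_below R c" "regs_below R' c'" by blast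
  then show ?case by (intro exI[of _ "max R R'"]) (auto intro: regs_below_mono)
next
  case (Cond b c c')
  then obtain R R' where "regs_below R c" "regs_below R' c'" by blast
  then have "regs_below (Suc (case b of NZ v \<Rightarrow> v | _ \<Rightarrow> 0) + (R + R')) (Cond b c c')"
    by (auto intro: regs_below_mono)
  then show ?case by blast
next
  case (While b c)
  then obtain R where "regs_below R c" by blast
  then have "regs_below (Suc (case b of NZ v \<Rightarrow> v | _ \<Rightarrow> 0) + R) (While b c)"
    by (auto intro: regs_below_mono)
  then show ?case by blast
qed auto

text \<open>A counter is the head position of its own tape, on which cell 0 carries the mark 1.\<close>

definition mark :: "int \<Rightarrow> nat" where
  "mark = (\<lambda>_. 0)(0 := 1)"

fun seen :: "nat list \<Rightarrow> test \<Rightarrow> bool" where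
  "seen s (NZ v) \<longleftrightarrow> s ! Suc v \<noteq> 1"
| "seen s InNZ \<longleftrightarrow> s ! 0 \<noteq> 0"
| "seen s In2 \<longleftrightarrow> s ! 0 = 2"

fun next_pc :: "nat list \<Rightarrow> instr \<Rightarrow> nat \<Rightarrow> nat" where
  "next_pc s (IBr b m n) a = (if seen s b then m else n)"
| "next_pc s _ a = Suc a"

fun action :: "nat \<Rightarrow> nat list \<Rightarrow> instr \<Rightarrow> nat \<Rightarrow> nat \<times> int" where
  "action R s (IInc v) i = (s ! i, if i = Suc v then 1 else 0)"
| "action R s (IDec v) i = (s ! i, if i = Suc v \<and> s ! i \<noteq> 1 then -1 else 0)"
| "action R s IIR i = (s ! i, if i = 0 then 1 else 0)"
| "action R s IIL i = (s ! i, if i = 0 then -1 else 0)"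
| "action R s (IOut b) i = (if i = Suc R then (if b then 2 else 1, 1) else (s ! i, 0))"
| "action R s (IBr b m n) i = (s ! i, 0)"

definition nt :: "nat \<Rightarrow> nat" where
  "nt R = R + 2"

lemma nt_simps [simp]: "0 < nt R" "v < R \<Longrightarrow> Suc v < nt R" "Suc R < nt R" "nt R \<noteq> 0"
  by (auto simp: nt_def)

lemma lt_nt_iff: "i < nt R \<longleftrightarrow> i = 0 \<or> (\<exists>v<R. i = Suc v) \<or> i = Suc R"
  unfolding nt_def by (cases i) auto

text \<open>Tape 0 holds the input, tapes 1 to \<open>R\<close> the counters and tape
  \<open>R + 1\<close> the output. State 0 only writes the marks on the counter tapes; state
  \<open>Suc a\<close> executes instruction \<open>a\<close>, and the last state halts. The
  \<open>min\<close> keeps targets inside the state set for an arbitrary list \<open>P\<close>, as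
  well-formedness demands.\<close>

definition machine :: "nat \<Rightarrow> instr list \<Rightarrow> ntm" where
  "machine R P = \<lparr>tapes = nt R, states = length P + 2, symbols = 3, accepting = {},
     delta = (\<lambda>q s. if q = 0
       then {(1, map (\<lambda>i. (if 0 < i \<and> i \<le> R then 1 else s ! i, 0)) [0..<nt R])}
       else if q - 1 < length P
       then {(Suc (min (next_pc s (P ! (q - 1)) (q - 1)) (length P)),
              map (action R s (P ! (q - 1))) [0..<nt R])}
       else {})\<rparr>"

lemma action_wf:
  assumes "length s = nt R" "set s \<subseteq> {..<3}" "i < nt R"
  shows "action R s I i \<in> {..<3} \<times> {-1, 0, 1}"
proof -
  have "s ! i \<in> set s" using assms by simp
  then have "s ! i < 3" using assms(2) by auto
  then show ?thesis by (cases I) auto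
qed

lemma machine_wf: "wf_ntm (machine R P)"
proof -
  have "s ! i < 3" if "length s = nt R" "set s \<subseteq> {..<3}" "i < nt R" for s :: "nat list" and i
  proof -
    have "s ! i \<in> set s" using that by simp
    then show ?thesis using that(2) by auto
  qed
  then show ?thesis
    unfolding wf_ntm_def machine_def using action_wf[where R = R]
    by (auto split: if_splits simp: image_subset_iff simp del: mem_Sigma_iff) (auto simp: nt_def)
qed

lemma machine_deterministic: "deterministic (machine R P)"
  unfolding deterministic_def machine_def by auto

fun tape_of :: "nat \<Rightarrow> bool list \<Rightarrow> st \<Rightarrow> nat \<Rightarrow> tape" where
  "tape_of R x (\<rho>, p, out) i = (if i = 0 then (p, word_contents x)
     else if i \<le> R then (int (\<rho> (i - 1)), mark) else (int (length out), word_contents out))"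

definition conf :: "nat \<Rightarrow> bool list \<Rightarrow> nat \<Rightarrow> st \<Rightarrow> config" where
  "conf R x a s = (Suc a, map (tape_of R x s) [0..<nt R])"

lemma step_machine:
  assumes "P ! a = I" "a < length P"
    "a' = next_pc (map read (map (tape_of R x s) [0..<nt R])) I a" "a' \<le> length P"
    "\<And>i. i < nt R \<Longrightarrow> act (action R (map read (map (tape_of R x s) [0..<nt R])) I i) (tape_of R x s i) = tape_of R x s' i"
  shows "step (machine R P) (conf R x a s) (conf R x a' s')"
proof -
  let ?r = "map read (map (tape_of R x s) [0..<nt R])"
  have "map2 act (map (action R (map read (map (tape_of R x s) [0..<nt R])) I) [0..<nt R])
      (map (tape_of R x s) [0..<nt R]) = map (tape_of R x s') [0..<nt R]"
    by (rule nth_equalityI) (use assms(5) in auto)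
  then show ?thesis
    unfolding step_def machine_def conf_def using assms(1-4) by (simp add: min_absorb1 del: map_map)
qed

lemma act_stay: "act (read t, 0) t = t"
  unfolding act_def read_def by simp

lemma read_mark: "read (int n, mark) = (if n = 0 then 1 else 0)"
  unfolding read_def mark_def by simp

lemma word_contents_snoc:
  "(word_contents xs)(int (length xs) := (if b then 2 else 1)) = word_contents (xs @ [b])"
  unfolding word_contents_def by (auto simp: fun_eq_iff nth_append)

lemma nth_reads: "i < nt R \<Longrightarrow> map read (map (tape_of R x s) [0..<nt R]) ! i = read (tape_of R x s i)"
  by simp

lemma seen_reads:
  assumes "\<And>v. b = NZ v \<Longrightarrow> v < R"
  shows "seen (map read (map (tape_of R x s) [0..<nt R])) b = holds x b s"
proof (cases s)
  case (fields \<rho> p out)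
  show ?thesis
  proof (cases b)
    case (NZ v)
    then have "v < R" using assms by simp
    then show ?thesis using NZ fields by (simp add: nth_reads read_mark del: map_map)
  qed (simp_all add: nth_reads fields read_def del: map_map)
qed

abbreviation "steps R P n c c' \<equiv> (step (machine R P) ^^ n) c c'"

lemma steps_basic:
  assumes "regs_below R c" "c \<in> {Inc v, Dec v, IR, IL, Out b}" "big x c s t s'"
    "a < length P" "[P ! a] = code c a"
  shows "steps R P t (conf R x a s) (conf R x (Suc a) s')"
proof -
  obtain \<rho> p out where s: "s = (\<rho>, p, out)" by (cases s)
  have "t = 1 \<and> step (machine R P) (conf R x a s) (conf R x (Suc a) s')"
    using assms(2)
  proof (elim insertE emptyE)
    assume c: "c = Inc v"
    then have t: "t = 1" "s' = (\<rho>(v := Suc (\<rho> v)), p, out)" "P ! a = IInc v" "v < R"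
      using assms s by (auto elim: big.cases)
    show ?thesis unfolding s t(2)
      by (intro conjI t(1) step_machine[OF t(3) assms(4)])
        (use assms(4) t(4) in \<open>auto simp: nth_reads lt_nt_iff act_stay read_mark act_def read_def simp del: map_map\<close>)
  next
    assume c: "c = Dec v"
    then have t: "t = 1" "s' = (\<rho>(v := \<rho> v - 1), p, out)" "P ! a = IDec v" "v < R"
      using assms s by (auto elim: big.cases)
    show ?thesis unfolding s t(2)
      by (intro conjI t(1) step_machine[OF t(3) assms(4)])
        (use assms(4) t(4) in \<open>auto simp: nth_reads lt_nt_iff act_stay act_def read_def mark_def simp del: map_map\<close>)
  next
    assume c: "c = IR"
    then have t: "t = 1" "s' = (\<rho>, p + 1, out)" "P ! a = IIR"
      using assms s by (auto elim: big.cases)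
    show ?thesis unfolding s t(2)
      by (intro conjI t(1) step_machine[OF t(3) assms(4)])
        (use assms(4) in \<open>auto simp: nth_reads lt_nt_iff act_def read_def simp del: map_map\<close>)
  next
    assume c: "c = IL"
    then have t: "t = 1" "s' = (\<rho>, p - 1, out)" "P ! a = IIL"
      using assms s by (auto elim: big.cases)
    show ?thesis unfolding s t(2)
      by (intro conjI t(1) step_machine[OF t(3) assms(4)])
        (use assms(4) in \<open>auto simp: nth_reads lt_nt_iff act_def read_def simp del: map_map\<close>)
  next
    assume c: "c = Out b"
    then have t: "t = 1" "s' = (\<rho>, p, out @ [b])" "P ! a = IOut b"
      using assms s by (auto elim: big.cases)
    show ?thesis unfolding s t(2)
      by (intro conjI t(1) step_machine[OF t(3) assms(4)])
        (use assms(4) word_contents_snoc[of out b] in \<open>auto simp: nth_reads lt_nt_iff act_def read_def simp del: map_map\<close>)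
  qed
  then show ?thesis by (simp add: OO_def)
qed

lemma steps_branch:
  assumes "a < length P" "P ! a = IBr b m n" "\<And>v. b = NZ v \<Longrightarrow> v < R" "a' = (if holds x b s then m else n)" "a' \<le> length P"
  shows "step (machine R P) (conf R x a s) (conf R x a' s)"
  by (rule step_machine) (use assms in \<open>auto simp: nth_reads act_stay seen_reads simp del: map_map\<close>)

lemma steps_trans: "steps R P m c c' \<Longrightarrow> steps R P n c' c'' \<Longrightarrow> steps R P (m + n) c c''"
  by (auto simp: relpowp_add)

lemma steps_Suc: "step (machine R P) c c' \<Longrightarrow> steps R P n c' c'' \<Longrightarrow> steps R P (Suc n) c c''"
  by (metis relpowp_Suc_I2)

text \<open>Induction on the execution. The prefix \<open>pre\<close> fixes the address at which the
  code is placed, so that absolute targets agree; the number of steps is exact because the costs of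
  \<open>big\<close> were chosen to match.\<close>

lemma code_correct:
  assumes "big x c s t s'" "regs_below R c" "P = pre @ code c (length pre) @ post"
  shows "steps R P t (conf R x (length pre) s) (conf R x (length pre + length (code c (length pre))) s')"
  using assms
proof (induction arbitrary: pre post rule: big.induct)
  case (Seq c s t s' c' t' s'')
  let ?k = "code c (length pre)"
  have "steps R P t (conf R x (length pre) s) (conf R x (length pre + length ?k) s')"
    using Seq.prems by (intro Seq.IH(1)) (auto simp: Let_def)
  moreover have "steps R P t' (conf R x (length (pre @ ?k)) s')
      (conf R x (length (pre @ ?k) + length (code c' (length (pre @ ?k)))) s'')"
    using Seq.prems by (intro Seq.IH(2)[of _ post]) (auto simp: Let_def)
  ultimately have "steps R P (t + t') (conf R x (length pre) s)
      (conf R x (length (pre @ ?k) + length (code c' (length (pre @ ?k)))) s'')"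
    using steps_trans by simp
  then show ?case by (simp add: Let_def add.assoc)
next
  case (IfT b s c t s' c')
  let ?n = "length pre" let ?k = "code c (Suc ?n)" let ?e = "Suc (Suc (?n + length ?k))" let ?k' = "code c' ?e"
  let ?br = "IBr b (Suc ?n) ?e" let ?f = "?e + length ?k'"
  have P: "P = pre @ (?br # ?k @ IBr b ?f ?f # ?k') @ post" using IfT.prems by (simp add: Let_def)
  have 1: "step (machine R P) (conf R x ?n s) (conf R x (Suc ?n) s)"
    by (rule steps_branch) (use IfT.prems(1) IfT.hyps(1) in \<open>auto simp: P nth_append\<close>)
  have 2: "steps R P t (conf R x (length (pre @ [?br])) s) (conf R x (length (pre @ [?br]) + length (code c (length (pre @ [?br])))) s')"
    by (rule IfT.IH[where post = "IBr b ?f ?f # ?k' @ post"]) (use IfT.prems(1) in \<open>simp_all add: P\<close>)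
  have 3: "step (machine R P) (conf R x (Suc ?n + length ?k) s') (conf R x ?f s')"
    by (rule steps_branch) (use IfT.prems(1) in \<open>auto simp: P nth_append\<close>)
  have "steps R P (t + 2) (conf R x ?n s) (conf R x ?f s')"
  proof -
    have "steps R P (Suc t) (conf R x ?n s) (conf R x (Suc ?n + length ?k) s')"
      using steps_Suc[OF 1] 2 by simp
    from relpowp_Suc_I[OF this 3] show ?thesis by simp
  qed
  then show ?case by (simp add: Let_def add.assoc)
next
  case (IfF b s c' t s' c)
  let ?n = "length pre" let ?k = "code c (Suc ?n)" let ?e = "Suc (Suc (?n + length ?k))" let ?k' = "code c' ?e"
  let ?br = "IBr b (Suc ?n) ?e" let ?f = "?e + length ?k'"
  have P: "P = pre @ (?br # ?k @ IBr b ?f ?f # ?k') @ post" using IfF.prems by (simp add: Let_def)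
  have 1: "step (machine R P) (conf R x ?n s) (conf R x ?e s)"
    by (rule steps_branch) (use IfF.prems(1) IfF.hyps(1) in \<open>auto simp: P nth_append\<close>)
  let ?pre = "pre @ ?br # ?k @ [IBr b ?f ?f]"
  have 2: "steps R P t (conf R x (length ?pre) s) (conf R x (length ?pre + length (code c' (length ?pre))) s')"
    by (rule IfF.IH[where post = post]) (use IfF.prems(1) in \<open>simp_all add: P\<close>)
  have "steps R P (Suc t) (conf R x ?n s) (conf R x ?f s')"
    using steps_Suc[OF 1] 2 by simp
  then show ?case by (simp add: Let_def add.assoc)
next
  case (WhileF b s c)
  let ?n = "length pre" let ?k = "code c (Suc ?n)"
  have "step (machine R P) (conf R x ?n s) (conf R x (Suc (Suc (?n + length ?k))) s)"
    by (rule steps_branch) (use WhileF.prems(1) WhileF.hyps(1) in \<open>auto simp: WhileF.prems(2) nth_append Let_def\<close>)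
  then show ?case by (simp add: Let_def OO_def)
next
  case (WhileT b s c t s' t' s'')
  let ?n = "length pre" let ?k = "code c (Suc ?n)" let ?br = "IBr b (Suc ?n) (Suc (Suc (?n + length ?k)))"
  have P: "P = pre @ (?br # ?k @ [IBr b ?n ?n]) @ post" using WhileT.prems by (simp add: Let_def)
  have 1: "step (machine R P) (conf R x ?n s) (conf R x (Suc ?n) s)"
    by (rule steps_branch) (use WhileT.prems(1) WhileT.hyps(1) in \<open>auto simp: P nth_append\<close>)
  have 2: "steps R P t (conf R x (length (pre @ [?br])) s) (conf R x (length (pre @ [?br]) + length (code c (length (pre @ [?br])))) s')"
    by (rule WhileT.IH(1)[where post = "IBr b ?n ?n # post"]) (use WhileT.prems(1) in \<open>simp_all add: P\<close>)
  have 3: "step (machine R P) (conf R x (Suc ?n + length ?k) s') (conf R x ?n s')"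
    by (rule steps_branch) (use WhileT.prems(1) in \<open>auto simp: P nth_append\<close>)
  have 4: "steps R P t' (conf R x ?n s') (conf R x (?n + length (code (While b c) ?n)) s'')"
    by (rule WhileT.IH(2)[OF WhileT.prems])
  have "steps R P (Suc t) (conf R x ?n s) (conf R x (Suc ?n + length ?k) s')"
    using steps_Suc[OF 1] 2 by simp
  from steps_trans[OF this steps_Suc[OF 3 4]] show ?case by simp
next
  case (Skip s)
  then show ?case by simp
next
  case (Inc v \<rho> p out)
  have "steps R P 1 (conf R x (length pre) (\<rho>, p, out)) (conf R x (Suc (length pre)) (\<rho>(v := Suc (\<rho> v)), p, out))"
    by (rule steps_basic[of _ "com.Inc v" v]) (use Inc in \<open>auto intro: big.Inc simp del: One_nat_def\<close>)
  then show ?case by simp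
next
  case (Dec v \<rho> p out)
  have "steps R P 1 (conf R x (length pre) (\<rho>, p, out)) (conf R x (Suc (length pre)) (\<rho>(v := \<rho> v - 1), p, out))"
    by (rule steps_basic[of _ "com.Dec v" v]) (use Dec in \<open>auto intro: big.Dec simp del: One_nat_def\<close>)
  then show ?case by simp
next
  case (IR \<rho> p out)
  have "steps R P 1 (conf R x (length pre) (\<rho>, p, out)) (conf R x (Suc (length pre)) (\<rho>, p + 1, out))"
    by (rule steps_basic[of _ com.IR]) (use IR in \<open>auto intro: big.IR simp del: One_nat_def\<close>)
  then show ?case by simp
next
  case (IL \<rho> p out)
  have "steps R P 1 (conf R x (length pre) (\<rho>, p, out)) (conf R x (Suc (length pre)) (\<rho>, p - 1, out))"
    by (rule steps_basic[of _ com.IL]) (use IL in \<open>auto intro: big.IL simp del: One_nat_def\<close>)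
  then show ?case by simp
next
  case (Out b \<rho> p out)
  have "steps R P 1 (conf R x (length pre) (\<rho>, p, out)) (conf R x (Suc (length pre)) (\<rho>, p, out @ [b]))"
    by (rule steps_basic[of _ "com.Out b" _ b]) (use Out in \<open>auto intro: big.Out simp del: One_nat_def\<close>)
  then show ?case by simp
qed

lemma step_init: "step (machine R P) (init_config (machine R P) x) (conf R x 0 (\<lambda>_. 0, 0, []))"
proof -
  let ?t = "\<lambda>i::nat. if i = 0 then (0::int, word_contents x) else (0, \<lambda>_. 0)"
  have i: "init_config (machine R P) x = (0, map ?t [0..<nt R])"
    unfolding init_config_def machine_def
    by (auto intro!: nth_equalityI simp: nth_Cons' nt_def simp del: upt_Suc)
  have "map2 act (map (\<lambda>i. (if 0 < i \<and> i \<le> R then 1 else map read (map ?t [0..<nt R]) ! i, 0)) [0..<nt R]) (map ?t [0..<nt R])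
     = map (tape_of R x (\<lambda>_. 0, 0, [])) [0..<nt R]"
    by (rule nth_equalityI)
      (auto simp: lt_nt_iff act_def read_def mark_def word_contents_def fun_eq_iff)
  then show ?thesis
    unfolding i step_def conf_def unfolding machine_def by (simp del: map_map)
qed

lemma poly_time_computableI:
  assumes "\<And>x. runs x c (\<lambda>_. 0, 0, []) (poly q (length x)) (\<rho> x, p x, f x)"
  shows "poly_time_computable f"
proof -
  obtain R where R: "regs_below R c" using regs_below_exists by blast
  let ?P = "code c 0" let ?M = "machine R ?P"
  show ?thesis
    unfolding poly_time_computable_def
  proof (intro exI[of _ ?M] exI[of _ "q + [:1:]"] conjI allI machine_wf machine_deterministic)
    fix x
    obtain t where t: "t \<le> poly q (length x)" "big x c (\<lambda>_. 0, 0, []) t (\<rho> x, p x, f x)"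
      using assms[of x] unfolding runs_def by blast
    let ?c = "conf R x (length ?P) (\<rho> x, p x, f x)"
    have "steps R ?P t (conf R x 0 (\<lambda>_. 0, 0, [])) ?c"
      using code_correct[OF t(2) R, of ?P "[]" "[]"] by simp
    then have "steps R ?P (Suc t) (init_config ?M x) ?c" using step_init steps_Suc by blast
    moreover have "halted ?M ?c"
      unfolding halted_def step_def conf_def machine_def by simp
    moreover have "snd (last (snd ?c)) = word_contents (f x)"
      unfolding conf_def by (simp add: last_map nt_def)
    ultimately show "\<exists>t\<le>poly (q + [:1:]) (length x). \<exists>c. (step ?M ^^ t) (init_config ?M x) c \<and> halted ?M c \<and>
        snd (last (snd c)) = word_contents (f x)"
      using t(1) by (intro exI[of _ "Suc t"] conjI exI[of _ ?c]) simp_all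
  qed
qed

text \<open>This reduces polynomial-time computability of a bit string to giving its length and its
  \<open>i\<close>-th bit as expressions, where variable 0 carries \<open>i\<close>.\<close>

lemma poly_time_computable_map:
  "poly_time_computable (\<lambda>x. map (\<lambda>i. aval x ((\<lambda>_. 0)(0 := i)) eb \<noteq> 0) [0..<aval x (\<lambda>_. 0) el])"
proof -
  obtain B1 B2 where "vars_below B1 eb" "vars_below B2 el" using vars_below_exists by meson
  then obtain B where B: "vars_below B eb" "vars_below B el" "0 < B"
    using vars_below_mono[of B1 eb "Suc (B1 + B2)"] vars_below_mono[of B2 el "Suc (B1 + B2)"] by auto
  obtain p where p: "\<And>x \<rho> m. length x \<le> m \<Longrightarrow> (\<And>v. v < B \<Longrightarrow> \<rho> v \<le> m) \<Longrightarrow> aval x \<rho> el \<le> poly p m"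
    using aval_bound'[OF B(2)] by blast
  obtain pb where pb: "\<And>x \<rho> m. length x \<le> m \<Longrightarrow> (\<And>v. v < B \<Longrightarrow> \<rho> v \<le> m) \<Longrightarrow> aval x \<rho> eb \<le> poly pb m"
    using aval_bound'[OF B(1)] by blast
  obtain q qb where q: "computes B el q" and qb: "computes B eb qb" using computes_exists B by blast
  let ?D = "Suc B" let ?F = "Suc ?D"
  \<comment> \<open>Register \<open>B\<close> counts the bits still to be written, register 0 is the
    index of the current bit, \<open>?D\<close> receives its value, and the registers from
    \<open>?F\<close> on are scratch space.\<close>
  let ?body = "Seq (Dec B) (Seq (acode eb ?D ?F) (Seq (Cond (NZ ?D) (Out True) (Out False))
     (Seq (While (NZ ?D) (Dec ?D)) (Inc 0))))"
  let ?c = "Seq (acode el B ?F) (While (NZ B) ?body)"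
  let ?N = "[:0, 1:] + p"
  let ?U = "pcompose qb ?N + [:3:] * pcompose pb ?N + [:8:]"
  show ?thesis
  proof (rule poly_time_computableI)
    fix x
    let ?n = "aval x (\<lambda>_. 0) el" let ?m = "length x + poly p (length x)"
    let ?e = "\<lambda>i. aval x ((\<lambda>_. 0)(0 := i)) eb"
    let ?o = "\<lambda>i. map (\<lambda>i. ?e i \<noteq> 0) [0..<i]"
    let ?r = "\<lambda>i d. (\<lambda>_. 0)(B := ?n - i, 0 := i, ?D := d)"
    let ?s = "\<lambda>i. (?r i 0, 0::int, ?o i)"
    have n: "?n \<le> poly p (length x)" by (rule p) auto
    have 1: "runs x (acode el B ?F) (\<lambda>_. 0, 0, []) (poly q (length x)) ((\<lambda>_. 0)(B := ?n), 0, [])"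
      by (rule computesD[OF q]) auto
    have b: "runs x ?body (?s i) (poly ?U (length x)) (?s (Suc i))" if i: "i < ?n" for i
    proof -
      let ?r1 = "(\<lambda>_. 0)(B := ?n - Suc i, 0 := i, ?D := 0)"
      have e: "aval x ?r1 eb = ?e i" using B(3) by (intro aval_cong[OF B(1)]) auto
      have le: "?r1 u \<le> ?m" if "u < B" for u using that n i by auto
      have A: "runs x (Dec B) (?s i) 1 (?r1, 0, ?o i)"
        by (rule runs_conv, rule runs_basic) (use B in auto)
      have C: "runs x (acode eb ?D ?F) (?r1, 0, ?o i) (poly qb ?m) (?r1(?D := ?e i), 0, ?o i)"
        by (rule computesD[OF qb]) (use le e B in auto)
      have O: "runs x (Cond (NZ ?D) (Out True) (Out False)) (?r1(?D := ?e i), 0, ?o i) (1 + 2) (?r1(?D := ?e i), 0, ?o (Suc i))"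
        by (rule runs_Cond; rule runs_conv, rule runs_basic) (use B in auto)
      let ?t = "\<lambda>k. (?r1(?D := ?e i - k), 0::int, ?o (Suc i))"
      have W: "runs x (While (NZ ?D) (Dec ?D)) (?t 0) (?e i * 3 + 1) (?t (?e i))"
      proof (rule runs_While'[where \<sigma> = ?t and n = "?e i" and T = 1])
        show "runs x (Dec ?D) (?t k) 1 (?t (Suc k))" if "k < ?e i" for k
          by (rule runs_conv, rule runs_basic) auto
      qed auto
      have I: "runs x (Inc 0) (?t (?e i)) 1 (?s (Suc i))"
        by (rule runs_conv, rule runs_basic) (use B in \<open>auto simp: fun_eq_iff\<close>)
      have ei: "?e i \<le> poly pb ?m" unfolding e[symmetric] by (rule pb) (use le in auto)
      have "runs x ?body (?s i) (1 + (poly qb ?m + ((1 + 2) + ((?e i * 3 + 1) + 1)))) (?s (Suc i))"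
        by (intro runs_Seq[OF A runs_Seq[OF C runs_Seq[OF O runs_Seq[OF _ I]]]]) (use W in simp)
      then show ?thesis by (rule runs_mono) (use ei in \<open>simp add: poly_pcompose\<close>)
    qed
    have 2: "runs x (While (NZ B) ?body) (?s 0) (?n * (poly ?U (length x) + 2) + 1) (?s ?n)"
      by (rule runs_While'[where \<sigma> = ?s and n = ?n and T = "poly ?U (length x)"])
        (use b B in \<open>simp_all del: poly_add poly_smult poly_mult upt_Suc\<close>)
    have e0: "?s 0 = ((\<lambda>_. 0)(B := ?n), 0, [])" using B by (auto simp: fun_eq_iff)
    have "?n * (poly ?U (length x) + 2) \<le> poly p (length x) * (poly ?U (length x) + 2)"
      using n by (rule mult_right_mono) simp
    then have "poly q (length x) + (?n * (poly ?U (length x) + 2) + 1) \<le> poly (q + p * (?U + [:2:]) + [:1:]) (length x)"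
      by (simp only: poly_add poly_mult poly_pCons poly_0) simp
    with runs_Seq[OF 1 2[unfolded e0]]
    show "runs x ?c (\<lambda>_. 0, 0, []) (poly (q + p * (?U + [:2:]) + [:1:]) (length x)) (?r ?n 0, 0, ?o ?n)"
      by (rule runs_mono)
  qed
qed

section \<open>Functions definable by expressions\<close>

text \<open>The list holds the values of the variables 0 to \<open>n - 1\<close>, the innermost
  bound one last. A bounded operator can thus always bind variable \<open>n\<close>, and no renaming
  arises.\<close>

definition definable :: "nat \<Rightarrow> (bool list \<Rightarrow> nat list \<Rightarrow> nat) \<Rightarrow> bool" where
  "definable n f \<longleftrightarrow> (\<exists>e. \<forall>x \<rho>. aval x \<rho> e = f x (map \<rho> [0..<n]))"

abbreviation definableP :: "nat \<Rightarrow> (bool list \<Rightarrow> nat list \<Rightarrow> bool) \<Rightarrow> bool" where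
  "definableP n P \<equiv> definable n (\<lambda>x as. of_bool (P x as))"

lemma definableI: "(\<And>x \<rho>. aval x \<rho> e = f x (map \<rho> [0..<n])) \<Longrightarrow> definable n f"
  unfolding definable_def by blast

lemma definableE:
  assumes "definable n f" obtains e where "\<And>x \<rho>. aval x \<rho> e = f x (map \<rho> [0..<n])"
  using assms unfolding definable_def by blast

lemma def_cong: "definable n f \<Longrightarrow> (\<And>x as. length as = n \<Longrightarrow> f x as = g x as) \<Longrightarrow> definable n g"
  unfolding definable_def by simp

lemma def_const: "definable n (\<lambda>x as. c)"
  by (rule definableI[of "Cst c"]) simp

lemma def_len: "definable n (\<lambda>x as. length x)"
  by (rule definableI[of Len]) simp

lemma def_last: "definable (Suc n) (\<lambda>x as. last as)"
  by (rule definableI[of "Var n"]) simp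

lemma def_weaken: "definable n f \<Longrightarrow> definable (Suc n) (\<lambda>x as. f x (butlast as))"
  by (elim definableE, rule definableI) (simp add: butlast_append)

lemma def_add: "definable n f \<Longrightarrow> definable n g \<Longrightarrow> definable n (\<lambda>x as. f x as + g x as)"
  unfolding definable_def by (metis aval.simps)

lemma def_mul: "definable n f \<Longrightarrow> definable n g \<Longrightarrow> definable n (\<lambda>x as. f x as * g x as)"
  unfolding definable_def by (metis aval.simps)

lemma def_sub: "definable n f \<Longrightarrow> definable n g \<Longrightarrow> definable n (\<lambda>x as. f x as - g x as)"
  unfolding definable_def by (metis aval.simps)

lemma def_Suc: "definable n f \<Longrightarrow> definable n (\<lambda>x as. Suc (f x as))"
  using def_add[OF _ def_const[of _ 1], of n f] by simp

lemma def_inp: "definable n f \<Longrightarrow> definable n (\<lambda>x as. word_contents x (int (f x as)))"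
  unfolding definable_def by (metis aval.simps)

lemma def_sum:
  assumes "definable n f" "definable (Suc n) (\<lambda>x as. g x (butlast as) (last as))"
  shows "definable n (\<lambda>x as. \<Sum>i<f x as. g x as i)"
proof -
  obtain e1 where e1: "\<And>x \<rho>. aval x \<rho> e1 = f x (map \<rho> [0..<n])" using assms(1) unfolding definable_def by blast
  obtain e2 where e2: "\<And>x \<rho>. aval x \<rho> e2 = g x (butlast (map \<rho> [0..<Suc n])) (last (map \<rho> [0..<Suc n]))"
    using assms(2) unfolding definable_def by blast
  have "map (\<rho>(n := i)) [0..<n] = map \<rho> [0..<n]" for \<rho> :: "nat \<Rightarrow> nat" and i by simp
  then show ?thesis by (intro definableI[of "BSum n e1 e2"]) (simp add: e1 e2)
qed

lemma def_not: "definableP n P \<Longrightarrow> definableP n (\<lambda>x as. \<not> P x as)"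
  by (rule def_cong[OF def_sub[OF def_const[of n 1]]]) auto

lemma def_and: "definableP n P \<Longrightarrow> definableP n Q \<Longrightarrow> definableP n (\<lambda>x as. P x as \<and> Q x as)"
  using def_mul[of n "\<lambda>x as. of_bool (P x as)" "\<lambda>x as. of_bool (Q x as)"] by (simp add: of_bool_conj)

lemma def_or: "definableP n P \<Longrightarrow> definableP n Q \<Longrightarrow> definableP n (\<lambda>x as. P x as \<or> Q x as)"
  by (rule def_cong[OF def_not[OF def_and[OF def_not def_not]]]) auto

lemma def_False: "definableP n (\<lambda>x as. False)"
  using def_const[of n 0] by simp

lemma def_constP: "definableP n (\<lambda>x as. c)"
  using def_const[of n "of_bool c"] by simp

lemma def_le: "definable n f \<Longrightarrow> definable n g \<Longrightarrow> definableP n (\<lambda>x as. f x as \<le> g x as)"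
proof -
  assume "definable n f" "definable n g"
  then have "definable n (\<lambda>x as. 1 - (f x as - g x as))" by (intro def_sub def_const)
  moreover have "1 - (f x as - g x as) = of_bool (f x as \<le> g x as)" for x as by auto
  ultimately show ?thesis by simp
qed

lemma def_less: "definable n f \<Longrightarrow> definable n g \<Longrightarrow> definableP n (\<lambda>x as. f x as < g x as)"
  using def_le[OF def_Suc, of n f g] by (simp add: Suc_le_eq)

lemma def_eq: "definable n f \<Longrightarrow> definable n g \<Longrightarrow> definableP n (\<lambda>x as. f x as = g x as)"
proof -
  assume "definable n f" "definable n g"
  then have "definableP n (\<lambda>x as. f x as \<le> g x as \<and> g x as \<le> f x as)" by (intro def_and def_le)
  then show ?thesis by (simp only: order.eq_iff[symmetric])
qed

lemma def_neq: "definable n f \<Longrightarrow> definable n g \<Longrightarrow> definableP n (\<lambda>x as. f x as \<noteq> g x as)"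
  by (intro def_not def_eq)

lemma def_nonzero: "definable n f \<Longrightarrow> definableP n (\<lambda>x as. f x as \<noteq> 0)"
  by (intro def_neq def_const)

lemma def_ex:
  assumes "definable n f" "definableP (Suc n) (\<lambda>x as. P x (butlast as) (last as))"
  shows "definableP n (\<lambda>x as. \<exists>i<f x as. P x as i)"
  by (rule def_cong[OF def_nonzero[OF def_sum[OF assms]]]) auto

lemma def_all:
  assumes "definable n f" "definableP (Suc n) (\<lambda>x as. P x (butlast as) (last as))"
  shows "definableP n (\<lambda>x as. \<forall>i<f x as. P x as i)"
  by (rule def_cong[OF def_not[OF def_ex[OF assms(1) def_not[OF assms(2)]]]]) auto

lemma def_if:
  assumes "definableP n P" "definable n f" "definable n g"
  shows "definable n (\<lambda>x as. if P x as then f x as else g x as)"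
  by (rule def_cong[OF def_add[OF def_mul[OF assms(1,2)] def_mul[OF def_not[OF assms(1)] assms(3)]]]) auto

lemma def_exset:
  assumes "\<And>a. a \<in> set cs \<Longrightarrow> definableP n (P a)"
  shows "definableP n (\<lambda>x as. \<exists>a\<in>set cs. P a x as)"
  using assms
proof (induction cs)
  case Nil then show ?case using def_False by simp
next
  case (Cons a cs)
  then have "definableP n (\<lambda>x as. P a x as \<or> (\<exists>a\<in>set cs. P a x as))" by (intro def_or) auto
  then show ?case by simp
qed

text \<open>\<open>R\<close> is an arbitrary predicate: below a constant \<open>A\<close> it is a
  finite table. So facts about the letters of a fixed machine need no arithmetic
  description.\<close>

lemma def_table:
  assumes "definable n f"
  shows "definableP n (\<lambda>x as. f x as < A \<and> R (f x as))"
  by (rule def_cong[OF def_exset[of "filter R [0..<A]" n "\<lambda>a x as. f x as = a"]])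
    (auto intro: def_eq assms def_const)

lemma def_table2:
  assumes "definable n f" "definable n g"
  shows "definableP n (\<lambda>x as. f x as < A \<and> g x as < A \<and> R (f x as) (g x as))"
  by (rule def_cong[OF def_exset[of "[0..<A]" n "\<lambda>a x as. f x as = a \<and> (g x as < A \<and> R a (g x as))"]])
    (auto intro!: def_and def_eq assms def_const def_table)

lemma def_div:
  assumes "definable n f" "definable n g"
  shows "definable n (\<lambda>x as. f x as div g x as)"
proof (rule def_cong)
  \<comment> \<open>The quotient is the number of positive multiples of the divisor up to the
    dividend; the factor in front gives the value 0 for division by 0.\<close>
  show "definable n (\<lambda>x as. of_bool (0 < g x as) * (\<Sum>i<f x as. of_bool (Suc i * g x as \<le> f x as)))"
    by (intro def_mul def_sum def_less def_le def_const def_Suc def_last assms def_weaken[OF assms(1)] def_weaken[OF assms(2)])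
  fix x and as :: "nat list"
  let ?a = "f x as" let ?c = "g x as"
  show "of_bool (0 < ?c) * (\<Sum>i<?a. of_bool (Suc i * ?c \<le> ?a)) = ?a div ?c"
  proof (cases "?c = 0")
    case False
    have "{i \<in> {..<?a}. Suc i * ?c \<le> ?a} = {..<?a div ?c}"
    proof -
      have "Suc i * ?c \<le> ?a \<longleftrightarrow> i < ?a div ?c" for i
        using False by (simp add: less_eq_div_iff_mult_less_eq Suc_le_eq[symmetric] del: mult_Suc)
      moreover have "i < ?a" if "i < ?a div ?c" for i using that div_le_dividend less_le_trans by blast
      ultimately show ?thesis by auto
    qed
    then have "(\<Sum>i<?a. of_bool (Suc i * ?c \<le> ?a)) = ?a div ?c" 
      by (simp add: sum_of_bool_eq Int_def)
    then show ?thesis using False by simp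
  qed simp
qed

lemma def_mod:
  assumes "definable n f" "definable n g"
  shows "definable n (\<lambda>x as. f x as mod g x as)"
  by (rule def_cong[OF def_sub[OF assms(1) def_mul[OF def_div[OF assms] assms(2)]]]) (simp add: minus_div_mult_eq_mod)

lemma def_poly: "definable n (\<lambda>x as. poly p (length x))"
proof (induction p)
  case 0 then show ?case using def_const[of n 0] by simp
next
  case (pCons c p)
  have "definable n (\<lambda>x as. c + length x * poly p (length x))" by (intro def_add def_const def_mul def_len pCons)
  then show ?case by simp
qed

lemmas def_intros = def_const def_constP def_len def_last def_add def_mul def_sub def_Suc def_inp
  def_not def_and def_or def_le def_less def_eq def_if def_div def_mod

text \<open>Powers of two are the positive numbers all of whose divisors other than 1 are even.\<close>

definition pow2 :: "nat \<Rightarrow> bool" where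
  "pow2 q \<longleftrightarrow> 0 < q \<and> (\<forall>d<Suc q. q mod d \<noteq> 0 \<or> d \<le> 1 \<or> d mod 2 = 0)"

lemma pow2D: "pow2 q \<Longrightarrow> d \<le> q \<Longrightarrow> q mod d = 0 \<Longrightarrow> d \<le> 1 \<or> d mod 2 = 0"
  unfolding pow2_def by (metis le_imp_less_Suc)

lemma pow2_iff: "pow2 q \<longleftrightarrow> (\<exists>i. q = 2 ^ i)"
proof
  show "pow2 q \<Longrightarrow> \<exists>i. q = 2 ^ i"
  proof (induction q rule: less_induct)
    case (less q)
    show ?case
    proof (cases "q = 1")
      case True then show ?thesis by (intro exI[of _ 0]) simp
    next
      case False
      then have q: "q > 1" using less.prems unfolding pow2_def by simp
      then have "q mod 2 = 0" using pow2D[OF less.prems, of q] by simp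
      then obtain r where r: "q = 2 * r" by auto
      have "pow2 r"
        unfolding pow2_def
      proof (intro conjI allI impI)
        show "0 < r" using q r by simp
        fix d assume d: "d < Suc r"
        have "d \<le> 1 \<or> d mod 2 = 0" if "r mod d = 0"
        proof (rule pow2D[OF less.prems])
          show "d \<le> q" using d r by simp
          show "q mod d = 0" using that r by auto
        qed
        then show "r mod d \<noteq> 0 \<or> d \<le> 1 \<or> d mod 2 = 0" by argo
      qed
      then obtain i where "r = 2 ^ i" using less.IH[of r] r q by auto
      then show ?thesis using r by (intro exI[of _ "Suc i"]) simp
    qed
  qed
  assume "\<exists>i. q = 2 ^ i"
  then obtain i where q: "q = 2 ^ i" by blast
  show "pow2 q"
    unfolding pow2_def
  proof (intro conjI allI impI)
    fix d
    have "d \<le> 1 \<or> d mod 2 = 0" if h: "q mod d = 0"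
    proof -
      have "d dvd 2 ^ i" using q h by auto
      then obtain j where "d = 2 ^ j" using divides_primepow_nat[of 2 d i] by auto
      then show ?thesis by (cases j) auto
    qed
    then show "q mod d \<noteq> 0 \<or> d \<le> 1 \<or> d mod 2 = 0" by argo
  qed (simp add: q)
qed

lemma card_pow2: "card {q. q < 2 ^ i \<and> pow2 q} = i"
proof -
  have "{q. q < 2 ^ i \<and> pow2 q} = (\<lambda>j. 2 ^ j) ` {..<i}" unfolding pow2_iff by auto
  then show ?thesis by (simp add: card_image inj_on_def)
qed

lemma bits_nth: "i < length (bits k) \<longleftrightarrow> 2 ^ i \<le> k" "i < length (bits k) \<Longrightarrow> bits k ! i = odd (k div 2 ^ i)"
proof -
  have "(i < length (bits k) \<longleftrightarrow> 2 ^ i \<le> k) \<and> (i < length (bits k) \<longrightarrow> bits k ! i = odd (k div 2 ^ i))"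
  proof (induction k arbitrary: i rule: less_induct)
    case (less k)
    show ?case
    proof (cases "k = 0")
      case True then show ?thesis by (simp add: bits.simps)
    next
      case False
      then have b: "bits k = odd k # bits (k div 2)" by (simp add: bits.simps[of k])
      show ?thesis
      proof (cases i)
        case 0 then show ?thesis using False b by simp
      next
        case (Suc j)
        have "2 ^ Suc j \<le> k \<longleftrightarrow> 2 ^ j \<le> k div 2" by (simp add: less_eq_div_iff_mult_less_eq mult.commute)
        moreover have "k div 2 ^ Suc j = (k div 2) div 2 ^ j" by (simp add: div_mult2_eq)
        ultimately show ?thesis using less.IH[of "k div 2" j] False Suc b by simp
      qed
    qed
  qed
  then show "i < length (bits k) \<longleftrightarrow> 2 ^ i \<le> k" "i < length (bits k) \<Longrightarrow> bits k ! i = odd (k div 2 ^ i)" by auto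
qed

text \<open>The power \<open>q = 2 ^ i\<close> is not computed from \<open>i\<close> but recognised
  as the power of two with exactly \<open>i\<close> smaller ones.\<close>

definition bit_at :: "nat \<Rightarrow> nat \<Rightarrow> bool" where
  "bit_at k i \<longleftrightarrow> (\<exists>q<Suc k. pow2 q \<and> (\<Sum>r<q. of_bool (pow2 r)) = i \<and> (k div q) mod 2 = 1)"

lemma sum_pow2: "(\<Sum>r<(2::nat) ^ i. of_bool (pow2 r)) = i"
proof -
  have "{..<2 ^ i} \<inter> {q. pow2 q} = {q. q < 2 ^ i \<and> pow2 q}" by auto
  then show ?thesis using card_pow2[of i] by (simp add: sum_of_bool_eq)
qed

lemma bit_at_iff: "i < length (bits k) \<Longrightarrow> bit_at k i \<longleftrightarrow> bits k ! i"
proof -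
  assume i: "i < length (bits k)"
  have "bit_at k i \<longleftrightarrow> (k div 2 ^ i) mod 2 = 1"
  proof
    assume "bit_at k i"
    then obtain q where q: "pow2 q" "(\<Sum>r<q. of_bool (pow2 r)) = i" "(k div q) mod 2 = 1" unfolding bit_at_def by blast
    then obtain j where "q = 2 ^ j" using pow2_iff by blast
    then show "(k div 2 ^ i) mod 2 = 1" using q sum_pow2[of j] by simp
  next
    assume "(k div 2 ^ i) mod 2 = 1"
    moreover have "2 ^ i < Suc k" using bits_nth(1) i by simp
    ultimately show "bit_at k i" unfolding bit_at_def using pow2_iff sum_pow2[of i] by blast
  qed
  then show ?thesis using bits_nth(2)[OF i] by (simp add: odd_iff_mod_2_eq_one)
qed

text \<open>The bit positions of \<open>k\<close> correspond to the powers of two up to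
  \<open>k\<close>.\<close>

lemma length_bits: "length (bits k) = (\<Sum>q<Suc k. of_bool (pow2 q))"
proof -
  have "{q. q < Suc k \<and> pow2 q} = (\<lambda>j. 2 ^ j) ` {..<length (bits k)}"
    unfolding pow2_iff using bits_nth(1)[of _ k] by (auto simp: less_Suc_eq_le)
  then have "card {q. q < Suc k \<and> pow2 q} = length (bits k)" by (simp add: card_image inj_on_def)
  moreover have "{..<Suc k} \<inter> {q. pow2 q} = {q. q < Suc k \<and> pow2 q}" by auto
  ultimately show ?thesis by (simp add: sum_of_bool_eq del: sum.lessThan_Suc)
qed

lemma def_pow2:
  assumes "definable n f"
  shows "definableP n (\<lambda>x as. pow2 (f x as))"
proof -
  note w = def_weaken[OF assms]
  show ?thesis unfolding pow2_def by (intro def_intros def_all assms w)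
qed

lemma def_bit_at:
  assumes "definable n f" "definable n g"
  shows "definableP n (\<lambda>x as. bit_at (f x as) (g x as))"
  unfolding bit_at_def
  by (intro def_intros def_ex def_pow2 def_sum assms def_weaken[OF assms(1)] def_weaken[OF assms(2)])

lemma def_length_bits: "definable n f \<Longrightarrow> definable n (\<lambda>x as. length (bits (f x as)))"
  unfolding length_bits by (intro def_sum def_Suc def_pow2 def_last)

section \<open>Lattice graphs\<close>

definition unit_step :: "int \<times> int \<Rightarrow> int \<times> int \<Rightarrow> bool" where
  "unit_step a b \<longleftrightarrow> b = (fst a + 1, snd a) \<or> b = (fst a, snd a + 1)"

definition cpx :: "int \<times> int \<Rightarrow> complex" where
  "cpx a = Complex (of_int (fst a)) (of_int (snd a))"

lemma cpx_inject: "cpx a = cpx b \<longleftrightarrow> a = b"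
  by (auto simp: cpx_def prod_eq_iff)

lemma unit_segment:
  assumes "unit_step a b"
  shows "z \<in> closed_segment (cpx a) (cpx b) \<longleftrightarrow>
     of_int (fst a) \<le> Re z \<and> Re z \<le> of_int (fst b) \<and> of_int (snd a) \<le> Im z \<and> Im z \<le> of_int (snd b)"
  using assms unfolding unit_step_def
  by (auto simp: cpx_def closed_segment_same_Im closed_segment_same_Re closed_segment_eq_real_ivl)

lemma lattice_on_segment:
  assumes "unit_step a b" "cpx c \<in> closed_segment (cpx a) (cpx b)"
  shows "c = a \<or> c = b"
proof -
  have "fst a \<le> fst c \<and> fst c \<le> fst b \<and> snd a \<le> snd c \<and> snd c \<le> snd b"
    using assms(2) unfolding unit_segment[OF assms(1)] by (simp add: cpx_def)
  then show ?thesis using assms(1) unfolding unit_step_def by (auto simp: prod_eq_iff)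
qed

text \<open>Of two perpendicular segments one fixes the real and the other the imaginary part at an
  integer. Distinct parallel ones that meet lie on one line and share only an end.\<close>

lemma common_point_lattice:
  assumes "unit_step a b" "unit_step c d" "(a, b) \<noteq> (c, d)"
    "z \<in> closed_segment (cpx a) (cpx b)" "z \<in> closed_segment (cpx c) (cpx d)"
  obtains p where "z = cpx p"
proof -
  obtain a1 a2 c1 c2 where [simp]: "a = (a1, a2)" "c = (c1, c2)" by fastforce
  note z = assms(4)[unfolded unit_segment[OF assms(1)]] assms(5)[unfolded unit_segment[OF assms(2)]]
  have "\<exists>p1 p2. Re z = of_int p1 \<and> Im z = of_int p2"
  proof -
    consider "b = (a1 + 1, a2)" "d = (c1 + 1, c2)" | "b = (a1 + 1, a2)" "d = (c1, c2 + 1)"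
      | "b = (a1, a2 + 1)" "d = (c1 + 1, c2)" | "b = (a1, a2 + 1)" "d = (c1, c2 + 1)"
      using assms(1,2) by (auto simp: unit_step_def)
    then show ?thesis
    proof cases
      case 1
      then have "Im z = of_int a2" "a2 = c2" using z by auto
      moreover from this have "a1 \<noteq> c1" using assms(3) 1 by auto
      then have "a1 + 1 \<le> c1 \<or> c1 + 1 \<le> a1" by linarith
      then have "Re z = of_int a1 \<or> Re z = of_int c1" using z 1 by auto
      ultimately show ?thesis by blast
    next
      case 2 then show ?thesis using z by (intro exI[of _ c1] exI[of _ a2]) auto
    next
      case 3 then show ?thesis using z by (intro exI[of _ a1] exI[of _ c2]) auto
    next
      case 4
      then have "Re z = of_int a1" "a1 = c1" using z by auto
      moreover from this have "a2 \<noteq> c2" using assms(3) 4 by auto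
      then have "a2 + 1 \<le> c2 \<or> c2 + 1 \<le> a2" by linarith
      then have "Im z = of_int a2 \<or> Im z = of_int c2" using z 4 by auto
      ultimately show ?thesis by blast
    qed
  qed
  then obtain p1 p2 where "z = cpx (p1, p2)" by (auto simp: cpx_def complex_eq_iff)
  then show ?thesis using that by blast
qed

text \<open>Straight segments form the drawing. Two of them meet only in lattice points, and a unit
  segment carries no lattice points besides its ends, so common points are images of common
  vertices.\<close>

lemma lattice_graph_planar:
  fixes pos :: "'a \<Rightarrow> int \<times> int"
  assumes inj: "inj_on pos (verts G)"
    and edge: "\<And>e. e \<in> edges G \<Longrightarrow> \<exists>u v. e = {u, v} \<and> u \<in> verts G \<and> v \<in> verts G \<and> unit_step (pos u) (pos v)"
  shows "planar G"
proof -
  let ?p = "\<lambda>v. cpx (pos v)"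
  have "\<forall>e\<in>edges G. \<exists>w. e = {fst w, snd w} \<and> fst w \<in> verts G \<and> snd w \<in> verts G \<and> unit_step (pos (fst w)) (pos (snd w))"
    using edge by fastforce
  then obtain w where w: "\<And>e. e \<in> edges G \<Longrightarrow> e = {fst (w e), snd (w e)} \<and> fst (w e) \<in> verts G \<and>
      snd (w e) \<in> verts G \<and> unit_step (pos (fst (w e))) (pos (snd (w e)))"
    by metis
  let ?g = "\<lambda>e. linepath (?p (fst (w e))) (?p (snd (w e)))"
  have img: "path_image (?g e) = closed_segment (?p (fst (w e))) (?p (snd (w e)))" for e by simp
  have ends: "?p ` e \<subseteq> path_image (?g e)" if "e \<in> edges G" for e
  proof -
    obtain u v where uv: "w e = (u, v)" by fastforce
    then have "e = {u, v}" using w[OF that] by simp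
    then show ?thesis unfolding img uv by auto
  qed
  have on: "c \<in> e" if e: "e \<in> edges G" and c: "c \<in> verts G" "?p c \<in> path_image (?g e)" for c e
  proof -
    obtain u v where uv: "w e = (u, v)" by fastforce
    then have *: "e = {u, v}" "u \<in> verts G" "v \<in> verts G" "unit_step (pos u) (pos v)" using w[OF e] by auto
    then have "pos c = pos u \<or> pos c = pos v" using lattice_on_segment c(2) unfolding img uv by simp
    then show ?thesis using inj c(1) * by (auto dest: inj_onD)
  qed
  have ev: "e \<subseteq> verts G" if "e \<in> edges G" for e using w[OF that] by (metis empty_subsetI insert_subset)
  show ?thesis
    unfolding planar_def
  proof (intro exI[of _ ?p] exI[of _ ?g] conjI ballI impI)
    show "inj_on ?p (verts G)" using inj by (auto simp: inj_on_def cpx_inject)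
  next
    fix e assume e: "e \<in> edges G"
    obtain u v where uv: "w e = (u, v)" by fastforce
    then have *: "e = {u, v}" "unit_step (pos u) (pos v)" using w[OF e] by auto
    show "arc (?g e)" unfolding uv fst_conv snd_conv
      by (rule arc_linepath) (use *(2) in \<open>auto simp: cpx_inject unit_step_def prod_eq_iff\<close>)
    show "{pathstart (?g e), pathfinish (?g e)} = ?p ` e" unfolding uv fst_conv snd_conv pathstart_linepath pathfinish_linepath unfolding *(1) by simp
    show "path_image (?g e) \<inter> ?p ` verts G = ?p ` e" using on[OF e] ends[OF e] ev[OF e] by blast
  next
    fix e f assume e: "e \<in> edges G" and f: "f \<in> edges G" and ne: "e \<noteq> f"
    obtain u v u' v' where uv: "w e = (u, v)" "w f = (u', v')" by (metis surj_pair)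
    then have *: "e = {u, v}" "u \<in> verts G" "v \<in> verts G" "unit_step (pos u) (pos v)"
      "f = {u', v'}" "u' \<in> verts G" "v' \<in> verts G" "unit_step (pos u') (pos v')" using w[OF e] w[OF f] by auto
    have "(pos u, pos v) \<noteq> (pos u', pos v')"
      using ne * inj by (auto dest: inj_onD)
    show "path_image (?g e) \<inter> path_image (?g f) = ?p ` (e \<inter> f)"
    proof
      show "?p ` (e \<inter> f) \<subseteq> path_image (?g e) \<inter> path_image (?g f)" using ends[OF e] ends[OF f] by blast
      show "path_image (?g e) \<inter> path_image (?g f) \<subseteq> ?p ` (e \<inter> f)"
      proof
        fix z assume z: "z \<in> path_image (?g e) \<inter> path_image (?g f)"
        then obtain q where q: "z = cpx q"
          using common_point_lattice[OF *(4,8) \<open>(pos u, pos v) \<noteq> _\<close>] unfolding img uv by auto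
        have "q = pos u \<or> q = pos v" using lattice_on_segment[OF *(4)] z unfolding img uv q by simp
        then obtain c where c: "c \<in> verts G" "q = pos c" using * by blast
        then have "c \<in> e" "c \<in> f" using on[OF e] on[OF f] z q by auto
        then show "z \<in> ?p ` (e \<inter> f)" using q c by blast
      qed
    qed
  qed
qed

section \<open>Cycles and 2-cores\<close>

definition adj :: "'a graph \<Rightarrow> 'a \<Rightarrow> 'a \<Rightarrow> bool" where
  "adj G u v \<longleftrightarrow> {u, v} \<in> edges G"

text \<open>A witness for a cycle that is easier to transport than a cyclic list: a nonempty finite
  set of minimum degree two. Over an arbitrary relation the same notion serves for the graph, for
  its vertex names and for the maze.\<close>

definition core2 :: "('a \<Rightarrow> 'a \<Rightarrow> bool) \<Rightarrow> 'a set \<Rightarrow> bool" where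
  "core2 R Z \<longleftrightarrow> finite Z \<and> Z \<noteq> {} \<and> (\<forall>z\<in>Z. \<exists>a\<in>Z. \<exists>b\<in>Z. a \<noteq> b \<and> R z a \<and> R z b)"

lemma core2_mono: "core2 R Z \<Longrightarrow> (\<And>a b. a \<in> Z \<Longrightarrow> b \<in> Z \<Longrightarrow> R a b \<Longrightarrow> R' a b) \<Longrightarrow> core2 R' Z"
  unfolding core2_def by meson

lemma cycle_core2:
  assumes "is_cycle G c"
  shows "core2 (adj G) (set c)"
  unfolding core2_def
proof (intro conjI ballI)
  have n: "length c \<ge> 3" and d: "distinct c"
    and e: "\<And>i. i < length c \<Longrightarrow> {c ! i, c ! (Suc i mod length c)} \<in> edges G"
    using assms unfolding is_cycle_def by auto
  show "finite (set c)" "set c \<noteq> {}" using n by auto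
  fix z assume "z \<in> set c"
  then obtain i where i: "i < length c" "z = c ! i" by (metis in_set_conv_nth)
  let ?s = "Suc i mod length c" let ?p = "if i = 0 then length c - 1 else i - 1"
  have l: "?s < length c" "?p < length c" using n i by (auto intro: mod_less_divisor)
  have p: "Suc ?p mod length c = i" using n i by auto
  have "?s \<noteq> ?p"
  proof (cases "Suc i = length c")
    case True then show ?thesis using n by auto
  next
    case False then have "?s = Suc i" using i by simp
    then show ?thesis using n i by (auto split: if_splits)
  qed
  then have "c ! ?s \<noteq> c ! ?p" using d l by (simp add: nth_eq_iff_index_eq)
  moreover have "adj G z (c ! ?s)" "adj G z (c ! ?p)"
    using e[OF i(1)] e[OF l(2)] i p unfolding adj_def by (auto simp: insert_commute)
  ultimately show "\<exists>a\<in>set c. \<exists>b\<in>set c. a \<noteq> b \<and> adj G z a \<and> adj G z b"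
    using l nth_mem by meson
qed

text \<open>A longest path cannot be extended at its head, so both neighbours of the head lie on it.\<close>

lemma core2_cycle:
  assumes "core2 (adj G) Z" "\<forall>e\<in>edges G. card e = 2"
  obtains c where "is_cycle G c" "set c \<subseteq> Z"
proof -
  have fin: "finite Z" "Z \<noteq> {}"
    and nb: "\<And>z. z \<in> Z \<Longrightarrow> \<exists>a\<in>Z. \<exists>b\<in>Z. a \<noteq> b \<and> adj G z a \<and> adj G z b"
    using assms(1) unfolding core2_def by auto
  define path where "path p \<longleftrightarrow> p \<noteq> [] \<and> distinct p \<and> set p \<subseteq> Z \<and>
    (\<forall>i. Suc i < length p \<longrightarrow> {p ! i, p ! Suc i} \<in> edges G)" for p
  obtain z where "z \<in> Z" using fin by auto
  then have "path [z]" unfolding path_def by simp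
  moreover have "\<forall>p. path p \<longrightarrow> length p < Suc (card Z)"
    unfolding path_def using fin(1) by (metis card_mono distinct_card less_Suc_eq_le)
  ultimately obtain p where p: "path p" and max: "\<And>q. path q \<Longrightarrow> length q \<le> length p"
    using ex_has_greatest_nat[of path "[z]" length] by blast
  have hp: "hd p \<in> Z" "p \<noteq> []" using p unfolding path_def by auto
  have on: "a \<in> set p" if a: "a \<in> Z" "adj G (hd p) a" for a
  proof (rule ccontr)
    assume "a \<notin> set p"
    then have "path (a # p)"
      using p a unfolding path_def adj_def
      by (auto simp: nth_Cons hd_conv_nth insert_commute split: nat.split)
    then show False using max by fastforce
  qed
  obtain a b where ab: "a \<in> Z" "b \<in> Z" "a \<noteq> b" "adj G (hd p) a" "adj G (hd p) b"
    using nb[OF hp(1)] by blast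
  have ne: "c \<noteq> hd p" if "adj G (hd p) c" for c
    using that assms(2) unfolding adj_def by fastforce
  obtain i j where ij: "i < length p" "j < length p" "a = p ! i" "b = p ! j"
    using on ab by (metis in_set_conv_nth)
  have "i \<noteq> j" "i \<noteq> 0" "j \<noteq> 0" using ij ab ne[of a] ne[of b] hp by (metis hd_conv_nth)+
  \<comment> \<open>Of two distinct nonzero indices the larger is at least 2, so closing the path
    there gives a cycle of length at least three.\<close>
  then obtain k where k: "2 \<le> k" "k < length p" "adj G (hd p) (p ! k)"
    using ij ab by (metis One_nat_def Suc_leI le_neq_implies_less less_2_cases_iff not_less numeral_2_eq_2)
  let ?c = "take (Suc k) p"
  have lc: "length ?c = Suc k" using k by simp
  have "is_cycle G ?c"
    unfolding is_cycle_def
  proof (intro conjI allI impI)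
    show "3 \<le> length ?c" using k by simp
    show "distinct ?c" using p unfolding path_def by simp
    fix i assume i: "i < length ?c"
    show "{?c ! i, ?c ! (Suc i mod length ?c)} \<in> edges G"
    proof (cases "i = k")
      case True
      then show ?thesis using k hp unfolding lc by (simp add: adj_def hd_conv_nth insert_commute)
    next
      case False
      then have "Suc i < Suc k" using i by simp
      then show ?thesis using k p unfolding path_def lc by simp
    qed
  qed
  moreover have "set ?c \<subseteq> Z" using p set_take_subset unfolding path_def by fastforce
  ultimately show ?thesis using that by blast
qed

text \<open>Passing to an induced subgraph only restricts the vertex set of a core: its points have
  neighbours in the induced graph and therefore lie in \<open>W\<close>.\<close>

lemma acyclic_induced_iff:
  assumes "\<forall>e\<in>edges G. card e = 2"
  shows "acyclic_graph (induced G W) \<longleftrightarrow> \<not> (\<exists>Z\<subseteq>W. core2 (adj G) Z)"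
proof
  assume a: "acyclic_graph (induced G W)"
  show "\<not> (\<exists>Z\<subseteq>W. core2 (adj G) Z)"
  proof
    assume "\<exists>Z\<subseteq>W. core2 (adj G) Z"
    then obtain Z where Z: "Z \<subseteq> W" "core2 (adj G) Z" by blast
    have "core2 (adj (induced G W)) Z"
      by (rule core2_mono[OF Z(2)]) (use Z(1) in \<open>auto simp: adj_def induced_def\<close>)
    moreover have "\<forall>e\<in>edges (induced G W). card e = 2" using assms by (auto simp: induced_def)
    ultimately show False using core2_cycle a unfolding acyclic_graph_def by blast
  qed
next
  assume n: "\<not> (\<exists>Z\<subseteq>W. core2 (adj G) Z)"
  show "acyclic_graph (induced G W)"
    unfolding acyclic_graph_def
  proof
    assume "\<exists>c. is_cycle (induced G W) c"
    then obtain c where c: "is_cycle (induced G W) c" by blast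
    then have "core2 (adj (induced G W)) (set c)" by (rule cycle_core2)
    then have "core2 (adj G) (set c)" by (rule core2_mono) (auto simp: adj_def induced_def)
    moreover have "set c \<subseteq> W"
    proof
      fix z assume "z \<in> set c"
      then obtain a where "adj (induced G W) z a"
        using \<open>core2 (adj (induced G W)) (set c)\<close> unfolding core2_def by blast
      then show "z \<in> W" by (auto simp: adj_def induced_def)
    qed
    ultimately show False using n by blast
  qed
qed

text \<open>The endpoint whose neighbours have all been eliminated, except for the other endpoint,
  makes the closed neighbourhoods of the edge a star.\<close>

lemma bisimplicial_leaf:
  assumes "bipartition G X Y" "x \<in> X" "y \<in> Y" "{x, y} \<in> edges G"
    and "nbhd G x \<subseteq> {y} \<or> nbhd G y \<subseteq> {x}"
  shows "bisimplicial G x y"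
proof -
  have star: "complete_bipartite (induced G (closed_nbhd G c))" if "c \<in> X \<or> c \<in> Y" for c
  proof -
    have no: "{u, v} \<notin> edges G" if "(c \<in> X \<and> u \<in> Y \<and> v \<in> Y) \<or> (c \<in> Y \<and> u \<in> X \<and> v \<in> X)" for u v
      using assms(1) that unfolding bipartition_def by (metis disjoint_iff doubleton_eq_iff)
    have opp: "u \<in> verts G" "u \<noteq> c" "(c \<in> X \<and> u \<in> Y) \<or> (c \<in> Y \<and> u \<in> X)" if "{c, u} \<in> edges G" for u
      using assms(1) that \<open>c \<in> X \<or> c \<in> Y\<close> unfolding bipartition_def
      by (metis Un_iff disjoint_iff doubleton_eq_iff)+
    let ?H = "induced G (closed_nbhd G c)"
    have "bipartition ?H {c} (nbhd G c)"
      unfolding bipartition_def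
    proof (intro conjI ballI)
      show "{c} \<inter> nbhd G c = {}" using opp(2)[of c] by (auto simp: nbhd_def)
      show "{c} \<union> nbhd G c = verts ?H"
        using opp(1) assms(1) \<open>c \<in> X \<or> c \<in> Y\<close> by (auto simp: induced_def closed_nbhd_def nbhd_def bipartition_def)
      fix e assume "e \<in> edges ?H"
      then have e: "e \<in> edges G" "e \<subseteq> insert c (nbhd G c)" by (auto simp: induced_def closed_nbhd_def)
      then obtain u v where uv: "u \<in> X" "v \<in> Y" "e = {u, v}" using assms(1) unfolding bipartition_def by blast
      have "u = c \<or> v = c"
      proof (rule ccontr)
        assume "\<not> (u = c \<or> v = c)"
        then have "{c, u} \<in> edges G" "{c, v} \<in> edges G" using e uv by (auto simp: nbhd_def)
        then show False using opp(3) uv assms(1) unfolding bipartition_def by blast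
      qed
      then show "\<exists>x\<in>{c}. \<exists>y\<in>nbhd G c. e = {x, y}"
        using uv e by (auto simp: nbhd_def insert_commute)
    qed
    moreover have "\<forall>b\<in>nbhd G c. {c, b} \<in> edges ?H" by (auto simp: nbhd_def induced_def closed_nbhd_def)
    ultimately show ?thesis unfolding complete_bipartite_def by blast
  qed
  have "closed_nbhd G x \<union> closed_nbhd G y = closed_nbhd G x \<or> closed_nbhd G x \<union> closed_nbhd G y = closed_nbhd G y"
    using assms(4,5) by (auto simp: closed_nbhd_def nbhd_def insert_commute)
  then show ?thesis unfolding bisimplicial_def using star assms by metis
qed

text \<open>Each listed edge has, at its turn, an end whose only possible remaining neighbour is the
  other end. What is left of the two closed neighbourhoods is then a star, which is complete
  bipartite.\<close>

lemma perfect_elimination_leaves: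
  assumes bip: "bipartition G X Y"
    and edge: "\<And>x y. (x, y) \<in> set es \<Longrightarrow> x \<in> X \<and> y \<in> Y \<and> {x, y} \<in> edges G"
    and dist: "distinct es"
    and disj: "\<And>x y x' y'. (x, y) \<in> set es \<Longrightarrow> (x', y') \<in> set es \<Longrightarrow> (x, y) \<noteq> (x', y') \<Longrightarrow> x \<noteq> x' \<and> y \<noteq> y'"
    and leaf: "\<And>j x y. j < length es \<Longrightarrow> es ! j = (x, y) \<Longrightarrow>
      nbhd G x \<subseteq> insert y (eliminated es j) \<or> nbhd G y \<subseteq> insert x (eliminated es j)"
    and cover: "\<And>e. e \<in> edges G \<Longrightarrow> e \<inter> eliminated es (length es) \<noteq> {}"
  shows "perfect_elimination_bipartite G"
proof -
  have XY: "X \<inter> Y = {}" "X \<union> Y = verts G" using bip unfolding bipartition_def by auto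
  have dj: "{fst (es ! i), snd (es ! i)} \<inter> {fst (es ! j), snd (es ! j)} = {}"
    if "i < length es" "j < length es" "i \<noteq> j" for i j
  proof -
    obtain x y x' y' where e: "es ! i = (x, y)" "es ! j = (x', y')" by fastforce
    have "(x, y) \<noteq> (x', y')" using dist that e by (metis nth_eq_iff_index_eq)
    then have "x \<noteq> x'" "y \<noteq> y'" using disj e that by (metis nth_mem)+
    moreover have "x \<in> X" "x' \<in> X" "y \<in> Y" "y' \<in> Y" using edge e that by (metis nth_mem)+
    ultimately show ?thesis using XY e by auto
  qed
  have fresh: "fst (es ! j) \<notin> eliminated es j" "snd (es ! j) \<notin> eliminated es j" if j: "j < length es" for j
  proof -
    have "z \<notin> {fst (es ! j), snd (es ! j)}" if "z \<in> eliminated es j" for z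
    proof -
      from that obtain i where "i < j" "z \<in> {fst (es ! i), snd (es ! i)}"
        unfolding eliminated_def using j by (auto simp: in_set_conv_nth)
      then show ?thesis using dj[of i j] j by auto
    qed
    then show "fst (es ! j) \<notin> eliminated es j" "snd (es ! j) \<notin> eliminated es j" by auto
  qed
  have "perfect_edge_elimination_ordering G X Y es"
    unfolding perfect_edge_elimination_ordering_def
  proof (intro conjI allI impI)
    show "\<forall>(x, y)\<in>set es. x \<in> X \<and> y \<in> Y \<and> {x, y} \<in> edges G" using edge by auto
    show "{fst (es ! i), snd (es ! i)} \<inter> {fst (es ! j), snd (es ! j)} = {}"
      if "i < length es" "j < length es" "i \<noteq> j" for i j using dj that by blast
    show "edges (induced G (X \<union> Y - eliminated es (length es))) = {}"
      using cover by (auto simp: induced_def)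
    fix j assume j: "j < length es"
    obtain x y where e: "es ! j = (x, y)" by fastforce
    let ?R = "eliminated es j" let ?H = "induced G (X \<union> Y - ?R)"
    have xy: "x \<in> X" "y \<in> Y" "{x, y} \<in> edges G" "x \<notin> ?R" "y \<notin> ?R"
      using edge[of x y] e j fresh[OF j] nth_mem[OF j] by auto
    have "bipartition ?H (X - ?R) (Y - ?R)"
    proof -
      have "\<exists>x\<in>X - ?R. \<exists>y\<in>Y - ?R. f = {x, y}" if f: "f \<in> edges ?H" for f
      proof -
        obtain u v where "u \<in> X" "v \<in> Y" "f = {u, v}"
          using f bip unfolding bipartition_def induced_def by auto
        then show ?thesis using f by (auto simp: induced_def)
      qed
      then show ?thesis using XY unfolding bipartition_def by (auto simp: induced_def)
    qed
    moreover have "nbhd ?H x \<subseteq> {y} \<or> nbhd ?H y \<subseteq> {x}"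
      using leaf[OF j e] by (auto simp: nbhd_def induced_def)
    moreover have "{x, y} \<in> edges ?H" using xy by (simp add: induced_def)
    ultimately show "bisimplicial ?H (fst (es ! j)) (snd (es ! j))"
      unfolding e fst_conv snd_conv using xy by (intro bisimplicial_leaf[of _ "X - ?R" "Y - ?R"]) auto
  qed
  then show ?thesis unfolding perfect_elimination_bipartite_def using bip by blast
qed

section \<open>The graph of a maze\<close>

datatype vtx = Q1 nat nat | Q2 nat nat | HP nat nat | HD nat nat | VP nat nat nat | VD nat nat nat

text \<open>\<open>Hw x y\<close> and \<open>Vw x y\<close> stand for the walls from
  \<open>(x, y)\<close> to its right and to its upper neighbour. Vertical walls become paths of
  length \<open>b\<close>, which controls the girth; \<open>b\<close> at least 2 gives each of them
  an inner vertex.\<close>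

locale maze =
  fixes X Y b :: nat and Hw Vw :: "nat \<Rightarrow> nat \<Rightarrow> bool"
  assumes Hw: "Hw x y \<Longrightarrow> Suc x < X \<and> y < Y"
    and Vw: "Vw x y \<Longrightarrow> x < X \<and> Suc y < Y"
    and b: "2 \<le> b"
begin

fun ok :: "vtx \<Rightarrow> bool" where
  "ok (Q1 x y) \<longleftrightarrow> x < X \<and> y < Y"
| "ok (Q2 x y) \<longleftrightarrow> x < X \<and> y < Y"
| "ok (HP x y) \<longleftrightarrow> Hw x y"
| "ok (HD x y) \<longleftrightarrow> Hw x y"
| "ok (VP x y i) \<longleftrightarrow> Vw x y \<and> 0 < i \<and> i < b"
| "ok (VD x y i) \<longleftrightarrow> Vw x y \<and> 0 < i \<and> i < b"

text \<open>The summand \<open>Y - y\<close> shears the drawing, so that a vertical wall runs straight from the \<open>Q1\<close> of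
  its lower point to the \<open>Q2\<close> of its upper point.\<close>

fun cl :: "vtx \<Rightarrow> nat" where
  "cl (Q1 x y) = 3 * x + (Y - y)"
| "cl (Q2 x y) = 3 * x + (Y - y) + 1"
| "cl (HP x y) = 3 * x + (Y - y) + 2"
| "cl (HD x y) = 3 * x + (Y - y) + 2"
| "cl (VP x y i) = 3 * x + (Y - y)"
| "cl (VD x y i) = 3 * x + (Y - y) + 1"

fun rw :: "vtx \<Rightarrow> nat" where
  "rw (Q1 x y) = b * y"
| "rw (Q2 x y) = b * y"
| "rw (HP x y) = b * y"
| "rw (HD x y) = b * y + 1"
| "rw (VP x y i) = b * y + i"
| "rw (VD x y i) = b * y + i"

text \<open>Splitting a lattice point into \<open>Q1\<close> and \<open>Q2\<close> distributes its
  up to four walls, two to each half, which keeps the degree at most three. All links are directed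
  to the right or upwards in the drawing.\<close>

inductive link :: "vtx \<Rightarrow> vtx \<Rightarrow> bool" where
  "x < X \<Longrightarrow> y < Y \<Longrightarrow> link (Q1 x y) (Q2 x y)"
| "Hw x y \<Longrightarrow> link (Q2 x y) (HP x y)"
| "Hw x y \<Longrightarrow> link (HP x y) (Q1 (Suc x) y)"
| "Hw x y \<Longrightarrow> link (HP x y) (HD x y)"
| "Vw x y \<Longrightarrow> link (Q1 x y) (VP x y 1)"
| "Vw x y \<Longrightarrow> 0 < i \<Longrightarrow> Suc i < b \<Longrightarrow> link (VP x y i) (VP x y (Suc i))"
| "Vw x y \<Longrightarrow> link (VP x y (b - 1)) (Q2 x (Suc y))"
| "Vw x y \<Longrightarrow> 0 < i \<Longrightarrow> i < b \<Longrightarrow> link (VP x y i) (VD x y i)"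

definition Wd :: nat where "Wd = 3 * X + Y + 3"

text \<open>Vertices are numbered by their position in the drawing, row by row, so the number alone
  yields the planar embedding and the bipartition. Positions without a vertex name become isolated
  vertices.\<close>

definition cd :: "vtx \<Rightarrow> nat" where "cd v = rw v * Wd + cl v"

definition E :: "nat set set" where "E = {{cd u, cd v} | u v. link u v}"

definition G :: "nat graph" where "G = \<lparr>verts = {..<Wd * (b * Y)}, edges = E\<rparr>"

definition nb :: "vtx \<Rightarrow> vtx \<Rightarrow> bool" where "nb u v \<longleftrightarrow> link u v \<or> link v u"

lemma link_ok: "link u v \<Longrightarrow> ok u \<and> ok v"
  by (induction rule: link.induct) (use b in \<open>auto dest: Hw Vw\<close>)

lemma link_step: "link u v \<Longrightarrow> (cl v = cl u + 1 \<and> rw v = rw u) \<or> (cl v = cl u \<and> rw v = rw u + 1)"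
proof (induction rule: link.induct)
  case (7 x y)
  then have "y < Y" using Vw[OF 7] by simp
  then show ?case using b by (auto simp: Suc_diff_Suc)
qed (auto dest: Hw Vw)

lemma cl_less: "ok v \<Longrightarrow> cl v < Wd"
  by (cases v) (auto simp: Wd_def dest!: Hw Vw)

lemma rw_less: "ok v \<Longrightarrow> rw v < b * Y"
proof -
  have *: "b * y + i < b * Y" if "y < Y" "i < b" for y i
  proof -
    have "b * y + i < b * Suc y" using that by simp
    also have "\<dots> \<le> b * Y" using that by (intro mult_le_mono2) simp
    finally show ?thesis .
  qed
  assume "ok v" then show ?thesis
    using *[of _ 0] *[of _ 1] * b by (cases v) (auto dest!: Hw Vw)
qed

lemma decode:
  assumes "ok v"
  shows "cd v div Wd = rw v" "cd v mod Wd = cl v"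
  using cl_less[OF assms] unfolding cd_def by (auto simp: div_mult_self3 Wd_def)

text \<open>The shear is undone with the recovered \<open>y\<close>; the column modulo 3 and the row
  modulo \<open>b\<close> then tell apart the names belonging to one lattice point.\<close>

definition cell :: "vtx \<Rightarrow> nat \<times> nat \<times> nat \<times> nat" where
  "cell v = (let y = rw v div b; c = cl v - (Y - y) in (c div 3, y, c mod 3, rw v mod b))"

lemma cell_simps:
  "cell (Q1 x y) = (x, y, 0, 0)" "cell (Q2 x y) = (x, y, 1, 0)" "cell (HP x y) = (x, y, 2, 0)"
  "cell (HD x y) = (x, y, 2, 1)" 
  "i < b \<Longrightarrow> cell (VP x y i) = (x, y, 0, i)" "i < b \<Longrightarrow> cell (VD x y i) = (x, y, 1, i)"
proof -
  have *: "(b * y + i) div b = y" "(b * y + i) mod b = i" if "i < b" for i using that by auto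
  have **: "(3 * x + (Y - y) + c - (Y - y)) div 3 = x" "(3 * x + (Y - y) + c - (Y - y)) mod 3 = c" if "c < 3" for c
    using that by auto
  show "cell (Q1 x y) = (x, y, 0, 0)" "cell (Q2 x y) = (x, y, 1, 0)" "cell (HP x y) = (x, y, 2, 0)"
    "cell (HD x y) = (x, y, 2, 1)"
    using *[of 0] *[of 1] **[of 0] **[of 1] **[of 2] b by (simp_all add: cell_def Let_def del: One_nat_def)
  show "cell (VP x y i) = (x, y, 0, i)" "cell (VD x y i) = (x, y, 1, i)" if "i < b"
    using *[OF that] **[of 0] **[of 1] by (simp_all add: cell_def Let_def del: One_nat_def)
qed

lemma cell_inj: "ok u \<Longrightarrow> ok v \<Longrightarrow> cell u = cell v \<Longrightarrow> u = v"
  by (cases u; cases v) (auto simp: cell_simps)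

lemma cd_inject: "ok u \<Longrightarrow> ok v \<Longrightarrow> cd u = cd v \<longleftrightarrow> u = v"
proof
  assume "ok u" "ok v" "cd u = cd v"
  then have "rw u = rw v" "cl u = cl v" using decode by metis+
  then have "cell u = cell v" unfolding cell_def by simp
  then show "u = v" using cell_inj \<open>ok u\<close> \<open>ok v\<close> by blast
qed simp

lemma cd_less: "ok v \<Longrightarrow> cd v < Wd * (b * Y)"
proof -
  assume v: "ok v"
  have "cd v < Suc (rw v) * Wd" using cl_less[OF v] unfolding cd_def by simp
  also have "\<dots> \<le> (b * Y) * Wd" using rw_less[OF v] by (intro mult_le_mono1) simp
  finally show ?thesis by (simp add: mult.commute)
qed

lemma nb_ok: "nb u v \<Longrightarrow> ok u \<and> ok v" using link_ok unfolding nb_def by blast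

lemma edge_iff: "{m, n} \<in> E \<longleftrightarrow> (\<exists>u v. m = cd u \<and> n = cd v \<and> nb u v)"
  unfolding E_def nb_def by (auto simp: doubleton_eq_iff)

lemma edge_cd: "ok u \<Longrightarrow> ok v \<Longrightarrow> {cd u, cd v} \<in> E \<longleftrightarrow> nb u v"
  unfolding edge_iff using nb_ok cd_inject by blast

lemma link_irrefl: "link u v \<Longrightarrow> u \<noteq> v" using link_step by fastforce

lemma simple_G: "simple_graph G"
  unfolding simple_graph_def
proof (intro conjI ballI)
  fix e assume "e \<in> edges G"
  then obtain u v where e: "e = {cd u, cd v}" "link u v" unfolding G_def E_def by auto
  then have "ok u" "ok v" "u \<noteq> v" using link_ok link_irrefl by auto
  then show "e \<subseteq> verts G" "card e = 2" using e cd_less cd_inject by (auto simp: G_def)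
qed (simp add: G_def)

lemma card_E: "\<forall>e\<in>edges G. card e = 2" using simple_G unfolding simple_graph_def by blast

lemma nb_simps:
  "nb (Q1 x y) v \<longleftrightarrow> x < X \<and> y < Y \<and> v = Q2 x y \<or> (\<exists>x'. x = Suc x' \<and> Hw x' y \<and> v = HP x' y) \<or> Vw x y \<and> v = VP x y 1"
  "nb (Q2 x y) v \<longleftrightarrow> x < X \<and> y < Y \<and> v = Q1 x y \<or> Hw x y \<and> v = HP x y \<or> (\<exists>y'. y = Suc y' \<and> Vw x y' \<and> v = VP x y' (b - 1))"
  "nb (HP x y) v \<longleftrightarrow> Hw x y \<and> (v = Q2 x y \<or> v = Q1 (Suc x) y \<or> v = HD x y)"
  "nb (HD x y) v \<longleftrightarrow> Hw x y \<and> v = HP x y"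
  "nb (VP x y i) v \<longleftrightarrow> Vw x y \<and> 0 < i \<and> i < b \<and> (v = VD x y i \<or> i = 1 \<and> v = Q1 x y \<or> i = b - 1 \<and> v = Q2 x (Suc y) \<or>
     Suc i < b \<and> v = VP x y (Suc i) \<or> 1 < i \<and> v = VP x y (i - 1))"
  "nb (VD x y i) v \<longleftrightarrow> Vw x y \<and> 0 < i \<and> i < b \<and> v = VP x y i"
proof -
  have b1: "b - 1 < b" "0 < b - 1" "1 < b" "b - Suc 0 < b" "0 < b - Suc 0" using b by auto
  show "nb (Q1 x y) v \<longleftrightarrow> x < X \<and> y < Y \<and> v = Q2 x y \<or> (\<exists>x'. x = Suc x' \<and> Hw x' y \<and> v = HP x' y) \<or> Vw x y \<and> v = VP x y 1"
    unfolding nb_def by (auto simp: link.simps)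
  show "nb (Q2 x y) v \<longleftrightarrow> x < X \<and> y < Y \<and> v = Q1 x y \<or> Hw x y \<and> v = HP x y \<or> (\<exists>y'. y = Suc y' \<and> Vw x y' \<and> v = VP x y' (b - 1))"
    unfolding nb_def by (auto simp: link.simps)
  show "nb (HP x y) v \<longleftrightarrow> Hw x y \<and> (v = Q2 x y \<or> v = Q1 (Suc x) y \<or> v = HD x y)"
    unfolding nb_def by (auto simp: link.simps)
  show "nb (HD x y) v \<longleftrightarrow> Hw x y \<and> v = HP x y"
    unfolding nb_def by (auto simp: link.simps)
  show "nb (VP x y i) v \<longleftrightarrow> Vw x y \<and> 0 < i \<and> i < b \<and> (v = VD x y i \<or> i = 1 \<and> v = Q1 x y \<or> i = b - 1 \<and> v = Q2 x (Suc y) \<or>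
     Suc i < b \<and> v = VP x y (Suc i) \<or> 1 < i \<and> v = VP x y (i - 1))"
    unfolding nb_def using b1 by (auto simp: link.simps)
  show "nb (VD x y i) v \<longleftrightarrow> Vw x y \<and> 0 < i \<and> i < b \<and> v = VP x y i"
    unfolding nb_def by (auto simp: link.simps)
qed

lemma core2_cd:
  assumes "core2 (adj G) Z"
  defines "Z' \<equiv> {v. ok v \<and> cd v \<in> Z}"
  shows "core2 nb Z'" "Z = cd ` Z'"
proof -
  have fin: "finite Z" "Z \<noteq> {}" and n: "\<And>z. z \<in> Z \<Longrightarrow> \<exists>p\<in>Z. \<exists>q\<in>Z. p \<noteq> q \<and> {z, p} \<in> E \<and> {z, q} \<in> E"
    using assms(1) unfolding core2_def adj_def G_def by auto
  have inj: "inj_on cd Z'" using cd_inject unfolding Z'_def inj_on_def by blast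
  have step: "\<exists>u p q. z = cd u \<and> ok u \<and> p \<in> Z' \<and> q \<in> Z' \<and> p \<noteq> q \<and> nb u p \<and> nb u q" if z: "z \<in> Z" for z
  proof -
    obtain p q where pq: "p \<in> Z" "q \<in> Z" "p \<noteq> q" "{z, p} \<in> E" "{z, q} \<in> E" using n[OF z] by blast
    obtain u p' u' q' where *: "z = cd u" "p = cd p'" "nb u p'" "z = cd u'" "q = cd q'" "nb u' q'"
      using pq(4,5) unfolding edge_iff by blast
    then have "u' = u" using nb_ok cd_inject by metis
    then show ?thesis using * pq nb_ok unfolding Z'_def by blast
  qed
  show "Z = cd ` Z'" using step unfolding Z'_def by blast
  then have fz: "finite Z'" "Z' \<noteq> {}" using fin inj finite_image_iff by auto
  have n2: "\<exists>p\<in>Z'. \<exists>q\<in>Z'. p \<noteq> q \<and> nb v p \<and> nb v q" if v: "v \<in> Z'" for v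
  proof -
    have "ok v" "cd v \<in> Z" using v unfolding Z'_def by auto
    then obtain u p q where u: "cd v = cd u" "ok u" "p \<in> Z'" "q \<in> Z'" "p \<noteq> q" "nb u p" "nb u q"
      using step by blast
    then have "u = v" using cd_inject \<open>ok v\<close> by metis
    then show ?thesis using u by blast
  qed
  show "core2 nb Z'" unfolding core2_def by (intro conjI ballI fz n2)
qed

lemma core2_adj:
  assumes "core2 nb Z"
  shows "core2 (adj G) (cd ` Z)"
proof -
  have "\<exists>p\<in>cd ` Z. \<exists>q\<in>cd ` Z. p \<noteq> q \<and> adj G (cd z) p \<and> adj G (cd z) q" if z: "z \<in> Z" for z
  proof -
    obtain p q where pq: "p \<in> Z" "q \<in> Z" "p \<noteq> q" "nb z p" "nb z q" using assms z unfolding core2_def by blast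
    then have "adj G (cd z) (cd p)" "adj G (cd z) (cd q)" "cd p \<noteq> cd q"
      using nb_ok cd_inject by (auto simp: adj_def G_def edge_iff)
    then show ?thesis using pq by blast
  qed
  then show ?thesis using assms unfolding core2_def by (auto simp del: bex_simps)
qed

definition D :: "(nat \<times> nat) set" where "D = {..<X} \<times> {..<Y}"

fun wadj :: "nat \<times> nat \<Rightarrow> nat \<times> nat \<Rightarrow> bool" where
  "wadj (x, y) (x', y') \<longleftrightarrow> (x' = Suc x \<and> y' = y \<and> Hw x y) \<or> (x = Suc x' \<and> y' = y \<and> Hw x' y) \<or>
     (x' = x \<and> y' = Suc y \<and> Vw x y) \<or> (x' = x \<and> y = Suc y' \<and> Vw x y')"

definition forest :: "(nat \<times> nat) set \<Rightarrow> bool" where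
  "forest S \<longleftrightarrow> \<not> (\<exists>Z\<subseteq>S. core2 wadj Z)"

fun isP :: "vtx \<Rightarrow> bool" where
  "isP (HP x y) = True" | "isP (VP x y i) = True" | "isP _ = False"

definition P :: "vtx set" where "P = {v. ok v \<and> isP v}"

fun pend :: "vtx \<Rightarrow> vtx" where
  "pend (HP x y) = HD x y" | "pend (VP x y i) = VD x y i" | "pend v = v"

lemma finite_ok: "finite {v. ok v}"
proof (rule finite_imageD[of cd])
  show "finite (cd ` {v. ok v})" by (rule finite_subset[of _ "{..<Wd * (b * Y)}"]) (auto dest: cd_less)
  show "inj_on cd {v. ok v}" by (rule inj_onI) (simp add: cd_inject)
qed

lemma finite_P: "finite P" unfolding P_def by (rule finite_subset[OF _ finite_ok]) auto

text \<open>A vertical wall enters the lower half \<open>Q2\<close> of the point above it and leaves the upper half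
  \<open>Q1\<close> of the point below it; horizontal walls join \<open>Q2\<close> to the \<open>Q1\<close> of the next point.\<close>

definition lift :: "(nat \<times> nat) set \<Rightarrow> vtx set" where
  "lift Z = {Q1 x y | x y. (x, y) \<in> Z \<and> ((x, Suc y) \<in> Z \<and> Vw x y \<or> (\<exists>x'. x = Suc x' \<and> (x', y) \<in> Z \<and> Hw x' y))} \<union>
     {Q2 x y | x y. (x, y) \<in> Z \<and> ((Suc x, y) \<in> Z \<and> Hw x y \<or> (\<exists>y'. y = Suc y' \<and> (x, y') \<in> Z \<and> Vw x y'))} \<union>
     {HP x y | x y. (x, y) \<in> Z \<and> (Suc x, y) \<in> Z \<and> Hw x y} \<union>
     {VP x y i | x y i. (x, y) \<in> Z \<and> (x, Suc y) \<in> Z \<and> Vw x y \<and> 0 < i \<and> i < b}"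

lemma lift_simps:
  "Q1 x y \<in> lift Z \<longleftrightarrow> (x, y) \<in> Z \<and> ((x, Suc y) \<in> Z \<and> Vw x y \<or> (\<exists>x'. x = Suc x' \<and> (x', y) \<in> Z \<and> Hw x' y))"
  "Q2 x y \<in> lift Z \<longleftrightarrow> (x, y) \<in> Z \<and> ((Suc x, y) \<in> Z \<and> Hw x y \<or> (\<exists>y'. y = Suc y' \<and> (x, y') \<in> Z \<and> Vw x y'))"
  "HP x y \<in> lift Z \<longleftrightarrow> (x, y) \<in> Z \<and> (Suc x, y) \<in> Z \<and> Hw x y"
  "VP x y i \<in> lift Z \<longleftrightarrow> (x, y) \<in> Z \<and> (x, Suc y) \<in> Z \<and> Vw x y \<and> 0 < i \<and> i < b"
  "HD x y \<notin> lift Z" "VD x y i \<notin> lift Z"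
  unfolding lift_def by auto

lemma core2_lift:
  assumes Z: "core2 wadj Z"
  shows "core2 nb (lift Z)"
proof -
  have two: "\<exists>p\<in>Z. \<exists>q\<in>Z. p \<noteq> q \<and> wadj (x, y) p \<and> wadj (x, y) q" if "(x, y) \<in> Z" for x y
    using Z that unfolding core2_def by blast
  define up where "up x y \<longleftrightarrow> (x, Suc y) \<in> Z \<and> Vw x y" for x y
  define dn where "dn x y \<longleftrightarrow> (\<exists>y'. y = Suc y' \<and> (x, y') \<in> Z \<and> Vw x y')" for x y
  define lf where "lf x y \<longleftrightarrow> (\<exists>x'. x = Suc x' \<and> (x', y) \<in> Z \<and> Hw x' y)" for x y
  define rt where "rt x y \<longleftrightarrow> (Suc x, y) \<in> Z \<and> Hw x y" for x y
  have cases4: "(up x y \<and> dn x y) \<or> (up x y \<and> lf x y) \<or> (up x y \<and> rt x y) \<or> (dn x y \<and> lf x y) \<or> (dn x y \<and> rt x y) \<or> (lf x y \<and> rt x y)"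
    if xy: "(x, y) \<in> Z" for x y
  proof -
    obtain x1 y1 x2 y2 where "(x1, y1) \<in> Z" "(x2, y2) \<in> Z" "(x1, y1) \<noteq> (x2, y2)" "wadj (x, y) (x1, y1)" "wadj (x, y) (x2, y2)"
      using two[OF xy] by (metis surj_pair)
    then show ?thesis unfolding wadj.simps up_def dn_def lf_def rt_def by blast
  qed
  have ok: "x < X \<and> y < Y" if "(x, y) \<in> Z" for x y
    using cases4[OF that] Hw Vw unfolding up_def dn_def lf_def rt_def by (meson Suc_lessD)
  have q1: "Q1 x y \<in> lift Z \<longleftrightarrow> (x, y) \<in> Z \<and> (up x y \<or> lf x y)" for x y
    unfolding lift_simps up_def lf_def by auto
  have q2: "Q2 x y \<in> lift Z \<longleftrightarrow> (x, y) \<in> Z \<and> (rt x y \<or> dn x y)" for x y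
    unfolding lift_simps rt_def dn_def by auto
  have b1: "0 < b - 1" "b - 1 < b" "1 < b" using b by auto
  \<comment> \<open>Inner vertices of vertical walls, those of horizontal walls and half points are
    of different kinds, so neighbours of two different kinds are distinct without further
    comparison.\<close>
  have two3: "\<exists>p\<in>lift Z. \<exists>q\<in>lift Z. p \<noteq> q \<and> nb v p \<and> nb v q"
    if t: "A \<Longrightarrow> \<exists>x y i. VP x y i \<in> lift Z \<and> nb v (VP x y i)" "B \<Longrightarrow> \<exists>x y. HP x y \<in> lift Z \<and> nb v (HP x y)"
      "C \<Longrightarrow> \<exists>w. w \<in> lift Z \<and> nb v w \<and> (\<forall>x y i. w \<noteq> VP x y i \<and> w \<noteq> HP x y)" "A \<and> B \<or> A \<and> C \<or> B \<and> C" for A B C v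
    using t(4)
  proof (elim disjE conjE)
    assume A B
    then obtain x y i x' y' where "VP x y i \<in> lift Z" "nb v (VP x y i)" "HP x' y' \<in> lift Z" "nb v (HP x' y')"
      using t(1,2) by meson
    then show ?thesis by (intro bexI[of _ "VP x y i"] bexI[of _ "HP x' y'"]) auto
  next
    assume A C then show ?thesis using t(1,3) by metis
  next
    assume B C then show ?thesis using t(2,3) by metis
  qed
  have "\<exists>p\<in>lift Z. \<exists>q\<in>lift Z. p \<noteq> q \<and> nb v p \<and> nb v q" if v: "v \<in> lift Z" for v
  proof (cases v)
    case (Q1 x y)
    then have xy: "(x, y) \<in> Z" "up x y \<or> lf x y" using v q1 by auto
    show ?thesis
    proof (rule two3)
      show "\<exists>x y i. VP x y i \<in> lift Z \<and> nb v (VP x y i)" if "up x y"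
        using that xy b1 unfolding Q1 lift_simps nb_simps up_def by auto
      show "\<exists>x y. HP x y \<in> lift Z \<and> nb v (HP x y)" if "lf x y"
        using that xy unfolding Q1 lift_simps nb_simps lf_def by auto
      show "\<exists>w. w \<in> lift Z \<and> nb v w \<and> (\<forall>x y i. w \<noteq> VP x y i \<and> w \<noteq> HP x y)" if "rt x y \<or> dn x y"
        using that xy ok[OF xy(1)] q2 by (intro exI[of _ "Q2 x y"]) (auto simp: Q1 nb_simps)
      show "up x y \<and> lf x y \<or> up x y \<and> (rt x y \<or> dn x y) \<or> lf x y \<and> (rt x y \<or> dn x y)"
        using cases4[OF xy(1)] xy(2) by blast
    qed
  next
    case (Q2 x y)
    then have xy: "(x, y) \<in> Z" "rt x y \<or> dn x y" using v q2 by auto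
    show ?thesis
    proof (rule two3)
      show "\<exists>x y i. VP x y i \<in> lift Z \<and> nb v (VP x y i)" if "dn x y"
        using that xy b1 unfolding Q2 lift_simps nb_simps dn_def by auto
      show "\<exists>x y. HP x y \<in> lift Z \<and> nb v (HP x y)" if "rt x y"
        using that xy unfolding Q2 lift_simps nb_simps rt_def by auto
      show "\<exists>w. w \<in> lift Z \<and> nb v w \<and> (\<forall>x y i. w \<noteq> VP x y i \<and> w \<noteq> HP x y)" if "up x y \<or> lf x y"
        using that xy ok[OF xy(1)] q1 by (intro exI[of _ "Q1 x y"]) (auto simp: Q2 nb_simps)
      show "dn x y \<and> rt x y \<or> dn x y \<and> (up x y \<or> lf x y) \<or> rt x y \<and> (up x y \<or> lf x y)"
        using cases4[OF xy(1)] xy(2) by blast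
    qed
  next
    case (HP x y)
    then show ?thesis using v
      by (intro bexI[of _ "Q2 x y"] bexI[of _ "Q1 (Suc x) y"]) (auto simp: lift_simps nb_simps)
  next
    case (VP x y i)
    then have xy: "(x, y) \<in> Z" "(x, Suc y) \<in> Z" "Vw x y" "0 < i" "i < b" using v by (auto simp: lift_simps)
    let ?l = "if i = 1 then Q1 x y else VP x y (i - 1)"
    let ?u = "if i = b - 1 then Q2 x (Suc y) else VP x y (Suc i)"
    have "?l \<in> lift Z" "?u \<in> lift Z" "?l \<noteq> ?u" using xy by (auto simp: lift_simps)
    moreover have "nb v ?l" "nb v ?u" using xy unfolding VP nb_simps by auto
    ultimately show ?thesis by blast
  qed (use v in \<open>auto simp: lift_simps\<close>)
  moreover have "lift Z \<subseteq> {v. ok v}"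
  proof
    fix v assume "v \<in> lift Z"
    then show "v \<in> {v. ok v}" using ok by (cases v) (auto simp: lift_simps)
  qed
  moreover have "lift Z \<noteq> {}"
  proof -
    obtain x y where "(x, y) \<in> Z" using Z unfolding core2_def by auto
    then show ?thesis using cases4[of x y] q1 q2 by blast
  qed
  ultimately show ?thesis unfolding core2_def using finite_subset[OF _ finite_ok] by blast
qed

end

section \<open>Acyclic matchings of the graph and feedback sets of the maze\<close>

context maze begin

lemma finite_D: "finite D" unfolding D_def by simp

lemma card_D: "card D = X * Y" unfolding D_def by (simp add: card_cartesian_product)

fun foot :: "vtx \<Rightarrow> nat \<times> nat" where
  "foot (HP x y) = (x, y)" | "foot (VP x y i) = (x, y)" | "foot v = (0, 0)"

lemma link_cases:
  assumes "link u v"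
  obtains "u \<in> P" | "v \<in> P" | x y where "x < X" "y < Y" "u = Q1 x y" "v = Q2 x y"
  using assms link_ok[OF assms] by (cases) (auto simp: P_def)

text \<open>A counting argument: at most as many points enter \<open>F\<close> as \<open>M\<close>
  falls short of saturating all inner path vertices and keeping all lattice points. A wall with an
  unsaturated inner vertex is cut in the induced subgraph, and deleting its foot cuts it in the
  maze.\<close>

lemma feedback_of_matching:
  assumes M: "acyclic_matching G M"
  obtains F where "F \<subseteq> D" "card F + card M \<le> card P + X * Y" "forest (D - F)"
proof -
  define VM where "VM = {v. ok v \<and> cd v \<in> \<Union>M}"
  define bad where "bad = {(x, y) \<in> D. \<not> (Q1 x y \<in> VM \<and> Q2 x y \<in> VM)}"
  define F where "F = bad \<union> (foot ` (P - VM) \<inter> D)"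
  have ME: "M \<subseteq> E" and disj: "\<And>e f. e \<in> M \<Longrightarrow> f \<in> M \<Longrightarrow> e \<inter> f \<noteq> {} \<Longrightarrow> e = f"
    using M unfolding acyclic_matching_def matching_def G_def by auto
  have finB: "finite bad" "bad \<subseteq> D" unfolding bad_def by (auto intro: finite_subset[OF _ finite_D])
  have FD: "F \<subseteq> D" unfolding F_def using finB by auto
  have ex: "(\<exists>p\<in>P \<inter> VM. cd p \<in> e) \<or> (\<exists>x y. (x, y) \<in> D - bad \<and> e = {cd (Q1 x y), cd (Q2 x y)})" if e: "e \<in> M" for e
  proof -
    obtain u v where uv: "e = {cd u, cd v}" "link u v" using ME e unfolding E_def by blast
    have VM: "u \<in> VM" "v \<in> VM" using uv e link_ok unfolding VM_def by auto
    show ?thesis using uv(2)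
    proof (cases rule: link_cases)
      case (3 x y)
      then show ?thesis using VM uv unfolding bad_def D_def by auto
    qed (use VM uv in auto)
  qed
  \<comment> \<open>Charges an edge to a saturated inner vertex on it or, failing that, to the
    lattice point whose split edge it is. Edges of \<open>M\<close> are disjoint, so no target is
    charged twice.\<close>
  define g where "g e = (if \<exists>p\<in>P \<inter> VM. cd p \<in> e then Inl (SOME p. p \<in> P \<inter> VM \<and> cd p \<in> e)
     else Inr (SOME z. z \<in> D - bad \<and> cd (Q1 (fst z) (snd z)) \<in> e))" for e
  have g1: "p \<in> P \<inter> VM \<and> cd p \<in> e" if "e \<in> M" "g e = Inl p" for e p
  proof -
    have ex1: "\<exists>p. p \<in> P \<inter> VM \<and> cd p \<in> e" and "p = (SOME p. p \<in> P \<inter> VM \<and> cd p \<in> e)"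
      using that(2) unfolding g_def by (auto split: if_splits)
    then show ?thesis using someI_ex[OF ex1] by simp
  qed
  have g2: "z \<in> D - bad \<and> cd (Q1 (fst z) (snd z)) \<in> e" if e: "e \<in> M" "g e = Inr z" for e z
  proof -
    have no: "\<not> (\<exists>p\<in>P \<inter> VM. cd p \<in> e)" and z: "z = (SOME z. z \<in> D - bad \<and> cd (Q1 (fst z) (snd z)) \<in> e)"
      using e(2) unfolding g_def by (auto split: if_splits)
    obtain x y where "(x, y) \<in> D - bad" "e = {cd (Q1 x y), cd (Q2 x y)}" using ex[OF e(1)] no by blast
    then have ex1: "\<exists>z. z \<in> D - bad \<and> cd (Q1 (fst z) (snd z)) \<in> e" by (intro exI[of _ "(x, y)"]) auto
    then show ?thesis using someI_ex[OF ex1] z by simp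
  qed
  have inj: "inj_on g M"
  proof (rule inj_onI)
    fix e f assume ef: "e \<in> M" "f \<in> M" "g e = g f"
    show "e = f"
    proof (cases "g e")
      case (Inl p)
      then have "cd p \<in> e \<inter> f" using g1 ef by auto
      then show ?thesis using disj ef by blast
    next
      case (Inr z)
      then have "cd (Q1 (fst z) (snd z)) \<in> e \<inter> f" using g2 ef by auto
      then show ?thesis using disj ef by blast
    qed
  qed
  have "g ` M \<subseteq> (P \<inter> VM) <+> (D - bad)"
  proof
    fix w assume "w \<in> g ` M"
    then obtain e where e: "e \<in> M" "w = g e" by blast
    show "w \<in> (P \<inter> VM) <+> (D - bad)"
    proof (cases w)
      case (Inl p) then show ?thesis using g1[OF e(1), of p] e(2) by (metis InlI)
    next
      case (Inr z) then show ?thesis using g2[OF e(1), of z] e(2) by (metis InrI)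
    qed
  qed
  then have "card M \<le> card ((P \<inter> VM) <+> (D - bad))"
    using inj finite_P finite_D by (intro card_inj_on_le[of g]) auto
  also have "\<dots> = card (P \<inter> VM) + card (D - bad)" using finite_P finite_D by (simp add: card_Plus)
  finally have m: "card M \<le> card (P \<inter> VM) + (X * Y - card bad)"
    using finB by (simp add: card_Diff_subset card_D)
  have "card F \<le> card bad + card (P - VM)"
  proof -
    have "card F \<le> card bad + card (foot ` (P - VM) \<inter> D)" unfolding F_def by (rule card_Un_le)
    also have "card (foot ` (P - VM) \<inter> D) \<le> card (foot ` (P - VM))"
      using finite_P by (intro card_mono) auto
    also have "\<dots> \<le> card (P - VM)" using finite_P by (intro card_image_le) auto
    finally show ?thesis by simp
  qed
  moreover have "card (P \<inter> VM) + card (P - VM) = card P"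
    using finite_P by (metis Int_Diff_Un Int_Diff_disjoint card_Un_disjoint finite_Diff finite_Int)
  moreover have "card bad \<le> X * Y" using finB card_mono[OF finite_D] card_D by metis
  ultimately have cardF: "card F + card M \<le> card P + X * Y" using m by linarith
  have "forest (D - F)"
    unfolding forest_def
  proof
    assume "\<exists>Z\<subseteq>D - F. core2 wadj Z"
    then obtain Z where Z: "Z \<subseteq> D - F" "core2 wadj Z" by blast
    have notbad: "Q1 x y \<in> VM" "Q2 x y \<in> VM" if "(x, y) \<in> Z" for x y
      using Z(1) that unfolding F_def bad_def by auto
    have keep: "v \<in> VM" if "v \<in> P" "foot v \<in> Z" for v
      using Z(1) that unfolding F_def by blast
    \<comment> \<open>A core surviving in the maze lifts to one all of whose vertices are saturated,
      against the acyclicity of \<open>M\<close>.\<close>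
    have "lift Z \<subseteq> VM"
    proof
      fix v assume v: "v \<in> lift Z"
      show "v \<in> VM"
      proof (cases v)
        case (HP x y)
        then show ?thesis using v keep[of v] by (auto simp: lift_simps P_def)
      next
        case (VP x y i)
        then show ?thesis using v keep[of v] by (auto simp: lift_simps P_def)
      qed (use v notbad in \<open>auto simp: lift_simps\<close>)
    qed
    then have "cd ` lift Z \<subseteq> \<Union>M" unfolding VM_def by blast
    then have "\<exists>Z\<subseteq>\<Union>M. core2 (adj G) Z" using core2_adj[OF core2_lift[OF Z(2)]] by blast
    then show False using M acyclic_induced_iff[OF card_E] unfolding acyclic_matching_def by blast
  qed
  then show ?thesis using that FD cardF by blast
qed

lemma pend_nb: "v \<in> P \<Longrightarrow> nb v (pend v) \<and> \<not> isP (pend v) \<and> ok (pend v)"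
  unfolding P_def by (cases v) (auto simp: nb_simps)

lemma pend_inj: "u \<in> P \<Longrightarrow> v \<in> P \<Longrightarrow> pend u = pend v \<Longrightarrow> u = v"
  unfolding P_def by (cases u; cases v) auto

lemma pend_not_Q: "v \<in> P \<Longrightarrow> pend v \<noteq> Q1 x y \<and> pend v \<noteq> Q2 x y \<and> v \<noteq> Q1 x y \<and> v \<noteq> Q2 x y"
  unfolding P_def by (cases v) auto

text \<open>Pendant vertices cannot lie in a core, so an inner vertex drags its whole wall with both
  ends into it; contracting the walls yields a core of lattice points.\<close>

lemma core2_walls:
  assumes Z: "core2 nb Z" and S: "\<And>x y. Q1 x y \<in> Z \<or> Q2 x y \<in> Z \<Longrightarrow> (x, y) \<in> S"
  shows "\<exists>Z'\<subseteq>S. core2 wadj Z'"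
proof -
  have fin: "finite Z" "Z \<noteq> {}" and two: "\<And>v. v \<in> Z \<Longrightarrow> \<exists>p\<in>Z. \<exists>q\<in>Z. p \<noteq> q \<and> nb v p \<and> nb v q"
    using Z unfolding core2_def by auto
  have ok: "ok v" if "v \<in> Z" for v using two[OF that] nb_ok by blast
  have HD: "HD x y \<notin> Z" for x y using two[of "HD x y"] unfolding nb_simps by blast
  have VD: "VD x y i \<notin> Z" for x y i using two[of "VD x y i"] unfolding nb_simps by blast
  have hp: "Q2 x y \<in> Z \<and> Q1 (Suc x) y \<in> Z \<and> Hw x y" if "HP x y \<in> Z" for x y
    using two[OF that] HD unfolding nb_simps by blast
  have VP: "(if i = 1 then Q1 x y \<in> Z else VP x y (i - 1) \<in> Z) \<and> (if i = b - 1 then Q2 x (Suc y) \<in> Z else VP x y (Suc i) \<in> Z)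
      \<and> Vw x y \<and> 0 < i \<and> i < b" if "VP x y i \<in> Z" for x y i
    using two[OF that] VD unfolding nb_simps by (auto; blast?)
  have VPlow: "Q1 x y \<in> Z" if "VP x y i \<in> Z" for x y i
    using that
  proof (induction i)
    case 0 then show ?case using VP by blast
  next
    case (Suc i) then show ?case using VP[OF Suc.prems] by (cases "i = 0") auto
  qed
  have VPup: "VP x y i \<in> Z \<Longrightarrow> Q2 x (Suc y) \<in> Z" for x y i
  proof (induction "b - i" arbitrary: i rule: less_induct)
    case less
    show ?case
    proof (cases "i = b - 1")
      case True then show ?thesis using VP[OF less.prems] by simp
    next
      case False
      then have "VP x y (Suc i) \<in> Z" "i < b" using VP[OF less.prems] by auto
      then show ?thesis using less.hyps[of "Suc i"] by simp
    qed
  qed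
  define Z' where "Z' = {(x, y). Q1 x y \<in> Z \<or> Q2 x y \<in> Z}"
  define up where "up x y \<longleftrightarrow> VP x y 1 \<in> Z \<and> Vw x y" for x y
  define dn where "dn x y \<longleftrightarrow> (\<exists>y'. y = Suc y' \<and> VP x y' (b - 1) \<in> Z \<and> Vw x y')" for x y
  define lf where "lf x y \<longleftrightarrow> (\<exists>x'. x = Suc x' \<and> HP x' y \<in> Z \<and> Hw x' y)" for x y
  define rt where "rt x y \<longleftrightarrow> HP x y \<in> Z \<and> Hw x y" for x y
  have u: "(x, Suc y) \<in> Z' \<and> wadj (x, y) (x, Suc y)" if "up x y" for x y
    using that VPup[of x y 1] unfolding up_def Z'_def by auto
  have d: "\<exists>y'. y = Suc y' \<and> (x, y') \<in> Z' \<and> wadj (x, y) (x, y')" if "dn x y" for x y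
    using that VPlow[of x _ "b - 1"] unfolding dn_def Z'_def by auto
  have l: "\<exists>x'. x = Suc x' \<and> (x', y) \<in> Z' \<and> wadj (x, y) (x', y)" if "lf x y" for x y
    using that hp unfolding lf_def Z'_def by auto
  have r: "(Suc x, y) \<in> Z' \<and> wadj (x, y) (Suc x, y)" if "rt x y" for x y
    using that hp unfolding rt_def Z'_def by auto
  have q1: "(up x y \<and> lf x y) \<or> ((up x y \<or> lf x y) \<and> Q2 x y \<in> Z)" if "Q1 x y \<in> Z" for x y
    using two[OF that] unfolding nb_simps up_def lf_def by blast
  have q2: "(dn x y \<and> rt x y) \<or> ((dn x y \<or> rt x y) \<and> Q1 x y \<in> Z)" if "Q2 x y \<in> Z" for x y
    using two[OF that] unfolding nb_simps dn_def rt_def by blast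
  have "\<exists>p\<in>Z'. \<exists>q\<in>Z'. p \<noteq> q \<and> wadj z p \<and> wadj z q" if "z \<in> Z'" for z
  proof -
    obtain x y where z: "z = (x, y)" by fastforce
    have "(up x y \<and> lf x y) \<or> (dn x y \<and> rt x y) \<or> ((up x y \<or> lf x y) \<and> (dn x y \<or> rt x y))"
      using that q1[of x y] q2[of x y] unfolding z Z'_def by blast
    then consider "up x y" "lf x y" | "dn x y" "rt x y" | "up x y" "dn x y" | "up x y" "rt x y" | "lf x y" "dn x y" | "lf x y" "rt x y"
      by blast
    then show ?thesis
    proof cases
      case 1 then show ?thesis using u[OF 1(1)] l[OF 1(2)] unfolding z by (metis Pair_inject n_not_Suc_n)
    next
      case 2 then show ?thesis using d[OF 2(1)] r[OF 2(2)] unfolding z by (metis Pair_inject n_not_Suc_n)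
    next
      case 3
      then obtain y' where "y = Suc y'" "(x, y') \<in> Z'" "wadj (x, y) (x, y')" using d by blast
      then show ?thesis using u[OF 3(1)] unfolding z by (intro bexI[of _ "(x, y')"] bexI[of _ "(x, Suc y)"]) auto
    next
      case 4 then show ?thesis using u[OF 4(1)] r[OF 4(2)] unfolding z by (metis Pair_inject n_not_Suc_n)
    next
      case 5 then show ?thesis using l[OF 5(1)] d[OF 5(2)] unfolding z by (metis Pair_inject n_not_Suc_n)
    next
      case 6
      then obtain x' where "x = Suc x'" "(x', y) \<in> Z'" "wadj (x, y) (x', y)" using l by blast
      then show ?thesis using r[OF 6(2)] unfolding z by (intro bexI[of _ "(x', y)"] bexI[of _ "(Suc x, y)"]) auto
    qed
  qed
  moreover have "finite Z'"
  proof (rule finite_subset[OF _ finite_D])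
    show "Z' \<subseteq> D" unfolding Z'_def D_def by (auto dest!: ok)
  qed
  moreover have "Z' \<noteq> {}"
  proof -
    obtain v where v: "v \<in> Z" using fin by blast
    have "\<exists>x y. Q1 x y \<in> Z \<or> Q2 x y \<in> Z"
    proof (cases v)
      case (HP x y) then show ?thesis using v hp by blast
    next
      case (VP x y i) then show ?thesis using v VPlow by blast
    qed (use v HD VD in blast)+
    then show ?thesis unfolding Z'_def by auto
  qed
  moreover have "Z' \<subseteq> S" using S unfolding Z'_def by auto
  ultimately have "Z' \<subseteq> S \<and> core2 wadj Z'" unfolding core2_def by (intro conjI ballI)
  then show ?thesis by blast
qed

text \<open>The pendant edges saturate all inner path vertices without closing a cycle by
  themselves: a cycle also needs halves of lattice points, and only those outside \<open>F\<close>
  are saturated.\<close>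

lemma matching_of_feedback:
  assumes F: "F \<subseteq> D" "forest (D - F)"
  obtains M where "acyclic_matching G M" "card M = card P + (X * Y - card F)"
proof -
  define e1 where "e1 v = {cd v, cd (pend v)}" for v
  define e2 where "e2 z = {cd (Q1 (fst z) (snd z)), cd (Q2 (fst z) (snd z))}" for z
  define M where "M = e1 ` P \<union> e2 ` (D - F)"
  have okP: "ok v" "ok (pend v)" "nb v (pend v)" if "v \<in> P" for v using that pend_nb P_def by auto
  have okD: "ok (Q1 (fst z) (snd z))" "ok (Q2 (fst z) (snd z))" if "z \<in> D" for z using that unfolding D_def by auto
  have d11: "v = w" if "v \<in> P" "w \<in> P" "e1 v \<inter> e1 w \<noteq> {}" for v w
  proof -
    have "v = w \<or> v = pend w \<or> pend v = w \<or> pend v = pend w"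
      using that okP cd_inject unfolding e1_def by auto
    then show ?thesis using that pend_nb[of v] pend_nb[of w] pend_inj P_def by auto
  qed
  have d22: "z = w" if "z \<in> D" "w \<in> D" "e2 z \<inter> e2 w \<noteq> {}" for z w
    using that okD[of z] okD[of w] by (auto simp: e2_def cd_inject prod_eq_iff)
  have d12: "e1 v \<inter> e2 z = {}" if "v \<in> P" "z \<in> D" for v z
    using that okD[of z] okP[of v] pend_not_Q[of v] by (auto simp: e1_def e2_def cd_inject)
  have ne: "e1 v \<noteq> {}" "e2 z \<noteq> {}" for v z unfolding e1_def e2_def by auto
  have "matching G M"
    unfolding matching_def
  proof (intro conjI ballI impI)
    show "M \<subseteq> edges G"
    proof
      fix e assume "e \<in> M"
      then consider v where "v \<in> P" "e = e1 v" | z where "z \<in> D" "e = e2 z" unfolding M_def by auto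
      then show "e \<in> edges G"
      proof cases
        case 1 then show ?thesis using okP[OF 1(1)] by (simp add: e1_def G_def edge_cd)
      next
        case 2 
        then have "nb (Q1 (fst z) (snd z)) (Q2 (fst z) (snd z))" unfolding D_def nb_simps by auto
        then show ?thesis using 2 okD[OF 2(1)] by (simp add: e2_def G_def edge_cd)
      qed
    qed
    fix e f assume ef: "e \<in> M" "f \<in> M" "e \<noteq> f"
    then consider v w where "v \<in> P" "w \<in> P" "e = e1 v" "f = e1 w" | v z where "v \<in> P" "z \<in> D" "e = e1 v" "f = e2 z"
      | v z where "v \<in> P" "z \<in> D" "f = e1 v" "e = e2 z" | z w where "z \<in> D" "w \<in> D" "e = e2 z" "f = e2 w"
      unfolding M_def by blast
    then show "e \<inter> f = {}"
    proof cases
      case 1 then show ?thesis using d11[of v w] ef(3) by metis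
    next
      case 2 then show ?thesis using d12 by simp
    next
      case 3 then show ?thesis using d12[of v z] by (simp add: Int_commute)
    next
      case 4 then show ?thesis using d22[of z w] ef(3) by metis
    qed
  qed
  moreover have "acyclic_graph (induced G (\<Union>M))"
    unfolding acyclic_induced_iff[OF card_E]
  proof
    assume "\<exists>Z\<subseteq>\<Union>M. core2 (adj G) Z"
    then obtain Z where Z: "Z \<subseteq> \<Union>M" "core2 (adj G) Z" by blast
    let ?Z = "{v. ok v \<and> cd v \<in> Z}"
    have "\<exists>Z'\<subseteq>D - F. core2 wadj Z'"
    proof (rule core2_walls[OF core2_cd(1)[OF Z(2)]])
      fix x y assume "Q1 x y \<in> ?Z \<or> Q2 x y \<in> ?Z"
      then obtain w where w: "w = Q1 x y \<or> w = Q2 x y" "ok w" "cd w \<in> \<Union>M" using Z(1) by blast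
      then have D: "(x, y) \<in> D" unfolding D_def by auto
      from w(3) consider v where "v \<in> P" "cd w \<in> e1 v" | z where "z \<in> D - F" "cd w \<in> e2 z" unfolding M_def by auto
      then show "(x, y) \<in> D - F"
      proof cases
        case 1 then show ?thesis using okP[of v] pend_not_Q[of v x y] w by (auto simp: e1_def cd_inject)
      next
        case 2 then show ?thesis using okD[of z] w by (auto simp: e2_def cd_inject)
      qed
    qed
    then show False using F(2) unfolding forest_def by blast
  qed
  moreover have "card M = card P + (X * Y - card F)"
  proof -
    have "inj_on e1 P" "inj_on e2 (D - F)" using d11 d22 ne by (auto intro!: inj_onI)
    then have "card (e1 ` P) = card P" "card (e2 ` (D - F)) = card (D - F)" by (auto simp: card_image)
    moreover have "e1 ` P \<inter> e2 ` (D - F) = {}" using d12 ne by fastforce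
    ultimately have "card M = card P + card (D - F)"
      unfolding M_def using finite_P finite_D by (subst card_Un_disjoint) auto
    then show ?thesis using F(1) finite_D by (simp add: card_Diff_subset finite_subset card_D)
  qed
  ultimately show ?thesis using that unfolding acyclic_matching_def by blast
qed

end

section \<open>Planarity, degrees, girth and edge elimination\<close>

context maze begin

lemma planar_G: "planar G"
proof (rule lattice_graph_planar[where pos = "\<lambda>n. (int (n mod Wd), int (n div Wd))"])
  show "inj_on (\<lambda>n. (int (n mod Wd), int (n div Wd))) (verts G)"
    by (rule inj_onI) (metis Pair_inject div_mult_mod_eq of_nat_eq_iff)
  fix e assume "e \<in> edges G"
  then obtain u v where e: "e = {cd u, cd v}" "link u v" unfolding G_def E_def by auto
  then have o: "ok u" "ok v" using link_ok by auto
  have "unit_step (int (cd u mod Wd), int (cd u div Wd)) (int (cd v mod Wd), int (cd v div Wd))"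
    unfolding decode[OF o(1)] decode[OF o(2)] unit_step_def using link_step[OF e(2)] by auto
  moreover have "cd u \<in> verts G" "cd v \<in> verts G" using o cd_less by (auto simp: G_def)
  ultimately show "\<exists>u v. e = {u, v} \<and> u \<in> verts G \<and> v \<in> verts G \<and>
      unit_step (int (u mod Wd), int (u div Wd)) (int (v mod Wd), int (v div Wd))"
    using e(1) by blast
qed

lemma nbhd_cd: "ok v \<Longrightarrow> nbhd G (cd v) = cd ` {w. nb v w}"
proof -
  assume v: "ok v"
  have "n \<in> nbhd G (cd v) \<longleftrightarrow> n \<in> cd ` {w. nb v w}" for n
  proof
    assume "n \<in> nbhd G (cd v)"
    then obtain u w where "cd v = cd u" "n = cd w" "nb u w" unfolding nbhd_def G_def by (auto simp: edge_iff)
    then show "n \<in> cd ` {w. nb v w}" using nb_ok cd_inject v by blast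
  qed (auto simp: nbhd_def G_def edge_iff)
  then show ?thesis by blast
qed

lemma nbs_subset:
  obtains p q r where "{w. nb v w} \<subseteq> {p, q, r}"
proof (cases v)
  case (Q1 x y)
  have "{w. nb v w} \<subseteq> {Q2 x y, HP (x - 1) y, VP x y 1}" by (auto simp: Q1 nb_simps)
  then show ?thesis using that by blast
next
  case (Q2 x y)
  have "{w. nb v w} \<subseteq> {Q1 x y, HP x y, VP x (y - 1) (b - 1)}" by (auto simp: Q2 nb_simps)
  then show ?thesis using that by blast
next
  case (HP x y)
  have "{w. nb v w} \<subseteq> {Q2 x y, Q1 (Suc x) y, HD x y}" by (auto simp: HP nb_simps)
  then show ?thesis using that by blast
next
  case (HD x y)
  have "{w. nb v w} \<subseteq> {HP x y, HP x y, HP x y}" by (auto simp: HD nb_simps)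
  then show ?thesis using that by blast
next
  case (VP x y i)
  have "{w. nb v w} \<subseteq> {VD x y i, if i = 1 then Q1 x y else VP x y (i - 1), if i = b - 1 then Q2 x (Suc y) else VP x y (Suc i)}"
    by (auto simp: VP nb_simps)
  then show ?thesis using that by blast
next
  case (VD x y i)
  have "{w. nb v w} \<subseteq> {VP x y i, VP x y i, VP x y i}" by (auto simp: VD nb_simps)
  then show ?thesis using that by blast
qed

lemma degree_le: "vdegree G n \<le> 3"
proof (cases "\<exists>v. ok v \<and> n = cd v")
  case True
  then obtain v where v: "ok v" "n = cd v" by blast
  obtain p q r where "{w. nb v w} \<subseteq> {p, q, r}" by (rule nbs_subset)
  then have "nbhd G n \<subseteq> {cd p, cd q, cd r}" unfolding v(2) nbhd_cd[OF v(1)] by auto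
  then have "card (nbhd G n) \<le> card {cd p, cd q, cd r}" by (intro card_mono) auto
  also have "\<dots> \<le> 3" by (simp add: card_insert_if)
  finally show ?thesis unfolding vdegree_def .
next
  case False
  then have "nbhd G n = {}" unfolding nbhd_def G_def using nb_ok by (auto simp: edge_iff)
  then show ?thesis unfolding vdegree_def by simp
qed

lemma max_degree_G:
  assumes "Hw x y" "Vw (Suc x) y"
  shows "max_degree G = 3"
proof -
  have o: "ok (Q1 (Suc x) y)" using Hw[OF assms(1)] by simp
  have "{w. nb (Q1 (Suc x) y) w} = {Q2 (Suc x) y, HP x y, VP (Suc x) y 1}"
    using assms Hw[OF assms(1)] by (auto simp: nb_simps)
  then have "nbhd G (cd (Q1 (Suc x) y)) = cd ` {Q2 (Suc x) y, HP x y, VP (Suc x) y 1}" using nbhd_cd[OF o] by simp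
  moreover have "inj_on cd {Q2 (Suc x) y, HP x y, VP (Suc x) y 1}"
    by (rule inj_onI) (use assms Hw[OF assms(1)] b in \<open>auto simp: cd_inject\<close>)
  ultimately have "vdegree G (cd (Q1 (Suc x) y)) = 3" unfolding vdegree_def by (simp add: card_image)
  moreover have "cd (Q1 (Suc x) y) \<in> verts G" using cd_less[OF o] by (simp add: G_def)
  ultimately have "3 \<in> vdegree G ` verts G" by (metis imageI)
  then show ?thesis
    unfolding max_degree_def using degree_le by (intro Max_eqI) (auto simp: G_def)
qed

text \<open>A cycle without vertical walls would run to the right for ever.\<close>

lemma core2_card:
  assumes "core2 nb Z"
  shows "b - 1 \<le> card Z"
proof -
  have fin: "finite Z" "Z \<noteq> {}" and two: "\<And>v. v \<in> Z \<Longrightarrow> \<exists>p\<in>Z. \<exists>q\<in>Z. p \<noteq> q \<and> nb v p \<and> nb v q"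
    using assms unfolding core2_def by auto
  have HD: "HD x y \<notin> Z" for x y using two[of "HD x y"] unfolding nb_simps by blast
  have VD: "VD x y i \<notin> Z" for x y i using two[of "VD x y i"] unfolding nb_simps by blast
  have hp: "Q2 x y \<in> Z \<and> Q1 (Suc x) y \<in> Z \<and> Hw x y" if "HP x y \<in> Z" for x y
    using two[OF that] HD unfolding nb_simps by blast
  have vp: "(i \<noteq> 1 \<longrightarrow> VP x y (i - 1) \<in> Z) \<and> (i \<noteq> b - 1 \<longrightarrow> VP x y (Suc i) \<in> Z) \<and> 0 < i \<and> i < b" if "VP x y i \<in> Z" for x y i
    using two[OF that] VD unfolding nb_simps by (auto; blast?)
  show ?thesis
  proof (cases "\<exists>x y i. VP x y i \<in> Z")
    case True
    then obtain x y i where i: "VP x y i \<in> Z" by blast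
    have low: "VP x y (i - k) \<in> Z" if "k < i" for k
      using that
    proof (induction k)
      case 0 then show ?case using i by simp
    next
      case (Suc k)
      then have "VP x y (i - k) \<in> Z" "i - k \<noteq> 1" by auto
      then have "VP x y (i - k - 1) \<in> Z" using vp by blast
      then show ?case by simp
    qed
    have up: "VP x y (i + k) \<in> Z" if "i + k < b" for k
      using that
    proof (induction k)
      case 0 then show ?case using i by simp
    next
      case (Suc k)
      then have "VP x y (i + k) \<in> Z" "i + k \<noteq> b - 1" by auto
      then have "VP x y (Suc (i + k)) \<in> Z" using vp by blast
      then show ?case by simp
    qed
    have "VP x y j \<in> Z" if "0 < j" "j < b" for j
      using low[of "i - j"] up[of "j - i"] that vp[OF i] by (cases "j \<le> i") auto
    then have "VP x y ` {1..<b} \<subseteq> Z" by auto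
    then have "card (VP x y ` {1..<b}) \<le> card Z" using fin by (intro card_mono)
    moreover have "card (VP x y ` {1..<b}) = b - 1" by (subst card_image) (auto simp: inj_on_def)
    ultimately show ?thesis by simp
  next
    case False
    have q1: "Q2 x y \<in> Z" if "Q1 x y \<in> Z" for x y
      using two[OF that] False unfolding nb_simps by blast
    have q2: "HP x y \<in> Z" if "Q2 x y \<in> Z" for x y
      using two[OF that] False unfolding nb_simps by blast
    have run: "Q2 (x + k) y \<in> Z" if "Q2 x y \<in> Z" for x y k
    proof (induction k)
      case 0 then show ?case using that by simp
    next
      case (Suc k) then show ?case using q1 hp[OF q2[OF Suc]] by simp
    qed
    obtain v where v: "v \<in> Z" using fin by blast
    have "\<exists>x y. Q2 x y \<in> Z"
    proof (cases v)
      case (HP x y) then show ?thesis using v hp by blast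
    next
      case (Q1 x y) then show ?thesis using v q1 by blast
    qed (use v HD VD False in blast)+
    then obtain x y where "Q2 x y \<in> Z" by blast
    then have "Q2 (x + X) y \<in> Z" using run by blast
    then have "ok (Q2 (x + X) y)" using two nb_ok by blast
    then show ?thesis by simp
  qed
qed

lemma girth_G: "l < b \<Longrightarrow> enat l \<le> girth G"
  unfolding girth_def
proof (rule INF_greatest)
  fix c assume l: "l < b" and "c \<in> {c. is_cycle G c}"
  then have c: "is_cycle G c" by simp
  then have "core2 (adj G) (set c)" by (rule cycle_core2)
  note * = core2_cd[OF this]
  have "b - 1 \<le> card {v. ok v \<and> cd v \<in> set c}" by (rule core2_card[OF *(1)])
  also have "\<dots> = card (cd ` {v. ok v \<and> cd v \<in> set c})"
    by (rule card_image[symmetric]) (rule inj_onI, simp add: cd_inject)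
  also have "\<dots> = card (set c)" using *(2) by simp
  also have "\<dots> \<le> length c" by (rule card_length)
  finally show "enat l \<le> enat (length c)" using l by simp
qed

definition side :: "vtx \<Rightarrow> bool" where "side v \<longleftrightarrow> even (rw v + cl v)"

lemma nb_side: "nb u v \<Longrightarrow> side u \<noteq> side v"
  unfolding nb_def side_def using link_step[of u v] link_step[of v u] by auto

definition orient :: "vtx \<Rightarrow> vtx \<Rightarrow> nat \<times> nat" where
  "orient u v = (if side u then (cd u, cd v) else (cd v, cd u))"

lemma perfect_elimination_G: "perfect_elimination_bipartite G"
proof -
  \<comment> \<open>The checkerboard colouring of the drawing, in which every link joins
    neighbouring positions.\<close>
  define A where "A = {n \<in> verts G. even (n div Wd + n mod Wd)}"
  define B where "B = verts G - A"
  have inA: "cd v \<in> A \<longleftrightarrow> side v" "cd v \<in> B \<longleftrightarrow> \<not> side v" if "ok v" for v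
    using that cd_less[OF that] decode[OF that] unfolding A_def B_def side_def by (auto simp: G_def)
  obtain ps where ps: "set ps = P" "distinct ps" using finite_distinct_list[OF finite_P] by blast
  obtain zs where zs: "set zs = D" "distinct zs" using finite_distinct_list[OF finite_D] by blast
  define f1 where "f1 v = (v, pend v)" for v
  define f2 where "f2 z = (Q1 (fst z) (snd z), Q2 (fst z) (snd z))" for z
  \<comment> \<open>When the split edges have their turn, all inner path vertices are gone, so
    \<open>Q2\<close> retains no neighbour but \<open>Q1\<close>. Every link contains an inner
    vertex or is a split edge, hence no edge remains at the end.\<close>
  define us where "us = map f1 ps @ map f2 zs"
  define es where "es = map (\<lambda>(u, v). orient u v) us"
  have okP: "ok v" "ok (pend v)" "nb v (pend v)" "\<not> isP (pend v)" "isP v" if "v \<in> P" for v using that pend_nb P_def by auto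
  have set_us: "set us = f1 ` P \<union> f2 ` D" unfolding us_def using ps zs by auto
  have nb_us: "nb u v" if "(u, v) \<in> set us" for u v
    using that okP unfolding set_us f1_def f2_def D_def by (auto simp: nb_simps)
  have dj: "u \<noteq> u' \<and> u \<noteq> v' \<and> v \<noteq> u' \<and> v \<noteq> v'" if t: "(u, v) \<in> set us" "(u', v') \<in> set us" "(u, v) \<noteq> (u', v')" for u v u' v'
  proof -
    consider "u \<in> P" "v = pend u" "u' \<in> P" "v' = pend u'" | z where "u \<in> P" "v = pend u" "u' = Q1 (fst z) (snd z)" "v' = Q2 (fst z) (snd z)"
      | z where "u' \<in> P" "v' = pend u'" "u = Q1 (fst z) (snd z)" "v = Q2 (fst z) (snd z)"
      | z z' where "u = Q1 (fst z) (snd z)" "v = Q2 (fst z) (snd z)" "u' = Q1 (fst z') (snd z')" "v' = Q2 (fst z') (snd z')"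
      using t(1,2) unfolding set_us f1_def f2_def by auto
    then show ?thesis
    proof cases
      case 1
      then have "u \<noteq> u'" using t(3) by auto
      then show ?thesis using 1 okP(4)[of u] okP(4)[of u'] okP(5)[of u] okP(5)[of u'] pend_inj by metis
    next
      case 2 then show ?thesis using pend_not_Q[of u] by metis
    next
      case 3 then show ?thesis using pend_not_Q[of u'] by metis
    next
      case 4 then show ?thesis using t(3) by auto
    qed
  qed
  have "distinct (map f1 ps)" "distinct (map f2 zs)" 
    using ps zs by (auto simp: distinct_map inj_on_def f1_def f2_def prod_eq_iff)
  moreover have "f1 ` P \<inter> f2 ` D = {}" using pend_not_Q unfolding f1_def f2_def by fastforce
  ultimately have dus: "distinct us" unfolding us_def using ps zs by auto
  have es_mem: "\<exists>u v. (u, v) \<in> set us \<and> (x, y) = orient u v" if "(x, y) \<in> set es" for x y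
    using that unfolding es_def by auto
  have elim: "eliminated es j = (\<Union>w\<in>set (take j us). {cd (fst w), cd (snd w)})" for j
  proof -
    have "(case orient (fst w) (snd w) of (x, y) \<Rightarrow> {x, y}) = {cd (fst w), cd (snd w)}" for w
      by (auto simp: orient_def)
    then show ?thesis unfolding eliminated_def es_def take_map set_map by (simp add: case_prod_unfold)
  qed
  have inj_or: "(u, v) = (u', v')" if "(u, v) \<in> set us" "(u', v') \<in> set us" "orient u v = orient u' v'" for u v u' v'
  proof (rule ccontr)
    assume n: "(u, v) \<noteq> (u', v')"
    have "ok u" "ok v" "ok u'" "ok v'" using nb_us that nb_ok by blast+
    then show False using dj[OF that(1,2) n] that(3) unfolding orient_def by (auto simp: cd_inject split: if_splits)
  qed
  show ?thesis
  proof (rule perfect_elimination_leaves[of G A B es])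
    show "bipartition G A B"
      unfolding bipartition_def
    proof (intro conjI ballI)
      show "A \<inter> B = {}" "A \<union> B = verts G" unfolding A_def B_def by auto
      fix e assume "e \<in> edges G"
      then obtain u v where e: "e = {cd u, cd v}" "link u v" unfolding G_def E_def by auto
      then have uv: "ok u" "ok v" "side u \<noteq> side v" using link_ok nb_side[of u v] unfolding nb_def by auto
      show "\<exists>x\<in>A. \<exists>y\<in>B. e = {x, y}"
      proof (cases "side u")
        case True then show ?thesis using e uv inA by (intro bexI[of _ "cd u"] bexI[of _ "cd v"]) auto
      next
        case False then show ?thesis using e uv inA by (intro bexI[of _ "cd v"] bexI[of _ "cd u"]) (auto simp: insert_commute)
      qed
    qed
    show "x \<in> A \<and> y \<in> B \<and> {x, y} \<in> edges G" if xy: "(x, y) \<in> set es" for x y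
    proof -
      obtain u v where uv: "(u, v) \<in> set us" "(x, y) = orient u v" using es_mem[OF xy] by blast
      then have "nb u v" using nb_us by blast
      then have "ok u" "ok v" "side u \<noteq> side v" "{cd u, cd v} \<in> E" using nb_ok nb_side by (auto simp: edge_iff)
      then show ?thesis using uv(2) inA unfolding orient_def by (auto simp: G_def insert_commute split: if_splits)
    qed
    show "distinct es"
      unfolding es_def distinct_map using dus inj_or by (auto simp: inj_on_def)
    show "x \<noteq> x' \<and> y \<noteq> y'" if *: "(x, y) \<in> set es" "(x', y') \<in> set es" "(x, y) \<noteq> (x', y')" for x y x' y'
    proof -
      obtain u v where uv: "(u, v) \<in> set us" "(x, y) = orient u v" using es_mem[OF *(1)] by blast
      obtain u' v' where uv': "(u', v') \<in> set us" "(x', y') = orient u' v'" using es_mem[OF *(2)] by blast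
      have n: "(u, v) \<noteq> (u', v')" using uv uv' *(3) by auto
      have "ok u" "ok v" "ok u'" "ok v'" using nb_us uv uv' nb_ok by blast+
      then show ?thesis using dj[OF uv(1) uv'(1) n] uv(2) uv'(2) unfolding orient_def by (auto simp: cd_inject split: if_splits)
    qed
    show "nbhd G x \<subseteq> insert y (eliminated es j) \<or> nbhd G y \<subseteq> insert x (eliminated es j)"
      if j: "j < length es" "es ! j = (x, y)" for j x y
    proof -
      have lj: "j < length us" using j unfolding es_def by simp
      obtain u v where uv: "us ! j = (u, v)" by fastforce
      then have xy: "(x, y) = orient u v" using j lj unfolding es_def by simp
      have "(u, v) \<in> set us" using uv lj nth_mem by metis
      then have o: "ok u" "ok v" using nb_us nb_ok by blast+
      have "nbhd G (cd v) \<subseteq> insert (cd u) (eliminated es j)"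
      proof (cases "j < length ps")
        case True
        then have "(u, v) = f1 (ps ! j)" using uv by (simp add: us_def nth_append)
        moreover have "ps ! j \<in> P" using True ps(1) nth_mem by blast
        ultimately have "u \<in> P" "v = pend u" unfolding f1_def by auto
        then have "{w. nb v w} \<subseteq> {u}" unfolding P_def by (cases u) (auto simp: nb_simps)
        then show ?thesis unfolding nbhd_cd[OF o(2)] by auto
      next
        case False
        then have "(u, v) = f2 (zs ! (j - length ps))" using uv lj by (simp add: us_def nth_append)
        then obtain x' y' where q: "u = Q1 x' y'" "v = Q2 x' y'" unfolding f2_def by auto
        have "w = u \<or> w \<in> P" if "nb v w" for w
          using that nb_ok[OF that] unfolding q P_def nb_simps by auto
        moreover have "cd ` P \<subseteq> eliminated es j"
        proof -
          have "take j us = map f1 ps @ take (j - length ps) (map f2 zs)"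
            using False by (simp add: us_def)
          then have "f1 w \<in> set (take j us)" if "w \<in> P" for w using that ps(1) by simp
          then have "cd (fst (f1 w)) \<in> eliminated es j" if "w \<in> P" for w using that unfolding elim by blast
          then show ?thesis unfolding f1_def by auto
        qed
        ultimately show ?thesis unfolding nbhd_cd[OF o(2)] by blast
      qed
      then show ?thesis using xy unfolding orient_def by (auto split: if_splits)
    qed
    show "e \<inter> eliminated es (length es) \<noteq> {}" if eG: "e \<in> edges G" for e
    proof -
      obtain u v where e: "e = {cd u, cd v}" "link u v" using eG unfolding G_def E_def by auto
      have all: "eliminated es (length es) = (\<Union>w\<in>set us. {cd (fst w), cd (snd w)})" unfolding elim by (simp add: es_def)
      from e(2) have "u \<in> P \<or> v \<in> P \<or> (\<exists>z\<in>D. u = Q1 (fst z) (snd z))"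
        by (cases rule: link_cases) (auto simp: D_def)
      then have "cd u \<in> eliminated es (length es) \<or> cd v \<in> eliminated es (length es)"
        unfolding all set_us f1_def f2_def by auto
      then show ?thesis unfolding e(1) by blast
    qed
  qed
qed

end

section \<open>The maze of a selection problem\<close>

text \<open>Serves for explicitly listed cycles of the maze; the auxiliary graph \<open>H\<close>
  has the pairs related by \<open>R\<close> as edges, so that the lemma on cycles applies.\<close>

lemma core2_walk:
  assumes "3 \<le> length ps" "distinct ps" "successively R (ps @ [hd ps])" and sym: "\<And>a b. R a b \<Longrightarrow> R b a"
  shows "core2 R (set ps)"
proof -
  define H where "H = \<lparr>verts = UNIV, edges = {{a, b} | a b. R a b}\<rparr>"
  have "is_cycle H ps"
    unfolding is_cycle_def
  proof (intro conjI allI impI)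
    fix i assume i: "i < length ps"
    have "R ((ps @ [hd ps]) ! i) ((ps @ [hd ps]) ! Suc i)"
      using assms(3) i unfolding successively_conv_nth by simp
    moreover have "(ps @ [hd ps]) ! Suc i = ps ! (Suc i mod length ps)"
    proof -
      have "ps \<noteq> []" using i by auto
      then show ?thesis using i by (cases "Suc i = length ps") (auto simp: nth_append hd_conv_nth)
    qed
    ultimately show "{ps ! i, ps ! (Suc i mod length ps)} \<in> edges H"
      using i by (auto simp: H_def nth_append)
  qed (use assms in auto)
  then have "core2 (adj H) (set ps)" by (rule cycle_core2)
  then show ?thesis
    by (rule core2_mono) (auto simp: H_def adj_def doubleton_eq_iff intro: sym)
qed

locale grid =
  fixes m n A b :: nat and tap :: "nat \<Rightarrow> nat \<Rightarrow> bool"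
  assumes pos: "0 < m" "0 < n" "0 < A" "A dvd n" and b2: "2 \<le> b"
begin

text \<open>The column of the cell is \<open>j = x div 6\<close>, its row \<open>r = y div 5\<close>; column \<open>m\<close> holds the rooms
  of the groups of \<open>A\<close> consecutive rows.\<close>

definition Hwall :: "nat \<Rightarrow> nat \<Rightarrow> bool" where
  "Hwall x y \<longleftrightarrow> (let j = x div 6; u = x mod 6; r = y div 5; w = y mod 5 in
     j < m \<and> r < n \<and>
       ((u, w) \<in> {(2,3), (2,4), (3,4), (4,4), (3,3), (4,3), (0,4), (1,4), (0,3), (1,3), (2,2), (5,2), (5,3)} \<or>
        tap r j \<and> (u, w) \<in> {(4,2), (3,2), (3,1)} \<or> 1 \<le> r \<and> (u, w) \<in> {(1,2), (1,0)}) \<or>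
     j < m \<and> 1 \<le> r \<and> r \<le> n \<and> u = 2 \<and> w = 0 \<or>
     j = m \<and> r < n \<and> u = 0 \<and> (w = 3 \<and> r mod A = 0 \<or> w = 4 \<and> Suc r mod A = 0))"

definition Vwall :: "nat \<Rightarrow> nat \<Rightarrow> bool" where
  "Vwall x y \<longleftrightarrow> (let j = x div 6; u = x mod 6; r = y div 5; w = y mod 5 in
     j < m \<and> r < n \<and>
       ((u, w) \<in> {(2,3), (3,3), (5,3), (2,4), (3,4), (2,2), (3,2), (5,2)} \<or>
        tap r j \<and> (u, w) \<in> {(4,2), (3,1), (4,1)} \<or>
        1 \<le> r \<and> (u, w) \<in> {(2,1), (2,0), (1,1), (1,0)} \<or> 1 \<le> j \<and> u = 0 \<and> w = 3) \<or>
     1 \<le> j \<and> j \<le> m \<and> r < n \<and> u = 0 \<and> w = 2 \<or>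
     j = m \<and> r < n \<and> u \<le> 1 \<and> (w = 3 \<or> w = 4 \<and> Suc r mod A \<noteq> 0 \<or> w < 3 \<and> r mod A \<noteq> 0))"

sublocale maze "6 * m + 2" "5 * n + 1" b Hwall Vwall
proof
  fix x y :: nat
  have x: "x = 6 * (x div 6) + x mod 6" and y: "y = 5 * (y div 5) + y mod 5" by simp_all
  have s: "x mod 6 < 6" "y mod 5 < 5" by simp_all
  show "Suc x < 6 * m + 2 \<and> y < 5 * n + 1" if "Hwall x y"
    using that x y s unfolding Hwall_def Let_def by (elim disjE conjE) linarith+
  show "x < 6 * m + 2 \<and> Suc y < 5 * n + 1" if "Vwall x y"
    using that x y s unfolding Vwall_def Let_def by (elim disjE conjE) linarith+
qed (rule b2)

lemma mem_D: "p \<in> D \<longleftrightarrow> fst p < 6 * m + 2 \<and> snd p < 5 * n + 1"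
  unfolding D_def by (cases p) simp

lemma wadj_sym: "wadj p q \<Longrightarrow> wadj q p"
  by (cases p; cases q) auto

definition loc :: "nat \<Rightarrow> nat \<Rightarrow> nat \<times> nat \<Rightarrow> nat \<times> nat" where
  "loc j r p = (6 * j + fst p, 5 * r + snd p)"

text \<open>Kind 0 is the crossing in the middle of the cell, kind 1 carries the row bit between the
  cell and its east neighbour, kind 2 the column bit to the row below, and kind 3 is the tap. Kind 1
  straddles the cell border: abscissa 6 is abscissa 0 of the next cell.\<close>

definition local_block :: "nat \<Rightarrow> (nat \<times> nat) set" where
  "local_block k = (if k = 0 then {2, 3} \<times> {3, 4} else if k = 1 then {5, 6} \<times> {2, 3}
     else if k = 2 then {1, 2} \<times> {0, 1, 2} else {3, 4} \<times> {1, 2})"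

definition blocks :: "(nat \<times> nat \<times> nat) set" where
  "blocks = {(k, j, r). j < m \<and> r < n \<and> (k = 0 \<or> k = 1 \<or> k = 2 \<and> 1 \<le> r \<or> k = 3 \<and> tap r j)}"

definition room :: "nat \<times> nat \<times> nat \<Rightarrow> (nat \<times> nat) set" where
  "room i = (case i of (k, j, r) \<Rightarrow> loc j r ` local_block k)"

text \<open>Abscissas run from 1 to 6 instead of 0 to 5, so that a block of kind 1 belongs to a
  single cell and each of its points has one local address.\<close>

lemma loc_inject:
  assumes "loc j r (u, w) = loc j' r' (u', w')" "1 \<le> u" "u \<le> 6" "1 \<le> u'" "u' \<le> 6" "w \<le> 4" "w' \<le> 4"
  shows "j = j' \<and> r = r' \<and> u = u' \<and> w = w'"
proof -
  have e: "6 * j + u = 6 * j' + u'" "5 * r + w = 5 * r' + w'" using assms(1) by (auto simp: loc_def)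
  have "j = j'" using e(1) assms(2-5) by (cases j j' rule: linorder_cases) linarith+
  moreover have "r = r'" using e(2) assms(6,7) by (cases r r' rule: linorder_cases) linarith+
  ultimately show ?thesis using e by simp
qed

lemma local_block_range: "(u, w) \<in> local_block k \<Longrightarrow> 1 \<le> u \<and> u \<le> 6 \<and> w \<le> 4"
  by (auto simp: local_block_def split: if_splits)

lemma local_block_disjoint:
  assumes "p \<in> local_block k" "p \<in> local_block k'" "k \<le> 3" "k' \<le> 3"
  shows "k = k'"
proof -
  define kind where "kind u w = (if w \<ge> 3 \<and> u \<le> 3 then 0 else if u \<ge> 5 then 1 else if u \<le> 2 then 2 else 3 :: nat)"
    for u w :: nat
  have 0: "kind u w = 0" if "(u, w) \<in> local_block 0" for u w using that by (auto simp: local_block_def kind_def)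
  have 1: "kind u w = 1" if "(u, w) \<in> local_block 1" for u w using that by (auto simp: local_block_def kind_def)
  have 2: "kind u w = 2" if "(u, w) \<in> local_block 2" for u w using that by (auto simp: local_block_def kind_def)
  have 3: "kind u w = 3" if "(u, w) \<in> local_block 3" for u w using that by (auto simp: local_block_def kind_def)
  have "kind (fst p) (snd p) = k" if "p \<in> local_block k" "k \<le> 3" for k
  proof -
    have "k = 0 \<or> k = 1 \<or> k = 2 \<or> k = 3" using that(2) by linarith
    then show ?thesis using 0[of "fst p" "snd p"] 1[of "fst p" "snd p"] 2[of "fst p" "snd p"] 3[of "fst p" "snd p"] that(1)
      by (elim disjE) simp_all
  qed
  then show ?thesis using assms by metis
qed

lemma room_unique:
  assumes "i \<in> blocks" "loc j r (u, w) \<in> room i" "1 \<le> u" "u \<le> 6" "w \<le> 4"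
  obtains k where "i = (k, j, r)" "(u, w) \<in> local_block k"
proof -
  obtain k j' r' where i: "i = (k, j', r')" by (cases i)
  then obtain u' w' where p: "loc j r (u, w) = loc j' r' (u', w')" "(u', w') \<in> local_block k"
    using assms(2) unfolding room_def by auto
  then have "j = j' \<and> r = r' \<and> u = u' \<and> w = w'"
    using loc_inject local_block_range[OF p(2)] assms(3-5) by blast
  then show ?thesis using that i p by blast
qed

lemma rooms_disjoint:
  assumes "i \<in> blocks" "i' \<in> blocks" "p \<in> room i" "p \<in> room i'"
  shows "i = i'"
proof -
  obtain k j r where i: "i = (k, j, r)" by (cases i)
  obtain u w where p: "p = loc j r (u, w)" "(u, w) \<in> local_block k" using assms(3) unfolding room_def i by auto
  obtain k' where i': "i' = (k', j, r)" "(u, w) \<in> local_block k'"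
    using room_unique[OF assms(2), of j r u w] assms(4) p local_block_range[OF p(2)] by blast
  have "k \<le> 3" "k' \<le> 3" using assms(1,2) unfolding i i' blocks_def by auto
  then show ?thesis using local_block_disjoint[OF p(2) i'(2)] unfolding i i' by simp
qed

lemma room_subset: "i \<in> blocks \<Longrightarrow> room i \<subseteq> D"
proof
  fix p assume i: "i \<in> blocks" and p: "p \<in> room i"
  obtain k j r where e: "i = (k, j, r)" by (cases i)
  obtain u w where uw: "p = loc j r (u, w)" "(u, w) \<in> local_block k" using p unfolding room_def e by auto
  have "j < m" "r < n" using i unfolding e blocks_def by auto
  then have "6 * Suc j \<le> 6 * m" "5 * Suc r \<le> 5 * n" by (auto simp only: mult_le_mono2 Suc_leI)
  then show "p \<in> D" using local_block_range[OF uw(2)] unfolding uw mem_D loc_def by auto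
qed

lemma hit:
  assumes "forest (D - F)" "3 \<le> length ps" "distinct ps" "set ps \<subseteq> D" "successively wadj (ps @ [hd ps])"
  shows "\<exists>p\<in>set ps. p \<in> F"
proof (rule ccontr)
  assume "\<not> ?thesis"
  then have "set ps \<subseteq> D - F" using assms(4) by blast
  then show False
    using core2_walk[OF assms(2,3,5) wadj_sym] assms(1) unfolding forest_def by blast
qed

lemma hit_local:
  assumes "forest (D - F)" "3 \<le> length ps" "distinct ps" "successively wadj (map (loc j r) (ps @ [hd ps]))"
    and "\<forall>p\<in>set ps. fst p \<le> 6 \<and> snd p \<le> 5" "j < m" "r < n"
  shows "\<exists>p\<in>set ps. loc j r p \<in> F"
proof -
  have "6 * Suc j \<le> 6 * m" "5 * Suc r \<le> 5 * n" using assms(6,7) by (auto simp only: mult_le_mono2 Suc_leI)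
  then have "loc j r p \<in> D" if "p \<in> set ps" for p using assms(5) that unfolding mem_D loc_def by fastforce
  then have "set (map (loc j r) ps) \<subseteq> D" by auto
  moreover have "distinct (map (loc j r) ps)" using assms(3) by (auto simp: distinct_map inj_on_def loc_def prod_eq_iff)
  moreover have "successively wadj (map (loc j r) ps @ [hd (map (loc j r) ps)])"
  proof -
    have "ps \<noteq> []" using assms(2) by auto
    then show ?thesis using assms(4) by (simp add: hd_map)
  qed
  ultimately show ?thesis using hit[of F "map (loc j r) ps"] assms(1,2) by auto
qed

lemma walls_local:
  assumes "j < m" "r < n"
  shows "\<forall>(u, w) \<in> {(2,3), (2,4), (3,4), (4,4), (3,3), (4,3), (0,4), (1,4), (0,3), (1,3), (2,2), (5,2), (5,3), (2,5)}.
      Hwall (6 * j + u) (5 * r + w)"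
    "\<forall>(u, w) \<in> {(2,3), (3,3), (5,3), (2,4), (3,4), (2,2), (3,2), (5,2), (6,2)}. Vwall (6 * j + u) (5 * r + w)"
    "tap r j \<Longrightarrow> \<forall>(u, w) \<in> {(4,2), (3,2), (3,1)}. Hwall (6 * j + u) (5 * r + w)"
    "tap r j \<Longrightarrow> \<forall>(u, w) \<in> {(4,2), (3,1), (4,1)}. Vwall (6 * j + u) (5 * r + w)"
    "1 \<le> r \<Longrightarrow> \<forall>(u, w) \<in> {(1,2), (1,0)}. Hwall (6 * j + u) (5 * r + w)"
    "1 \<le> r \<Longrightarrow> \<forall>(u, w) \<in> {(2,1), (2,0), (1,1), (1,0)}. Vwall (6 * j + u) (5 * r + w)"
    "1 \<le> j \<Longrightarrow> Vwall (6 * j) (5 * r + 3)"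
  using assms by (simp_all add: Hwall_def Vwall_def Let_def)

text \<open>\<open>?C\<close>, \<open>?H\<close>, \<open>?V\<close> and \<open>?B\<close> concern
  cycles inside the blocks of kind 0, 1, 2 and 3. The other cycles tie blocks together:
  \<open>?E\<close> and \<open>?W\<close> the crossing with the row bits on its two sides,
  \<open>?N\<close> and \<open>?S\<close> the crossing with the column bits above and below,
  \<open>?S\<close> also with the tap, and \<open>?T\<close> the tap with the row bit to the east. A
  block whose chosen point misses such a cycle leaves it to its partners.\<close>

lemma hit_rooms:
  assumes F: "forest (D - F)" and jr: "j < m" "r < n"
  shows "\<exists>p\<in>set [(2,3), (3,3), (3,4), (2,4)]. loc j r p \<in> F" (is ?C)
    and "\<exists>p\<in>set [(5,2), (6,2), (6,3), (5,3)]. loc j r p \<in> F" (is ?H)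
    and "\<exists>p\<in>set [(3,3), (4,3), (5,3), (5,4), (4,4), (3,4)]. loc j r p \<in> F" (is ?E)
    and "1 \<le> j \<Longrightarrow> \<exists>p\<in>set [(0,3), (1,3), (2,3), (2,4), (1,4), (0,4)]. loc j r p \<in> F" (is "_ \<Longrightarrow> ?W")
    and "\<exists>p\<in>set [(2,4), (3,4), (3,5), (2,5)]. loc j r p \<in> F" (is ?N)
    and "\<exists>p\<in>set [(2,2), (3,2), (3,3), (2,3)]. loc j r p \<in> F" (is ?S)
    and "1 \<le> r \<Longrightarrow> \<exists>p\<in>set [(1,0), (2,0), (2,1), (2,2), (1,2), (1,1)]. loc j r p \<in> F" (is "_ \<Longrightarrow> ?V")
    and "tap r j \<Longrightarrow> \<exists>p\<in>set [(3,1), (4,1), (4,2), (3,2)]. loc j r p \<in> F" (is "_ \<Longrightarrow> ?B")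
    and "tap r j \<Longrightarrow> \<exists>p\<in>set [(4,2), (5,2), (5,3), (4,3)]. loc j r p \<in> F" (is "_ \<Longrightarrow> ?T")
proof -
  note W = walls_local[OF jr]
  show ?C by (rule hit_local[OF F _ _ _ _ jr]) (use W(1,2) in \<open>simp_all add: loc_def\<close>)
  show ?H by (rule hit_local[OF F _ _ _ _ jr]) (use W(1,2) in \<open>simp_all add: loc_def\<close>)
  show ?E by (rule hit_local[OF F _ _ _ _ jr]) (use W(1,2) in \<open>simp_all add: loc_def\<close>)
  show ?N by (rule hit_local[OF F _ _ _ _ jr]) (use W(1,2) in \<open>simp_all add: loc_def\<close>)
  show ?S by (rule hit_local[OF F _ _ _ _ jr]) (use W(1,2) in \<open>simp_all add: loc_def\<close>)
  show ?W if "1 \<le> j"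
    by (rule hit_local[OF F _ _ _ _ jr]) (use W(1,2) W(7)[OF that] in \<open>simp_all add: loc_def\<close>)
  show ?V if "1 \<le> r"
    by (rule hit_local[OF F _ _ _ _ jr]) (use W(1,2) W(5,6)[OF that] in \<open>simp_all add: loc_def\<close>)
  show ?B if "tap r j"
    by (rule hit_local[OF F _ _ _ _ jr]) (use W(1,2) W(3,4)[OF that] in \<open>simp_all add: loc_def\<close>)
  show ?T if "tap r j"
    by (rule hit_local[OF F _ _ _ _ jr]) (use W(1,2) W(3,4)[OF that] in \<open>simp_all add: loc_def\<close>)
qed

end

section \<open>From feedback sets to solutions\<close>

context grid begin

lemma group_mod:
  assumes "g * A \<le> r" "r < g * A + A"
  shows "r mod A = r - g * A" "r div A = g" "Suc r mod A = 0 \<longleftrightarrow> Suc r = g * A + A"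
proof -
  obtain t where r: "r = g * A + t" "t < A" using assms by (metis add.commute le_Suc_ex nat_add_left_cancel_less)
  show 1: "r mod A = r - g * A" "r div A = g" using r by auto
  have "Suc r mod A = (if Suc t = A then 0 else Suc t)" using r by (simp add: mod_Suc)
  then show "Suc r mod A = 0 \<longleftrightarrow> Suc r = g * A + A" using r by auto
qed

lemma group_le: "g < n div A \<Longrightarrow> g * A + A \<le> n"
proof -
  assume "g < n div A"
  then have "Suc g * A \<le> (n div A) * A" by (intro mult_le_mono1) simp
  then show ?thesis using dvd_div_mult_self[OF pos(4)] by simp
qed

lemma group_wall:
  assumes "5 * (g * A) + 3 \<le> y" "y < 5 * (g * A + A - 1) + 4" "g < n div A" "u \<le> 1"
  shows "Vwall (6 * m + u) y"
proof -
  let ?r = "y div 5" let ?w = "y mod 5"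
  have y: "y = 5 * ?r + ?w" "?w < 5" by simp_all
  have gn: "g * A + A \<le> n" using group_le[OF assms(3)] .
  have r: "g * A \<le> ?r" "?r < g * A + A" using y assms(1,2) pos(3) by linarith+
  note R = group_mod[OF r]
  have 1: "?w = 4 \<Longrightarrow> Suc ?r mod A \<noteq> 0" using R(3) y assms(2) by linarith
  have 2: "?w < 3 \<Longrightarrow> ?r mod A \<noteq> 0" using R(1) y assms(1) by linarith
  have dm: "(6 * m + u) div 6 = m" "(6 * m + u) mod 6 = u" using assms(4) by auto
  have "?w < 3 \<or> ?w = 3 \<or> ?w = 4" using y(2) by linarith
  then have "?w = 3 \<or> ?w = 4 \<and> Suc ?r mod A \<noteq> 0 \<or> ?w < 3 \<and> ?r mod A \<noteq> 0" using 1 2 by blast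
  moreover have "?r < n" using r(2) gn by linarith
  ultimately show ?thesis
    unfolding Vwall_def Let_def dm by (intro disjI2[of _ "_ \<or> _"] disjI2[of _ "_ \<and> _"] conjI refl assms(4))
qed

text \<open>The room of a group is a ring of two adjacent vertical lines, closed at height 3 of its
  first row and at height 4 of its last row. With no point removed it is a core.\<close>

lemma hit_group:
  assumes F: "forest (D - F)" and g: "g < n div A"
  shows "\<exists>x y. (x, y) \<in> F \<and> 6 * m \<le> x \<and> x \<le> 6 * m + 1 \<and> 5 * (g * A) + 3 \<le> y \<and> y \<le> 5 * (g * A + A - 1) + 4"
proof (rule ccontr)
  assume no: "\<not> ?thesis"
  let ?a = "5 * (g * A) + 3" let ?b = "5 * (g * A + A - 1) + 4"
  let ?Z = "{6 * m, 6 * m + 1} \<times> {?a..?b}"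
  have gn: "g * A + A \<le> n" using group_le[OF g] .
  have ab: "?a < ?b" using pos(3) by simp
  have Ha: "Hwall (6 * m) ?a"
  proof -
    have "?a div 5 = g * A" "?a mod 5 = 3" by auto
    then show ?thesis using gn pos(3) unfolding Hwall_def Let_def by simp
  qed
  have Hb: "Hwall (6 * m) ?b"
  proof -
    have "?b div 5 = g * A + A - 1" "?b mod 5 = 4" by auto
    moreover have "Suc (g * A + A - 1) mod A = 0" using pos(3) by simp
    ultimately show ?thesis using gn pos(3) unfolding Hwall_def Let_def by simp
  qed
  have V: "Vwall (6 * m + u) y" if "?a \<le> y" "y < ?b" "u \<le> 1" for u y
    using group_wall[OF that(1,2) g that(3)] .
  have "core2 wadj ?Z"
    unfolding core2_def
  proof (intro conjI ballI)
    fix p assume "p \<in> ?Z"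
    then obtain u y where p: "p = (6 * m + u, y)" "u \<le> 1" "?a \<le> y" "y \<le> ?b" by auto
    have up: "wadj p (6 * m + u, Suc y) \<and> (6 * m + u, Suc y) \<in> ?Z" if "y < ?b"
      using V[of y u] p that by auto
    have dn: "wadj p (6 * m + u, y - 1) \<and> (6 * m + u, y - 1) \<in> ?Z" if lt: "?a < y"
    proof -
      obtain y' where y: "y = Suc y'" using lt by (cases y) auto
      then have "?a \<le> y'" "y' < ?b" using lt p by auto
      moreover from this have "Vwall (6 * m + u) y'" using V p(2) by blast
      ultimately show ?thesis using p(2) unfolding p(1) y by auto
    qed
    have sd: "wadj p (6 * m + (1 - u), y) \<and> (6 * m + (1 - u), y) \<in> ?Z" if "y = ?a \<or> y = ?b"
      using that Ha Hb p ab by (cases "u = 0") auto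
    show "\<exists>a\<in>?Z. \<exists>b\<in>?Z. a \<noteq> b \<and> wadj p a \<and> wadj p b"
    proof (cases "y = ?a")
      case True
      then show ?thesis using up sd ab
        by (intro bexI[of _ "(6 * m + u, Suc y)"] bexI[of _ "(6 * m + (1 - u), y)"]) auto
    next
      case False
      then have d: "?a < y" using p by auto
      show ?thesis
      proof (cases "y = ?b")
        case True
        then show ?thesis using dn[OF d] sd d
          by (intro bexI[of _ "(6 * m + u, y - 1)"] bexI[of _ "(6 * m + (1 - u), y)"]) auto
      next
        case False
        then show ?thesis using dn[OF d] up p d
          by (intro bexI[of _ "(6 * m + u, y - 1)"] bexI[of _ "(6 * m + u, Suc y)"]) auto
      qed
    qed
  qed (use ab in auto)
  moreover have "?Z \<subseteq> D - F"
  proof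
    fix p assume p: "p \<in> ?Z"
    obtain x y where xy: "p = (x, y)" by (cases p)
    then have "6 * m \<le> x" "x \<le> 6 * m + 1" "?a \<le> y" "y \<le> ?b" using p by auto
    then have "p \<notin> F" using no xy by blast
    moreover have "?b < 5 * n + 1" using gn pos(3) by linarith
    then have "p \<in> D" unfolding mem_D using p by auto
    ultimately show "p \<in> D - F" by simp
  qed
  ultimately show False using F unfolding forest_def by blast
qed

definition solution :: "nat set \<Rightarrow> bool" where
  "solution S \<longleftrightarrow> S \<subseteq> {..<n} \<and> (\<forall>g<n div A. \<exists>r\<in>S. r div A = g) \<and> (\<forall>j<m. \<exists>r<n. tap r j \<and> r \<notin> S)"

text \<open>Every block needs a point of \<open>F\<close> and there are no more points than blocks,
  so \<open>F\<close> is a transversal of the disjoint blocks. The linking cycles then propagate the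
  choices, westwards along rows and downwards along columns.\<close>

lemma solution_of_feedback:
  assumes FD: "F \<subseteq> D" and F: "forest (D - F)" and card: "card F \<le> card blocks"
  shows "\<exists>S. solution S"
proof -
  have finF: "finite F" using FD finite_D finite_subset by blast
  have ne: "\<exists>p. p \<in> F \<and> p \<in> room i" if i: "i \<in> blocks" for i
  proof -
    obtain k j r where e: "i = (k, j, r)" by (cases i)
    have jr: "j < m" "r < n" using i unfolding e blocks_def by auto
    note H = hit_rooms[OF F jr]
    have key: ?thesis if "\<exists>p\<in>Q. loc j r p \<in> F" "Q \<subseteq> local_block k" for Q :: "(nat \<times> nat) set"
    proof -
      from that obtain p where "p \<in> Q" "loc j r p \<in> F" by blast
      then show ?thesis using that(2) unfolding room_def e by (intro exI[of _ "loc j r p"]) auto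
    qed
    have "k = 0 \<or> k = 1 \<or> k = 2 \<and> 1 \<le> r \<or> k = 3 \<and> tap r j" using i unfolding e blocks_def by auto
    then show ?thesis
    proof (elim disjE conjE)
      assume "k = 0" then show ?thesis using key[OF H(1)] by (simp add: local_block_def)
    next
      assume "k = 1" then show ?thesis using key[OF H(2)] by (simp add: local_block_def)
    next
      assume "k = 2" "1 \<le> r" then show ?thesis using key[OF H(7)] by (simp add: local_block_def)
    next
      assume "k = 3" "tap r j" then show ?thesis using key[OF H(8)] by (simp add: local_block_def)
    qed
  qed
  then have "\<forall>i\<in>blocks. \<exists>p. p \<in> F \<and> p \<in> room i" by blast
  from bchoice[OF this] obtain ch where ch: "\<And>i. i \<in> blocks \<Longrightarrow> ch i \<in> F \<and> ch i \<in> room i" by blast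
  have inj: "inj_on ch blocks" by (rule inj_onI) (metis ch rooms_disjoint)
  \<comment> \<open>The count is tight, so \<open>F\<close> consists of the chosen points alone:
    every block contains exactly one point of \<open>F\<close>, and no point outside the blocks is
    in \<open>F\<close>.\<close>
  have gF: "ch ` blocks = F"
  proof (rule card_seteq)
    show "card F \<le> card (ch ` blocks)" using card card_image[OF inj] by simp
  qed (use finF ch in auto)
  define f where "f j r u w \<longleftrightarrow> loc j r (u, w) \<in> F" for j r u w
  have inF: "\<exists>k. (k, j, r) \<in> blocks \<and> (u, w) \<in> local_block k \<and> ch (k, j, r) = loc j r (u, w)"
    if h: "f j r u w" "1 \<le> u" "u \<le> 6" "w \<le> 4" for j r u w
  proof -
    obtain i where i: "i \<in> blocks" "loc j r (u, w) = ch i" using h(1) gF unfolding f_def by blast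
    then have "loc j r (u, w) \<in> room i" using ch by simp
    then obtain k where "i = (k, j, r)" "(u, w) \<in> local_block k" using room_unique[OF i(1) _ h(2-4)] by blast
    then show ?thesis using i by auto
  qed
  have uniq: "(u, w) = (u', w')" if h: "f j r u w" "f j r u' w'" "(u, w) \<in> local_block k" "(u', w') \<in> local_block k" "(k, j, r) \<in> blocks" for j r u w u' w' k
  proof -
    have *: "1 \<le> u \<and> u \<le> 6 \<and> w \<le> 4" "1 \<le> u' \<and> u' \<le> 6 \<and> w' \<le> 4" using local_block_range h(3,4) by blast+
    obtain k1 where k1: "(k1, j, r) \<in> blocks" "(u, w) \<in> local_block k1" "ch (k1, j, r) = loc j r (u, w)" using inF[OF h(1)] * by blast
    obtain k2 where k2: "(k2, j, r) \<in> blocks" "(u', w') \<in> local_block k2" "ch (k2, j, r) = loc j r (u', w')" using inF[OF h(2)] * by blast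
    have le: "k \<le> 3" "k1 \<le> 3" "k2 \<le> 3" using k1(1) k2(1) h(5) unfolding blocks_def by auto
    have "k1 = k" "k2 = k" using local_block_disjoint k1(2) k2(2) h(3,4) le by blast+
    then have "loc j r (u, w) = loc j r (u', w')" using k1 k2 by simp
    then show ?thesis by (simp add: loc_def)
  qed
  \<comment> \<open>These points of the linking cycles lie in no block. \<open>(3, 0)\<close> is
    \<open>(3, 5)\<close> of the cell below, and \<open>(6, 4)\<close> is \<open>(0, 4)\<close> of
    the cell to the east.\<close>
  have none: "\<not> f j r u w" if "(u, w) \<in> {(4,3), (4,4), (5,4), (1,3), (1,4), (6,4), (3,0)}" for j r u w
  proof
    assume h: "f j r u w"
    have "1 \<le> u \<and> u \<le> 6 \<and> w \<le> 4" using that by auto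
    then obtain k where "(u, w) \<in> local_block k" using inF[OF h] by blast
    then have "(u, w) \<in> {2, 3} \<times> {3, 4} \<or> (u, w) \<in> {5, 6} \<times> {2, 3} \<or> (u, w) \<in> {1, 2} \<times> {0, 1, 2} \<or> (u, w) \<in> {3, 4} \<times> {1, 2}"
      unfolding local_block_def by presburger
    then show False using that by (elim insertE emptyE) simp_all
  qed
  have C: "(0, j, r) \<in> blocks" "(1, j, r) \<in> blocks" if "j < m" "r < n" for j r using that unfolding blocks_def by auto
  have c1: "\<not> f j r 2 3" "\<not> f j r 2 4" if "j < m" "r < n" "f j r 3 3 \<or> f j r 3 4" for j r
    using that(3) C[OF that(1,2)] uniq[of j r 3 3 2 3 0] uniq[of j r 3 3 2 4 0] uniq[of j r 3 4 2 3 0] uniq[of j r 3 4 2 4 0]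
    by (auto simp: local_block_def)
  have c2: "\<not> f j r 2 3" "\<not> f j r 3 3" if "j < m" "r < n" "f j r 3 4 \<or> f j r 2 4" for j r
    using that(3) C[OF that(1,2)] uniq[of j r 3 4 2 3 0] uniq[of j r 3 4 3 3 0] uniq[of j r 2 4 2 3 0] uniq[of j r 2 4 3 3 0]
    by (auto simp: local_block_def)
  have h1: "\<not> f j r 5 3" "\<not> f j r 5 2" if "j < m" "r < n" "f j r 6 3 \<or> f j r 6 2" for j r
    using that(3) C[OF that(1,2)] uniq[of j r 6 3 5 3 1] uniq[of j r 6 3 5 2 1] uniq[of j r 6 2 5 3 1] uniq[of j r 6 2 5 2 1]
    by (auto simp: local_block_def)
  \<comment> \<open>The selection is read off at the east border; the choices in the other cells
    only have to follow from it.\<close>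
  define S where "S = {r. r < n \<and> (f (m - 1) r 6 3 \<or> f (m - 1) r 6 2)}"
  \<comment> \<open>Induction from the east border to the west. If \<open>(5, 3)\<close> is not in
    \<open>F\<close>, the east cycle must be hit in the crossing at abscissa 3; then the west cycle
    must be hit by \<open>(6, 3)\<close> of the cell to the left, whose block has no second point in
    \<open>F\<close>.\<close>
  have on: "\<not> f (m - 1 - d) r 5 3 \<and> \<not> f (m - 1 - d) r 5 2" if r: "r \<in> S" "d < m" for r d
    using r(2)
  proof (induction d)
    case 0 then show ?case using h1[of "m - 1" r] r(1) unfolding S_def by auto
  next
    case (Suc d)
    obtain j where j0: "m - 1 - d = Suc j" using Suc.prems by (cases "m - 1 - d") auto
    have j: "Suc j < m" "r < n" "j < m" and s: "m - 1 - Suc d = j" using Suc.prems j0 r(1) unfolding S_def by auto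
    have "\<not> f (Suc j) r 5 3" using Suc j0 by simp
    then have a: "f (Suc j) r 3 3 \<or> f (Suc j) r 3 4"
      using hit_rooms(3)[OF F j(1,2)] none[of 4 3 "Suc j" r] none[of 4 4 "Suc j" r] none[of 5 4 "Suc j" r] by (auto simp: f_def)
    have sh: "loc (Suc j) r (0, w) = loc j r (6, w)" for w by (simp add: loc_def)
    have "f j r 6 3"
      using hit_rooms(4)[OF F j(1,2)] c1[OF j(1,2) a] none[of 1 3 "Suc j" r] none[of 1 4 "Suc j" r] none[of 6 4 j r]
      by (auto simp: f_def sh)
    then show ?case using h1[of j r] j unfolding s by auto
  qed
  have on': "\<not> f j r 5 3 \<and> \<not> f j r 5 2" if "r \<in> S" "j < m" for r j
    using on[OF that(1), of "m - 1 - j"] that(2) by simp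
  have "\<exists>r<n. tap r j \<and> r \<notin> S" if j: "j < m" for j
  proof (rule ccontr)
    assume "\<not> ?thesis"
    then have tS: "r \<in> S" if "r < n" "tap r j" for r using that by blast
    \<comment> \<open>With all tapped rows selected, no tap can absorb the column bit: choosing
      \<open>(3, 2)\<close> would leave the cycle between the tap and the row bit unhit.\<close>
    have no32: "\<not> f j r 3 2" if r: "r < n" for r
    proof
      assume h: "f j r 3 2"
      have "tap r j" using inF[OF h] by (auto simp: local_block_def blocks_def split: if_splits)
      then have "\<not> f j r 5 3 \<and> \<not> f j r 5 2" using on' tS r j by blast
      then have "f j r 4 2"
        using hit_rooms(9)[OF F j r \<open>tap r j\<close>] none[of 4 3 j r] by (auto simp: f_def)
      then show False using uniq[OF h, of 4 2 3] j r \<open>tap r j\<close> by (auto simp: local_block_def blocks_def)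
    qed
    \<comment> \<open>The bit travels downwards. Above the top row \<open>(2, 5)\<close> lies in no
      block, so the top crossing must choose ordinate 4. That leaves its south cycle to
      \<open>(2, 2)\<close>; hence \<open>(2, 0)\<close> is not chosen, and the crossing below is
      forced in the same way.\<close>
    have bb: "f j (n - 1 - d) 3 4 \<or> f j (n - 1 - d) 2 4" if "d < n" for d
      using that
    proof (induction d)
      case 0
      obtain r where r: "n = Suc r" using pos(2) by (cases n) auto
      have sh: "loc j r (u, 5) = loc j n (u, 0)" for u unfolding r by (simp add: loc_def)
      have "\<not> f j n 2 0"
      proof
        assume "f j n 2 0" then show False using inF[of j n 2 0] by (auto simp: blocks_def)
      qed
      then have "f j r 3 4 \<or> f j r 2 4" using hit_rooms(5)[OF F j, of r] r none[of 3 0 j n] by (auto simp: f_def sh)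
      then show ?case using r by simp
    next
      case (Suc d)
      obtain r where r0: "n - 1 - d = Suc r" using Suc.prems by (cases "n - 1 - d") auto
      have r: "Suc r < n" "r < n" and s: "n - 1 - Suc d = r" using Suc.prems r0 by auto
      have b: "f j (Suc r) 3 4 \<or> f j (Suc r) 2 4" using Suc r0 by simp
      have "f j (Suc r) 2 2" using hit_rooms(6)[OF F j r(1)] c2[OF j r(1) b] no32[OF r(1)] by (auto simp: f_def)
      then have n20: "\<not> f j (Suc r) 2 0" using uniq[of j "Suc r" 2 2 2 0 2] j r by (auto simp: local_block_def blocks_def)
      have sh: "loc j r (u, 5) = loc j (Suc r) (u, 0)" for u by (simp add: loc_def)
      show ?case
        using hit_rooms(5)[OF F j r(2)] n20 none[of 3 0 j "Suc r"] unfolding s by (auto simp: f_def sh)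
    qed
    \<comment> \<open>In row 0 there is no block of kind 2 that could take the bit over, so the
      south cycle of that row stays unhit.\<close>
    have r0: "0 < n" "f j 0 3 4 \<or> f j 0 2 4" using pos(2) bb[of "n - 1"] by auto
    have "\<not> f j 0 2 2"
    proof
      assume "f j 0 2 2" then show False using inF[of j 0 2 2] by (auto simp: blocks_def local_block_def split: if_splits)
    qed
    then show False using hit_rooms(6)[OF F j r0(1)] c2[OF j r0] no32[OF r0(1)] by (auto simp: f_def)
  qed
  moreover have "\<exists>r\<in>S. r div A = g" if gA: "g < n div A" for g
  proof -
    obtain x y where xy: "(x, y) \<in> F" "6 * m \<le> x" "x \<le> 6 * m + 1" "5 * (g * A) + 3 \<le> y" "y \<le> 5 * (g * A + A - 1) + 4"
      using hit_group[OF F gA] by blast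
    obtain k j r where i: "(k, j, r) \<in> blocks" "(x, y) \<in> room (k, j, r)" 
      using xy(1) gF ch by (metis imageE surj_pair)
    then obtain u w where p: "x = 6 * j + u" "y = 5 * r + w" "(u, w) \<in> local_block k" unfolding room_def loc_def by auto
    have jr: "j < m" "r < n" using i(1) unfolding blocks_def by auto
    \<comment> \<open>Only blocks of kind 1 in the last cell of a row reach the border column, and
      they do so with abscissa 6.\<close>
    have j: "j = m - 1" "u = 6" using p(1) xy(2) local_block_range[OF p(3)] jr by linarith+
    have w: "w = 2 \<or> w = 3" using p(3) j(2) by (auto simp: local_block_def split: if_splits)
    have "f (m - 1) r 6 w" using xy(1) p j unfolding f_def loc_def by simp
    then have "r \<in> S" using w jr unfolding S_def by auto
    moreover have "g * A \<le> r" "r < g * A + A" using w p(2) xy(4,5) pos(3) by linarith+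
    ultimately show ?thesis using group_mod(2) by blast
  qed
  moreover have "S \<subseteq> {..<n}" unfolding S_def by auto
  ultimately show ?thesis unfolding solution_def by blast
qed

end

section \<open>From solutions to feedback sets\<close>

definition two_of :: "bool \<Rightarrow> bool \<Rightarrow> bool \<Rightarrow> bool \<Rightarrow> bool" where
  "two_of p q r s \<longleftrightarrow> p \<and> q \<or> p \<and> r \<or> p \<and> s \<or> q \<and> r \<or> q \<and> s \<or> r \<and> s"

lemma two_of_mono:
  "two_of p q r s \<Longrightarrow> (p \<Longrightarrow> p') \<Longrightarrow> (q \<Longrightarrow> q') \<Longrightarrow> (r \<Longrightarrow> r') \<Longrightarrow> (s \<Longrightarrow> s') \<Longrightarrow> two_of p' q' r' s'"
  unfolding two_of_def by blast

text \<open>Leaf pruning inside a cell: \<open>zuw\<close> says that point \<open>(u, w)\<close> belongs to the set. Once the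
  chosen point of every block is removed, only \<open>(6, 2)\<close> or \<open>(6, 3)\<close> ties the rest of the cell to
  the outside, so that rest is a forest hanging on one vertex.\<close>

lemma cell_prune:
  assumes
    "z03 \<Longrightarrow> two_of z13 (t0 \<and> z04) False False"
    "z04 \<Longrightarrow> two_of z14 (t0 \<and> z03) False False"
    "z13 \<Longrightarrow> two_of z03 z23 False False" "z14 \<Longrightarrow> two_of z04 z24 False False"
    "z23 \<Longrightarrow> two_of z13 z33 z24 z22" "z33 \<Longrightarrow> two_of z23 z43 z34 z32"
    "z24 \<Longrightarrow> two_of z14 z34 z23 z25" "z34 \<Longrightarrow> two_of z24 z44 z33 z35"
    "z44 \<Longrightarrow> two_of z34 z54 False False" "z54 \<Longrightarrow> two_of z44 z53 False False"
    "z43 \<Longrightarrow> two_of z33 z53 (t \<and> z42) False" "z53 \<Longrightarrow> two_of z43 z54 z52 z63"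
    "z25 \<Longrightarrow> two_of z24 z35 False False" "z35 \<Longrightarrow> two_of z25 z34 False False"
    "z22 \<Longrightarrow> two_of z23 z32 False False" "z32 \<Longrightarrow> two_of z33 z22 (t \<and> z42) (t \<and> z31)"
    "t \<Longrightarrow> z42 \<Longrightarrow> two_of z32 z52 z43 z41" "t \<Longrightarrow> z31 \<Longrightarrow> two_of z32 z41 False False"
    "t \<Longrightarrow> z41 \<Longrightarrow> two_of z31 z42 False False" "z52 \<Longrightarrow> two_of z53 (t \<and> z42) z62 False"
    and "a \<Longrightarrow> b \<Longrightarrow> \<not> z34" "a \<Longrightarrow> \<not> b \<Longrightarrow> \<not> z33" "\<not> a \<Longrightarrow> \<not> b \<Longrightarrow> \<not> z23" "\<not> a \<Longrightarrow> b \<Longrightarrow> \<not> z24"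
    "a \<Longrightarrow> \<not> z63" "\<not> a \<Longrightarrow> \<not> z53" "\<not> b \<Longrightarrow> \<not> z25" "b \<Longrightarrow> \<not> e \<Longrightarrow> \<not> z22" "e \<Longrightarrow> \<not> z32"
    "t \<Longrightarrow> \<not> e \<Longrightarrow> \<not> z42" "a \<Longrightarrow> t0 \<Longrightarrow> \<not> z03" "e \<Longrightarrow> t \<and> \<not> a \<and> b"
  shows "\<not> z03 \<and> \<not> z04 \<and> \<not> z13 \<and> \<not> z14 \<and> \<not> z23 \<and> \<not> z24 \<and> \<not> z33 \<and> \<not> z34 \<and> \<not> z43 \<and> \<not> z44 \<and> \<not> z53 \<and> \<not> z54 \<and>
     \<not> z25 \<and> \<not> z35 \<and> \<not> z22 \<and> \<not> z32 \<and> \<not> (t \<and> z42) \<and> \<not> (t \<and> z31) \<and> \<not> (t \<and> z41) \<and> \<not> z52"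


  using assms unfolding two_of_def by (smt (verit))

context grid begin

text \<open>Inside a cell the walls depend only on a few bits: tapped or not (\<open>t\<close>),
  above the bottom row or not (\<open>r1\<close>) and, for vertical walls, east of the first column
  or not (\<open>j1\<close>). This makes pruning a cell a finite check.\<close>

fun hw :: "bool \<Rightarrow> bool \<Rightarrow> nat \<Rightarrow> nat \<Rightarrow> bool" where
  "hw t r1 u w \<longleftrightarrow> (u, w) \<in> {(2,3), (2,4), (3,4), (4,4), (3,3), (4,3), (0,4), (1,4), (0,3), (1,3), (2,2), (5,2), (5,3)} \<or>
     t \<and> (u, w) \<in> {(4,2), (3,2), (3,1)} \<or> r1 \<and> (u, w) \<in> {(1,2), (1,0), (2,0)}"

fun vw :: "bool \<Rightarrow> bool \<Rightarrow> bool \<Rightarrow> nat \<Rightarrow> nat \<Rightarrow> bool" where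
  "vw t r1 j1 u w \<longleftrightarrow> (u, w) \<in> {(2,3), (3,3), (5,3), (2,4), (3,4), (2,2), (3,2), (5,2)} \<or>
     t \<and> (u, w) \<in> {(4,2), (3,1), (4,1)} \<or> r1 \<and> (u, w) \<in> {(2,1), (2,0), (1,1), (1,0)} \<or> j1 \<and> (u, w) \<in> {(0,3), (0,2)}"

lemma walls_at:
  assumes "j < m" "r < n" "u < 6" "w < 5"
  shows "Hwall (6 * j + u) (5 * r + w) \<longleftrightarrow> hw (tap r j) (1 \<le> r) u w"
    "Vwall (6 * j + u) (5 * r + w) \<longleftrightarrow> vw (tap r j) (1 \<le> r) (1 \<le> j) u w"
proof -
  have e: "(6 * j + u) div 6 = j" "(6 * j + u) mod 6 = u" "(5 * r + w) div 5 = r" "(5 * r + w) mod 5 = w"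
    using assms by auto
  show "Hwall (6 * j + u) (5 * r + w) \<longleftrightarrow> hw (tap r j) (1 \<le> r) u w"
    unfolding Hwall_def Let_def e hw.simps insert_iff empty_iff prod.inject using assms(1,2)
    by (smt (verit) nat_less_le less_imp_le)
  show "Vwall (6 * j + u) (5 * r + w) \<longleftrightarrow> vw (tap r j) (1 \<le> r) (1 \<le> j) u w"
    unfolding Vwall_def Let_def e vw.simps insert_iff empty_iff prod.inject using assms(1,2)
    by (smt (verit) nat_less_le less_imp_le)
qed

lemma walls_top:
  assumes "j < m" "u < 6"
  shows "Hwall (6 * j + u) (5 * n) \<longleftrightarrow> u = 2" "\<not> Vwall (6 * j + u) (5 * n)"
proof -
  have e: "(6 * j + u) div 6 = j" "(6 * j + u) mod 6 = u" using assms by auto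
  show "Hwall (6 * j + u) (5 * n) \<longleftrightarrow> u = 2" "\<not> Vwall (6 * j + u) (5 * n)"
    unfolding Hwall_def Vwall_def Let_def e using assms pos by auto
qed

lemma two_nbs:
  assumes "core2 wadj Z" "(x, y) \<in> Z"
  shows "two_of (0 < x \<and> Hwall (x - 1) y \<and> (x - 1, y) \<in> Z) (Hwall x y \<and> (x + 1, y) \<in> Z)
    (0 < y \<and> Vwall x (y - 1) \<and> (x, y - 1) \<in> Z) (Vwall x y \<and> (x, y + 1) \<in> Z)"
proof -
  obtain x1 y1 x2 y2 where *: "(x1, y1) \<in> Z" "(x2, y2) \<in> Z" "(x1, y1) \<noteq> (x2, y2)" "wadj (x, y) (x1, y1)" "wadj (x, y) (x2, y2)"
    using assms unfolding core2_def by (metis surj_pair)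
  let ?L = "0 < x \<and> Hwall (x - 1) y \<and> (x - 1, y) \<in> Z" let ?R = "Hwall x y \<and> (x + 1, y) \<in> Z"
  let ?B = "0 < y \<and> Vwall x (y - 1) \<and> (x, y - 1) \<in> Z" let ?U = "Vwall x y \<and> (x, y + 1) \<in> Z"
  have c: "?L \<and> p = (x - 1, y) \<or> ?R \<and> p = (x + 1, y) \<or> ?B \<and> p = (x, y - 1) \<or> ?U \<and> p = (x, y + 1)"
    if h: "wadj (x, y) p" "p \<in> Z" for p
  proof -
    obtain x' y' where p: "p = (x', y')" by (cases p)
    from h(1)[unfolded p wadj.simps] show ?thesis
      by (elim disjE conjE) (use h(2) p in simp_all)
  qed
  show ?thesis using c[OF *(4,1)] c[OF *(5,2)] *(3) unfolding two_of_def by metis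
qed

text \<open>A supposed core is exhausted: sweeping the columns from west to east, every cell loses
  all its points, and then the ring of each room is cut at a selected row.\<close>

lemma feedback_of_solution:
  assumes S: "solution S"
  shows "\<exists>F\<subseteq>D. card F = card blocks \<and> forest (D - F)"
proof -
  have "\<forall>j\<in>{..<m}. \<exists>r. r < n \<and> tap r j \<and> r \<notin> S" using S unfolding solution_def by auto
  from bchoice[OF this] obtain rs where rs: "\<And>j. j < m \<Longrightarrow> rs j < n \<and> tap (rs j) j \<and> rs j \<notin> S" by auto
  \<comment> \<open>In the crossing a selected row takes the east side and an unselected one the
    west side. Rows from \<open>rs j\<close> upwards, \<open>rs j\<close> being a tapped unselected
    row of column \<open>j\<close>, take the north side and the rows below it the south side. The
    tap absorbs the column bit in row \<open>rs j\<close> alone.\<close>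
  define ch where "ch i = (case i of (k, j, r) \<Rightarrow> loc j r (
     if k = 0 then (if r \<in> S then 3 else 2, if rs j \<le> r then 4 else 3)
     else if k = 1 then (if r \<in> S then 6 else 5, 3)
     else if k = 2 then (2, if rs j < r then 2 else 0)
     else (if r = rs j then 3 else 4, 2)))" for i :: "nat \<times> nat \<times> nat"
  have chr: "ch i \<in> room i" for i
    unfolding ch_def room_def local_block_def by (cases i) auto
  define F where "F = ch ` blocks"
  have inj: "inj_on ch blocks" by (rule inj_onI) (metis chr rooms_disjoint)
  have FD: "F \<subseteq> D" unfolding F_def using chr room_subset by blast
  have "forest (D - F)"
    unfolding forest_def
  proof
    assume "\<exists>Z\<subseteq>D - F. core2 wadj Z"
    then obtain Z where ZD: "Z \<subseteq> D - F" and Z: "core2 wadj Z" by blast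
    have notF: "ch i \<notin> Z" if "i \<in> blocks" for i using ZD that unfolding F_def by blast
    have c0: "(0, j, r) \<in> blocks" "(1, j, r) \<in> blocks" "1 \<le> r \<Longrightarrow> (2, j, r) \<in> blocks" "tap r j \<Longrightarrow> (3, j, r) \<in> blocks"
      if "j < m" "r < n" for j r using that unfolding blocks_def by auto
    \<comment> \<open>By induction no core point lies in the first \<open>j\<close> columns of
      cells, so points on the west edge of cell column \<open>j\<close> have no west neighbour in
      the core.\<close>
    have left: "\<forall>x y. x < 6 * j \<longrightarrow> (x, y) \<notin> Z" if "j \<le> m" for j
      using that
    proof (induction j)
      case 0 then show ?case by simp
    next
      case (Suc j)
      have j: "j < m" and IH: "\<And>x y. x < 6 * j \<Longrightarrow> (x, y) \<notin> Z" using Suc by auto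
      define z where "z r u w \<longleftrightarrow> (6 * j + u, 5 * r + w) \<in> Z" for r u w
      have zS: "z r u 5 \<longleftrightarrow> z (Suc r) u 0" for r u unfolding z_def by (simp add: add.commute)
      have two: "two_of (1 \<le> u \<and> hw (tap r j) (1 \<le> r) (u - 1) w \<and> z r (u - 1) w) (hw (tap r j) (1 \<le> r) u w \<and> z r (u + 1) w)
          (1 \<le> w \<and> vw (tap r j) (1 \<le> r) (1 \<le> j) u (w - 1) \<and> z r u (w - 1) \<or>
             w = 0 \<and> 1 \<le> r \<and> vw (tap (r - 1) j) (1 \<le> r - 1) (1 \<le> j) u 4 \<and> z (r - 1) u 4)
          (vw (tap r j) (1 \<le> r) (1 \<le> j) u w \<and> z r u (w + 1))"
        if h: "z r u w" "r < n" "u < 6" "w < 5" for r u w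
      proof -
        let ?x = "6 * j + u" let ?y = "5 * r + w"
        have t: "two_of (0 < ?x \<and> Hwall (?x - 1) ?y \<and> (?x - 1, ?y) \<in> Z) (Hwall ?x ?y \<and> (?x + 1, ?y) \<in> Z)
          (0 < ?y \<and> Vwall ?x (?y - 1) \<and> (?x, ?y - 1) \<in> Z) (Vwall ?x ?y \<and> (?x, ?y + 1) \<in> Z)"
          using two_nbs[OF Z] h(1) unfolding z_def by blast
        have 1: "1 \<le> u \<and> hw (tap r j) (1 \<le> r) (u - 1) w \<and> z r (u - 1) w" if "0 < ?x \<and> Hwall (?x - 1) ?y \<and> (?x - 1, ?y) \<in> Z"
        proof (cases "u = 0")
          case True
          then have "?x - 1 < 6 * j" using that by auto
          then show ?thesis using IH that by blast
        next
          case False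
          then have e: "?x - 1 = 6 * j + (u - 1)" "u - 1 < 6" using h by auto
          then show ?thesis using that walls_at(1)[OF j h(2) e(2) h(4)] False unfolding z_def e(1) by simp
        qed
        have 2: "hw (tap r j) (1 \<le> r) u w \<and> z r (u + 1) w" if "Hwall ?x ?y \<and> (?x + 1, ?y) \<in> Z"
          using that walls_at(1)[OF j h(2-4)] unfolding z_def by simp
        have 4: "vw (tap r j) (1 \<le> r) (1 \<le> j) u w \<and> z r u (w + 1)" if "Vwall ?x ?y \<and> (?x, ?y + 1) \<in> Z"
          using that walls_at(2)[OF j h(2-4)] unfolding z_def by simp
        have 3: "1 \<le> w \<and> vw (tap r j) (1 \<le> r) (1 \<le> j) u (w - 1) \<and> z r u (w - 1) \<or>
             w = 0 \<and> 1 \<le> r \<and> vw (tap (r - 1) j) (1 \<le> r - 1) (1 \<le> j) u 4 \<and> z (r - 1) u 4"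
          if *: "0 < ?y \<and> Vwall ?x (?y - 1) \<and> (?x, ?y - 1) \<in> Z"
        proof (cases "w = 0")
          case True
          then have r: "1 \<le> r" "r - 1 < n" "?y - 1 = 5 * (r - 1) + 4" using * h by auto
          have "(4::nat) < 5" by simp
          then show ?thesis using * True walls_at(2)[OF j r(2) h(3), of 4] r(1) unfolding z_def r(3) by blast
        next
          case False
          then have e: "?y - 1 = 5 * r + (w - 1)" "w - 1 < 5" using h by auto
          then show ?thesis using * walls_at(2)[OF j h(2,3) e(2)] False unfolding z_def e(1) by simp
        qed
        show ?thesis by (rule two_of_mono[OF t 1 2 3 4])
      qed
      \<comment> \<open>The four points are the inner points of the two paths between
        \<open>(2, 0)\<close> and \<open>(2, 2)\<close>; a core meeting such a path would contain
        both ends, and one of them is in \<open>F\<close>.\<close>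
      have v: "\<not> z r 1 0 \<and> \<not> z r 1 1 \<and> \<not> z r 1 2 \<and> \<not> z r 2 1" if r: "r < n" "1 \<le> r" for r
      proof -
        have d: "\<not> z r 2 2 \<or> \<not> z r 2 0"
          using notF[OF c0(3)[OF j r]] unfolding ch_def z_def loc_def by (auto split: if_splits)
        have "z r 1 1 \<and> z r 2 0" if "z r 1 0" using two[OF that r(1)] r by (simp add: two_of_def flip: numeral_2_eq_2)
        moreover have "z r 1 0 \<and> z r 1 2" if "z r 1 1" using two[OF that r(1)] r by (simp add: two_of_def flip: numeral_2_eq_2)
        moreover have "z r 1 1 \<and> z r 2 2" if "z r 1 2" using two[OF that r(1)] r by (simp add: two_of_def flip: numeral_2_eq_2)
        moreover have "z r 2 0 \<and> z r 2 2" if "z r 2 1" using two[OF that r(1)] r by (simp add: two_of_def flip: numeral_2_eq_2)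
        ultimately show ?thesis using d by blast
      qed
      have body: "\<not> z r 0 3 \<and> \<not> z r 0 4 \<and> \<not> z r 1 3 \<and> \<not> z r 1 4 \<and> \<not> z r 2 3 \<and> \<not> z r 2 4 \<and> \<not> z r 3 3 \<and> \<not> z r 3 4 \<and>
         \<not> z r 4 3 \<and> \<not> z r 4 4 \<and> \<not> z r 5 3 \<and> \<not> z r 5 4 \<and> \<not> z r 2 5 \<and> \<not> z r 3 5 \<and> \<not> z r 2 2 \<and> \<not> z r 3 2 \<and>
         \<not> (tap r j \<and> z r 4 2) \<and> \<not> (tap r j \<and> z r 3 1) \<and> \<not> (tap r j \<and> z r 4 1) \<and> \<not> z r 5 2"
        if r: "r < n" for r
      proof -
        \<comment> \<open>\<open>(2, 5)\<close> is \<open>(2, 0)\<close> of the cell above, whose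
          neighbours to the left and above have just been excluded; on the top line of the maze
          there are no such walls.\<close>
        have N1: "z r 2 5 \<Longrightarrow> two_of (z r 2 4) (z r 3 5) False False"
        proof -
          assume h: "z r 2 5"
          show ?thesis
          proof (cases "Suc r < n")
            case True
            then show ?thesis using two[OF h[unfolded zS]] v[of "Suc r"] unfolding zS by (simp add: two_of_def)
          next
            case False
            then have n: "Suc r = n" using r by simp
            have e: "5 * r + 5 = 5 * n" using n by auto
            have q: "6 * j + 2 - 1 = 6 * j + 1" "6 * j + 2 + 1 = 6 * j + 3" "5 * n - 1 = 5 * r + 4" using n by auto
            have "(6 * j + 2, 5 * n) \<in> Z" using h unfolding z_def e .
            note t = two_nbs[OF Z this, unfolded q]
            have "\<not> Hwall (6 * j + 1) (5 * n)" "\<not> Vwall (6 * j + 2) (5 * n)"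
              using walls_top(1)[OF j, of 1] walls_top(2)[OF j, of 2] by simp_all
            then show ?thesis using t unfolding z_def e two_of_def by blast
          qed
        qed
        have N2: "z r 3 5 \<Longrightarrow> two_of (z r 2 5) (z r 3 4) False False"
        proof -
          assume h: "z r 3 5"
          show ?thesis
          proof (cases "Suc r < n")
            case True
            then show ?thesis using two[OF h[unfolded zS]] unfolding zS by (simp add: two_of_def)
          next
            case False
            then have n: "Suc r = n" using r by simp
            have e: "5 * r + 5 = 5 * n" using n by auto
            have q: "6 * j + 3 - 1 = 6 * j + 2" "6 * j + 3 + 1 = 6 * j + 4" "5 * n - 1 = 5 * r + 4" using n by auto
            have "(6 * j + 3, 5 * n) \<in> Z" using h unfolding z_def e .
            note t = two_nbs[OF Z this, unfolded q]
            have "\<not> Hwall (6 * j + 3) (5 * n)" "\<not> Vwall (6 * j + 3) (5 * n)"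
              using walls_top[OF j, of 3] by simp_all
            then show ?thesis using t unfolding z_def e two_of_def by blast
          qed
        qed
        have vr: "1 \<le> r \<Longrightarrow> \<not> z r 1 2 \<and> \<not> z r 2 1" using v[OF r] by blast
        have z02: "\<not> z r 0 2"
        proof
          assume "z r 0 2" then show False using two[OF _ r, of 0 2] by (simp add: two_of_def)
        qed
        have S1: "two_of (z r 2 3) (z r 3 2) False False" if "z r 2 2"
        proof (cases "1 \<le> r")
          case True then show ?thesis using two[OF that r] vr by (simp add: two_of_def)
        next
          case False then show ?thesis using two[OF that r] by (simp add: two_of_def)
        qed
        note f = notF[OF c0(1)[OF j r]] notF[OF c0(2)[OF j r]]
        let ?a = "r \<in> S" let ?b = "rs j \<le> r" let ?e = "r = rs j"
        have e: "?e \<Longrightarrow> tap r j \<and> \<not> ?a \<and> ?b" using rs[OF j] by auto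
        show ?thesis
        proof (rule cell_prune[where a = ?a and b = ?b and e = ?e and t = "tap r j" and ?t0.0 = "1 \<le> j"
            and ?z62.0 = "z r 6 2" and ?z63.0 = "z r 6 3"])
          show "?a \<Longrightarrow> ?b \<Longrightarrow> \<not> z r 3 4" "?a \<Longrightarrow> \<not> ?b \<Longrightarrow> \<not> z r 3 3" "\<not> ?a \<Longrightarrow> \<not> ?b \<Longrightarrow> \<not> z r 2 3" "\<not> ?a \<Longrightarrow> ?b \<Longrightarrow> \<not> z r 2 4"
            "?a \<Longrightarrow> \<not> z r 6 3" "\<not> ?a \<Longrightarrow> \<not> z r 5 3"
            using f unfolding ch_def z_def loc_def by simp_all
          show "\<not> ?b \<Longrightarrow> \<not> z r 2 5"
          proof -
            assume b: "\<not> ?b"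
            then have "Suc r < n" using rs[OF j] by auto
            then show ?thesis using notF[OF c0(3)[OF j, of "Suc r"]] b unfolding ch_def zS unfolding z_def loc_def by simp
          qed
          show "?b \<Longrightarrow> \<not> ?e \<Longrightarrow> \<not> z r 2 2"
            using notF[OF c0(3)[OF j r]] unfolding ch_def z_def loc_def by simp
          show "?e \<Longrightarrow> \<not> z r 3 2"
            using notF[OF c0(4)[OF j r]] e unfolding ch_def z_def loc_def by simp
          show "tap r j \<Longrightarrow> \<not> ?e \<Longrightarrow> \<not> z r 4 2"
            using notF[OF c0(4)[OF j r]] unfolding ch_def z_def loc_def by simp
          show "?a \<Longrightarrow> 1 \<le> j \<Longrightarrow> \<not> z r 0 3"
          proof -
            assume a: ?a and j1: "1 \<le> j"
            then obtain i where i: "j = Suc i" by (cases j) auto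
            then have "i < m" using j by simp
            then show ?thesis using notF[OF c0(2)[of i r]] a r unfolding ch_def z_def loc_def i by (simp add: add.commute)
          qed
          show "z r 2 5 \<Longrightarrow> two_of (z r 2 4) (z r 3 5) False False" by (rule N1)
          show "z r 3 5 \<Longrightarrow> two_of (z r 2 5) (z r 3 4) False False" by (rule N2)
          show "z r 2 2 \<Longrightarrow> two_of (z r 2 3) (z r 3 2) False False" by (rule S1)
          show "?e \<Longrightarrow> tap r j \<and> \<not> ?a \<and> ?b" by (rule e)
        qed ((drule two[OF _ r], simp, simp, (simp add: two_of_def z02 flip: numeral_2_eq_2; blast?)[1])+)
      qed
      have low: "\<not> z r 2 0 \<and> \<not> z r 3 0" if r: "r < n" "1 \<le> r" for r
      proof -
        obtain r' where r': "r = Suc r'" using r(2) by (cases r) auto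
        then show ?thesis using body[of r'] r(1) zS by auto
      qed
      have z01: "\<not> z r 0 2" if r: "r < n" for r
      proof
        assume "z r 0 2" then show False using two[OF _ r, of 0 2] r by (auto simp: two_of_def)
      qed
      have inner: "\<not> z r u w" if h: "r < n" "u < 6" "w < 5" for r u w
      proof
        assume zz: "z r u w"
        have "u = 0 \<or> u = 1 \<or> u = 2 \<or> u = 3 \<or> u = 4 \<or> u = 5" "w = 0 \<or> w = 1 \<or> w = 2 \<or> w = 3 \<or> w = 4" using h by linarith+
        then show False
          using two[OF zz h] zz body[OF h(1)] v[OF h(1)] low[OF h(1)] z01[OF h(1)]
          by (elim disjE; hypsubst) (cases "1 \<le> r"; cases "tap r j"; simp add: two_of_def flip: numeral_2_eq_2)+
      qed
      show ?case
      proof (intro allI impI)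
        fix x y assume x: "x < 6 * Suc j"
        show "(x, y) \<notin> Z"
        proof (cases "x < 6 * j")
          case True then show ?thesis using IH by blast
        next
          case False
          define u where "u = x - 6 * j"
          have u: "x = 6 * j + u" "u < 6" using x False unfolding u_def by auto
          show ?thesis
          proof
            assume xy: "(x, y) \<in> Z"
            then have yn: "y < 5 * n + 1" using ZD mem_D by auto
            show False
            proof (cases "y < 5 * n")
              case True
              then have "z (y div 5) u (y mod 5)" "y div 5 < n" "y mod 5 < 5" using xy u unfolding z_def by auto
              then show False using inner u(2) by blast
            next
              case False
              then have y: "y = 5 * n" using yn by simp
              obtain r where r: "n = Suc r" using pos(2) by (cases n) auto
              have "\<not> z r 2 5" "\<not> z r 3 5" using body[of r] r by auto
              then have "u \<noteq> 2" "u \<noteq> 3" using xy y r unfolding z_def u(1) by (auto simp: add.commute)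
              have L: "\<not> (0 < x \<and> Hwall (x - 1) y \<and> (x - 1, y) \<in> Z)"
              proof (cases "u = 0")
                case True
                then have "x - 1 < 6 * j \<or> x = 0" using u by auto
                then show ?thesis using IH by auto
              next
                case False
                then have "x - 1 = 6 * j + (u - 1)" "u - 1 < 6" "u - 1 \<noteq> 2" using u \<open>u \<noteq> 3\<close> by auto
                then show ?thesis using walls_top(1)[OF j, of "u - 1"] y by simp
              qed
              have "\<not> Hwall x y" "\<not> Vwall x y" using walls_top[OF j u(2)] \<open>u \<noteq> 2\<close> unfolding u(1) y by auto
              then show False using two_nbs[OF Z xy] L unfolding two_of_def by blast
            qed
          qed
        qed
      qed
    qed
    have Z6: "6 * m \<le> x" if "(x, y) \<in> Z" for x y using left[of m] that by (metis le_refl linorder_not_less)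
    have Zx: "x = 6 * m \<or> x = 6 * m + 1" if h: "(x, y) \<in> Z" for x y
    proof -
      have "x < 6 * m + 2" using h ZD mem_D by auto
      then show ?thesis using Z6[OF h] by linarith
    qed
    have H1: "\<not> Hwall (6 * m + 1) y" for y
    proof -
      have "(6 * m + 1) div 6 = m" "(6 * m + 1) mod 6 = 1" by auto
      then show ?thesis unfolding Hwall_def Let_def by simp
    qed
    have H0: "Hwall (6 * m) y \<longleftrightarrow> y div 5 < n \<and> (y mod 5 = 3 \<and> (y div 5) mod A = 0 \<or> y mod 5 = 4 \<and> Suc (y div 5) mod A = 0)" for y
      unfolding Hwall_def Let_def by simp
    have V4: "\<not> Vwall x y" if "x = 6 * m \<or> x = 6 * m + 1" "y mod 5 = 4" "Suc (y div 5) mod A = 0" for x y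
    proof -
      have "x div 6 = m" "x mod 6 \<le> 1" using that(1) by auto
      then show ?thesis using that(2,3) unfolding Vwall_def Let_def by simp
    qed
    \<comment> \<open>A lowest point of the core has no neighbour below, hence one sideways and one
      above. Only the bottom wall of a room allows this, since no vertical wall continues upwards
      from its top wall.\<close>
    define y0 where "y0 = (LEAST y. \<exists>x. (x, y) \<in> Z)"
    have "\<exists>y x. (x, y) \<in> Z" using Z unfolding core2_def by auto
    from LeastI_ex[OF this] obtain x0 where x0: "(x0, y0) \<in> Z" unfolding y0_def by blast
    have min: "y0 \<le> y" if "(x, y) \<in> Z" for x y unfolding y0_def using that by (intro Least_le) blast
    have nodown: "\<not> (0 < y0 \<and> (x, y0 - 1) \<in> Z)" for x using min[of x "y0 - 1"] by auto
    have edge: "Hwall (6 * m) y0 \<and> (6 * m, y0) \<in> Z \<and> Vwall x0 y0"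
    proof (cases "x0 = 6 * m")
      case True
      have "\<not> (0 < x0 \<and> (x0 - 1, y0) \<in> Z)" using Z6[of "x0 - 1" y0] True by auto
      then show ?thesis using two_nbs[OF Z x0] nodown x0 True unfolding two_of_def by blast
    next
      case False
      then have x: "x0 = 6 * m + 1" using Zx[OF x0] by simp
      then have q: "x0 - 1 = 6 * m" by simp
      have "\<not> Hwall x0 y0" using H1[of y0] unfolding x .
      then show ?thesis using two_nbs[OF Z x0] nodown[of x0] unfolding two_of_def q by argo
    qed
    let ?r = "y0 div 5"
    have r: "?r < n" "y0 mod 5 = 3" "?r mod A = 0"
    proof -
      have "\<not> (y0 mod 5 = 4 \<and> Suc ?r mod A = 0)" using V4[OF Zx[OF x0], of y0] edge by argo
      then show "?r < n" "y0 mod 5 = 3" "?r mod A = 0" using edge H0[of y0] by metis+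
    qed
    define g where "g = ?r div A"
    have rg: "?r = g * A" unfolding g_def using r(3) by (simp add: mod_eq_0_iff_dvd)
    have y0: "y0 = 5 * (g * A) + 3" using r(2) rg by (metis mult_div_mod_eq)
    have gn: "g < n div A"
    proof -
      have "g * A < (n div A) * A" using r(1) rg dvd_div_mult_self[OF pos(4)] by simp
      then show ?thesis by simp
    qed
    let ?b = "5 * (g * A + A - 1) + 4"
    have H: "\<not> Hwall (6 * m) y" if y: "y0 < y" "y < ?b" for y
    proof
      assume "Hwall (6 * m) y"
      then have h: "y mod 5 = 3 \<and> (y div 5) mod A = 0 \<or> y mod 5 = 4 \<and> Suc (y div 5) mod A = 0" using H0 by blast
      have e: "y = 5 * (y div 5) + y mod 5" by simp
      have "y mod 5 < 5" by simp
      then have q: "g * A \<le> y div 5" "y div 5 < g * A + A" using e y y0 pos(3) by linarith+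
      note G = group_mod[OF q]
      from h show False
      proof (elim disjE conjE)
        assume "y mod 5 = 3" "(y div 5) mod A = 0"
        then have "y div 5 = g * A" using G(1) q(1) by simp
        then show False using e y(1) y0 \<open>y mod 5 = 3\<close> by linarith
      next
        assume "y mod 5 = 4" "Suc (y div 5) mod A = 0"
        then have "Suc (y div 5) = g * A + A" using G(3) by simp
        then show False using e y(2) \<open>y mod 5 = 4\<close> by linarith
      qed
    qed
    \<comment> \<open>On the west line of the ring there is no sideways wall strictly between bottom
      and top, so the core has to climb through every point up to the top, including the removed
      one.\<close>
    have up: "(6 * m, y0 + d) \<in> Z" if "y0 + d \<le> ?b" for d
      using that
    proof (induction d)
      case 0 then show ?case using edge by simp
    next
      case (Suc d)
      then have h: "(6 * m, y0 + d) \<in> Z" by simp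
      have nl: "\<not> (0 < 6 * m \<and> (6 * m - 1, y0 + d) \<in> Z)" using Z6[of "6 * m - 1" "y0 + d"] by auto
      have "Vwall (6 * m) (y0 + d) \<and> (6 * m, y0 + d + 1) \<in> Z"
      proof (cases "d = 0")
        case True
        then have q: "y0 + d = y0" by simp
        show ?thesis using two_nbs[OF Z h] nl nodown[of "6 * m"] unfolding two_of_def q by blast
      next
        case False
        then have "\<not> Hwall (6 * m) (y0 + d)" using H[of "y0 + d"] Suc.prems by auto
        then show ?thesis using two_nbs[OF Z h] nl unfolding two_of_def by blast
      qed
      then show ?case by simp
    qed
    obtain r' where r': "r' \<in> S" "r' div A = g" using S gn unfolding solution_def by blast
    have rn: "r' < n" using S r'(1) unfolding solution_def by auto
    have "r' = g * A + r' mod A" "r' mod A < A" using r'(2) pos(3) by (metis div_mult_mod_eq, simp)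
    then have "g * A \<le> r'" "r' < g * A + A" by linarith+
    then have "y0 + 5 * (r' - g * A) \<le> ?b" "y0 + 5 * (r' - g * A) = 5 * r' + 3" using y0 by auto
    then have "(6 * m, 5 * r' + 3) \<in> Z" using up by metis
    moreover have "(1, m - 1, r') \<in> blocks" "ch (1, m - 1, r') = (6 * m, 5 * r' + 3)"
      using pos(1) rn r'(1) unfolding blocks_def ch_def loc_def by auto
    ultimately show False using notF by metis
  qed
  then show ?thesis using FD card_image[OF inj] unfolding F_def by blast
qed

end

section \<open>Edges and cardinalities as arithmetic expressions\<close>

context maze
begin

text \<open>\<open>i\<close> is the height above the lattice row and \<open>s\<close> the shift to
  the right of \<open>Q1\<close>; shift 3 reaches the \<open>Q1\<close> of the next lattice
  point.\<close>

definition loc_code :: "nat \<Rightarrow> nat \<Rightarrow> nat \<Rightarrow> nat \<Rightarrow> nat" where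
  "loc_code x y i s = (b * y + i) * Wd + (3 * x + (Y - y) + s)"

lemma cd_simps:
  "cd (Q1 x y) = loc_code x y 0 0" "cd (Q2 x y) = loc_code x y 0 1" "cd (HP x y) = loc_code x y 0 2"
  "cd (HD x y) = loc_code x y 1 2" "cd (VP x y i) = loc_code x y i 0" "cd (VD x y i) = loc_code x y i 1"
  unfolding cd_def loc_code_def by simp_all

lemma cd_Q1_Suc: "cd (Q1 (Suc x) y) = loc_code x y 0 3"
  unfolding cd_def loc_code_def by simp

text \<open>One disjunct per rule of \<open>link\<close>, on numbers instead of vertex names, so
  that adjacency becomes a bounded quantification over \<open>x\<close>, \<open>y\<close> and
  \<open>i\<close>.\<close>

definition link_code :: "nat \<Rightarrow> nat \<Rightarrow> nat \<Rightarrow> nat \<Rightarrow> nat \<Rightarrow> bool" where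
  "link_code x y i a c \<longleftrightarrow> a = loc_code x y 0 0 \<and> c = loc_code x y 0 1 \<or>
     Hw x y \<and> (a = loc_code x y 0 1 \<and> c = loc_code x y 0 2 \<or> a = loc_code x y 0 2 \<and> c = loc_code x y 0 3 \<or>
       a = loc_code x y 0 2 \<and> c = loc_code x y 1 2) \<or>
     Vw x y \<and> (a = loc_code x y 0 0 \<and> c = loc_code x y 1 0 \<or>
       0 < i \<and> Suc i < b \<and> a = loc_code x y i 0 \<and> c = loc_code x y (Suc i) 0 \<or>
       a = loc_code x y (b - 1) 0 \<and> c = loc_code x (Suc y) 0 1 \<or> 0 < i \<and> a = loc_code x y i 0 \<and> c = loc_code x y i 1)"

lemma link_code_link:
  assumes "x < X" "y < Y" "i < b" "link_code x y i a c"
  shows "\<exists>u v. link u v \<and> a = cd u \<and> c = cd v"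
proof -
  have l: ?thesis if "link u v" "a = cd u" "c = cd v" for u v using that by blast
  from assms(4) show ?thesis
    unfolding link_code_def
  proof (elim disjE conjE)
    assume "a = loc_code x y 0 0" "c = loc_code x y 0 1"
    then show ?thesis using l[OF link.intros(1)[OF assms(1,2)]] by (simp only: cd_simps)
  next
    assume h: "Hw x y" "a = loc_code x y 0 1" "c = loc_code x y 0 2"
    show ?thesis using l[OF link.intros(2)[OF h(1)]] h(2,3) by (simp only: cd_simps)
  next
    assume h: "Hw x y" "a = loc_code x y 0 2" "c = loc_code x y 0 3"
    show ?thesis using l[OF link.intros(3)[OF h(1)] _ _, unfolded cd_Q1_Suc cd_simps(3)] h(2,3) by blast
  next
    assume h: "Hw x y" "a = loc_code x y 0 2" "c = loc_code x y 1 2"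
    show ?thesis using l[OF link.intros(4)[OF h(1)]] h(2,3) by (simp only: cd_simps)
  next
    assume h: "Vw x y" "a = loc_code x y 0 0" "c = loc_code x y 1 0"
    show ?thesis using l[OF link.intros(5)[OF h(1)]] h(2,3) by (simp only: cd_simps)
  next
    assume h: "Vw x y" "0 < i" "Suc i < b" "a = loc_code x y i 0" "c = loc_code x y (Suc i) 0"
    show ?thesis using l[OF link.intros(6)[OF h(1-3)]] h(4,5) by (simp only: cd_simps)
  next
    assume h: "Vw x y" "a = loc_code x y (b - 1) 0" "c = loc_code x (Suc y) 0 1"
    show ?thesis using l[OF link.intros(7)[OF h(1)]] h(2,3) by (simp only: cd_simps)
  next
    assume h: "Vw x y" "0 < i" "a = loc_code x y i 0" "c = loc_code x y i 1"
    show ?thesis using l[OF link.intros(8)[OF h(1,2) assms(3)]] h(3,4) by (simp only: cd_simps)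
  qed
qed

lemma link_link_code: "link u v \<Longrightarrow> \<exists>x<X. \<exists>y<Y. \<exists>i<b. link_code x y i (cd u) (cd v)"
proof (induction rule: link.induct)
  case (1 x y)
  then have "x < X \<and> y < Y \<and> 0 < b \<and> link_code x y 0 (cd (Q1 x y)) (cd (Q2 x y))" using b unfolding link_code_def cd_simps by simp
  then show ?case by blast
next
  case (2 x y)
  then have "x < X \<and> y < Y \<and> 0 < b \<and> link_code x y 0 (cd (Q2 x y)) (cd (HP x y))"
    using b Hw[OF 2] unfolding link_code_def cd_simps by simp
  then show ?case by blast
next
  case (3 x y)
  then have "x < X \<and> y < Y \<and> 0 < b \<and> link_code x y 0 (cd (HP x y)) (cd (Q1 (Suc x) y))"
    using b Hw[OF 3] unfolding link_code_def cd_Q1_Suc unfolding cd_simps by simp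
  then show ?case by blast
next
  case (4 x y)
  then have "x < X \<and> y < Y \<and> 0 < b \<and> link_code x y 0 (cd (HP x y)) (cd (HD x y))"
    using b Hw[OF 4] unfolding link_code_def cd_simps by simp
  then show ?case by blast
next
  case (5 x y)
  then have "x < X \<and> y < Y \<and> 0 < b \<and> link_code x y 0 (cd (Q1 x y)) (cd (VP x y 1))"
    using b Vw[OF 5] unfolding link_code_def cd_simps by simp
  then show ?case by blast
next
  case (6 x y i)
  then have "x < X \<and> y < Y \<and> i < b \<and> link_code x y i (cd (VP x y i)) (cd (VP x y (Suc i)))"
    using b Vw[OF 6(1)] unfolding link_code_def cd_simps by simp
  then show ?case by blast
next
  case (7 x y)
  then have "x < X \<and> y < Y \<and> 0 < b \<and> link_code x y 0 (cd (VP x y (b - 1))) (cd (Q2 x (Suc y)))"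
    using b Vw[OF 7] unfolding link_code_def cd_simps by simp
  then show ?case by blast
next
  case (8 x y i)
  then have "x < X \<and> y < Y \<and> i < b \<and> link_code x y i (cd (VP x y i)) (cd (VD x y i))"
    using b Vw[OF 8(1)] unfolding link_code_def cd_simps by simp
  then show ?case by blast
qed

lemma edge_code: "{a, c} \<in> E \<longleftrightarrow> (\<exists>x<X. \<exists>y<Y. \<exists>i<b. link_code x y i a c \<or> link_code x y i c a)"
proof
  assume "{a, c} \<in> E"
  then obtain u v where uv: "{a, c} = {cd u, cd v}" "link u v" unfolding E_def by auto
  obtain x y i where h: "x < X" "y < Y" "i < b" "link_code x y i (cd u) (cd v)" using link_link_code[OF uv(2)] by blast
  have "a = cd u \<and> c = cd v \<or> a = cd v \<and> c = cd u" using uv(1) by (auto simp: doubleton_eq_iff)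
  then show "\<exists>x<X. \<exists>y<Y. \<exists>i<b. link_code x y i a c \<or> link_code x y i c a" using h by blast
next
  assume "\<exists>x<X. \<exists>y<Y. \<exists>i<b. link_code x y i a c \<or> link_code x y i c a"
  then obtain x y i where h: "x < X" "y < Y" "i < b" "link_code x y i a c \<or> link_code x y i c a" by blast
  have "(\<exists>u v. link u v \<and> a = cd u \<and> c = cd v) \<or> (\<exists>u v. link u v \<and> c = cd u \<and> a = cd v)"
    using link_code_link[OF h(1-3)] h(4) by blast
  then show "{a, c} \<in> E" unfolding E_def by (auto simp: insert_commute)
qed

lemma card_pairs: "card {(x, y). x < X \<and> y < (Y::nat) \<and> R x y} = (\<Sum>x<(X::nat). \<Sum>y<Y. of_bool (R x y))"
proof -
  have "{(x, y). x < X \<and> y < Y \<and> R x y} = (SIGMA x:{..<X}. {y. y < Y \<and> R x y})" by auto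
  then have "card {(x, y). x < X \<and> y < Y \<and> R x y} = (\<Sum>x<X. card {y. y < Y \<and> R x y})" by simp
  moreover have "{..<Y} \<inter> {y. R x y} = {y. y < Y \<and> R x y}" for x by auto
  ultimately show ?thesis by (simp add: sum_of_bool_eq)
qed

lemma card_P: "card P = (\<Sum>x<X. \<Sum>y<Y. of_bool (Hw x y)) + (b - 1) * (\<Sum>x<X. \<Sum>y<Y. of_bool (Vw x y))"
proof -
  let ?H = "{(x, y). x < X \<and> y < Y \<and> Hw x y}" let ?V = "{(x, y). x < X \<and> y < Y \<and> Vw x y}"
  let ?f = "\<lambda>(x, y). HP x y" let ?g = "\<lambda>((x, y), i). VP x y i"
  have eq: "P = ?f ` ?H \<union> ?g ` (?V \<times> {1..<b})"
  proof (intro set_eqI iffI)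
    fix v assume "v \<in> P"
    then have v: "ok v" "isP v" unfolding P_def by auto
    show "v \<in> ?f ` ?H \<union> ?g ` (?V \<times> {1..<b})"
    proof (cases v)
      case (HP x y)
      then have "(x, y) \<in> ?H" using v(1) Hw[of x y] by simp
      then show ?thesis using HP by (intro UnI1 rev_image_eqI[of "(x, y)"]) auto
    next
      case (VP x y i)
      then have "((x, y), i) \<in> ?V \<times> {1..<b}" using v(1) Vw[of x y] by simp
      then show ?thesis using VP by (intro UnI2 rev_image_eqI[of "((x, y), i)"]) auto
    qed (use v(2) in auto)
  next
    fix v assume "v \<in> ?f ` ?H \<union> ?g ` (?V \<times> {1..<b})"
    then show "v \<in> P" unfolding P_def by auto
  qed
  have "card (?f ` ?H) = card ?H" by (rule card_image) (auto simp: inj_on_def)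
  moreover have "card (?g ` (?V \<times> {1..<b})) = card ?V * (b - 1)"
    by (subst card_image) (auto simp: inj_on_def card_cartesian_product)
  moreover have "?f ` ?H \<inter> ?g ` (?V \<times> {1..<b}) = {}" by auto
  moreover have "finite (?f ` ?H)" "finite (?g ` (?V \<times> {1..<b}))"
    using finite_P unfolding eq finite_Un by (rule conjunct1, rule conjunct2)
  ultimately have "card P = card ?H + card ?V * (b - 1)" unfolding eq by (simp only: card_Un_disjoint)
  then show ?thesis using card_pairs[of Hw] card_pairs[of Vw] by (simp add: mult.commute)
qed

end

section \<open>The target size and its equivalence with solvability\<close>

context grid
begin

text \<open>The size that is reached exactly when some feedback set meets the lower bound given by
  the number of disjoint blocks.\<close>

definition target :: nat where
  "target = card P + ((6 * m + 2) * (5 * n + 1) - card blocks)"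

lemma matching_iff_solution:
  "(\<exists>M. acyclic_matching G M \<and> card M = target) \<longleftrightarrow> (\<exists>S. solution S)"
proof
  assume "\<exists>M. acyclic_matching G M \<and> card M = target"
  then obtain M where M: "acyclic_matching G M" "card M = target" by blast
  obtain F where F: "F \<subseteq> D" "card F + card M \<le> card P + (6 * m + 2) * (5 * n + 1)" "forest (D - F)"
    using feedback_of_matching[OF M(1)] by blast
  \<comment> \<open>The difference in \<open>target\<close> is truncated; in the truncated case this
    bound on \<open>F\<close> alone gives the claim.\<close>
  have "card F \<le> (6 * m + 2) * (5 * n + 1)" using F(2) card_mono[OF finite_D F(1)] card_D by simp
  then have "card F \<le> card blocks" using F(2) unfolding M(2) target_def by linarith
  then show "\<exists>S. solution S" using solution_of_feedback[OF F(1,3)] by blast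
next
  assume "\<exists>S. solution S"
  then obtain F where F: "F \<subseteq> D" "card F = card blocks" "forest (D - F)" using feedback_of_solution by blast
  then obtain M where "acyclic_matching G M" "card M = card P + ((6 * m + 2) * (5 * n + 1) - card F)"
    using matching_of_feedback[OF F(1,3)] by blast
  then show "\<exists>M. acyclic_matching G M \<and> card M = target" unfolding target_def F(2) by blast
qed

lemma card_blocks: "card blocks = (\<Sum>j<m. \<Sum>r<n. 2 + of_bool (1 \<le> r) + of_bool (tap r j))"
proof -
  let ?R = "\<lambda>k j r. k = 0 \<or> k = 1 \<or> k = (2::nat) \<and> 1 \<le> r \<or> k = 3 \<and> tap r j"
  let ?S = "\<lambda>j r. {k. ?R k j r}"
  have "blocks = (\<lambda>(j, r, k). (k, j, r)) ` (SIGMA j:{..<m}. SIGMA r:{..<n}. ?S j r)"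
  proof (intro set_eqI iffI)
    fix i assume "i \<in> blocks"
    moreover obtain k j r where i: "i = (k, j, r)" by (cases i)
    ultimately have "(j, r, k) \<in> (SIGMA j:{..<m}. SIGMA r:{..<n}. ?S j r)" unfolding blocks_def by simp
    then show "i \<in> (\<lambda>(j, r, k). (k, j, r)) ` (SIGMA j:{..<m}. SIGMA r:{..<n}. ?S j r)"
      using i by (intro rev_image_eqI[of "(j, r, k)"]) auto
  next
    fix i assume "i \<in> (\<lambda>(j, r, k). (k, j, r)) ` (SIGMA j:{..<m}. SIGMA r:{..<n}. ?S j r)"
    then show "i \<in> blocks" unfolding blocks_def by auto
  qed
  moreover have "inj_on (\<lambda>(j, r, k). (k, j, r)) (SIGMA j:{..<m}. SIGMA r:{..<n}. ?S j r)" by (auto simp: inj_on_def)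
  ultimately have "card blocks = card (SIGMA j:{..<m}. SIGMA r:{..<n}. ?S j r)" by (simp add: card_image)
  moreover have fin: "finite (?S j r)" for j r by (rule finite_subset[of _ "{..3}"]) auto
  moreover have "card (?S j r) = 2 + of_bool (1 \<le> r) + of_bool (tap r j)" for j r
  proof -
    have "?S j r = {0, 1} \<union> (if 1 \<le> r then {2} else {}) \<union> (if tap r j then {3} else {})" by auto
    then show ?thesis by simp
  qed
  ultimately show ?thesis by simp
qed

lemma wall_corner: "Hwall 2 3" "Vwall 3 3"
  unfolding Hwall_def Vwall_def using pos by simp_all

lemma max_degree_3: "max_degree G = 3"
  using wall_corner by (intro max_degree_G[of 2 3]) (simp_all add: numeral_3_eq_3 numeral_2_eq_2)

lemma target_pos: "0 < target"
proof -
  have "HP 2 3 \<in> P" using wall_corner(1) by (simp only: P_def mem_Collect_eq ok.simps isP.simps)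
  then have "0 < card P" using finite_P by (auto simp: card_gt_0_iff)
  then show ?thesis unfolding target_def by simp
qed

end

section \<open>Tableaux of nondeterministic computations\<close>

text \<open>The transitions with \<open>stay\<close> let a halted accepting configuration repeat itself, so that all
  accepting computations have the same length.\<close>

datatype trans = Tr (tq: nat) (ts: "nat list") (tq': nat) (ta: "(nat \<times> int) list") (stay: bool)

text \<open>A letter describes one position on all tapes at once: the symbols, which heads stand
  there, and the transition made at that time. Repeating the transition at every position makes
  state changes checkable by comparing pairs of letters.\<close>

datatype letter = Lt (sy: "nat list") (he: "bool list") (tr: trans)

locale nondet =
  fixes M :: ntm
  assumes wf: "wf_ntm M"
begin

abbreviation "k \<equiv> tapes M"

definition trs :: "trans set" where
  "trs = {d. tq d < states M \<and> length (ts d) = k \<and> set (ts d) \<subseteq> {..<symbols M} \<and>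
     ((tq' d, ta d) \<in> delta M (tq d) (ts d) \<and> \<not> stay d \<or>
      delta M (tq d) (ts d) = {} \<and> tq d \<in> accepting M \<and> tq' d = tq d \<and> ta d = map (\<lambda>c. (c, 0)) (ts d) \<and> stay d)}"

lemma k1: "1 \<le> k" and symbols3: "3 \<le> symbols M" and states1: "1 \<le> states M"
  using wf unfolding wf_ntm_def by auto

lemma delta_wf:
  assumes "q < states M" "length s = k" "set s \<subseteq> {..<symbols M}" "(q', a) \<in> delta M q s"
  shows "q' < states M" "length a = k" "set a \<subseteq> {..<symbols M} \<times> {-1, 0, 1}"
  using wf assms unfolding wf_ntm_def by blast+

lemma trs_wf:
  assumes "d \<in> trs"
  shows "tq' d < states M" "length (ta d) = k" "set (ta d) \<subseteq> {..<symbols M} \<times> {-1, 0, 1}"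
proof -
  have d: "tq d < states M" "length (ts d) = k" "set (ts d) \<subseteq> {..<symbols M}" using assms unfolding trs_def by auto
  have "tq' d < states M \<and> length (ta d) = k \<and> set (ta d) \<subseteq> {..<symbols M} \<times> {-1, 0, 1}"
  proof (cases "stay d")
    case True
    then have "tq' d = tq d" "ta d = map (\<lambda>c. (c, 0)) (ts d)" using assms unfolding trs_def by auto
    then show ?thesis using d by auto
  next
    case False
    then have "(tq' d, ta d) \<in> delta M (tq d) (ts d)" using assms unfolding trs_def by auto
    then show ?thesis using delta_wf[OF d] by blast
  qed
  then show "tq' d < states M" "length (ta d) = k" "set (ta d) \<subseteq> {..<symbols M} \<times> {-1, 0, 1}" by auto
qed

lemma finite_trs: "finite trs"
proof (rule finite_subset)
  let ?S = "{..<states M} \<times> {s. set s \<subseteq> {..<symbols M} \<and> length s = k} \<times> {..<states M} \<times>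
    {a. set a \<subseteq> {..<symbols M} \<times> {-1, 0, 1::int} \<and> length a = k} \<times> (UNIV :: bool set)"
  show "trs \<subseteq> (\<lambda>(q, s, q', a, b). Tr q s q' a b) ` ?S"
  proof
    fix d assume d: "d \<in> trs"
    then have "(tq d, ts d, tq' d, ta d, stay d) \<in> ?S" using trs_wf[OF d] unfolding trs_def by auto
    moreover have "d = (\<lambda>(q, s, q', a, b). Tr q s q' a b) (tq d, ts d, tq' d, ta d, stay d)" by simp
    ultimately show "d \<in> (\<lambda>(q, s, q', a, b). Tr q s q' a b) ` ?S" by (rule rev_image_eqI)
  qed
  show "finite ((\<lambda>(q, s, q', a, b). Tr q s q' a b) ` ?S)"
    by (intro finite_imageI finite_cartesian_product finite_lists_length_eq) auto
qed

definition letters :: "letter set" where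
  "letters = {c. set (sy c) \<subseteq> {..<symbols M} \<and> length (sy c) = k \<and> length (he c) = k \<and> tr c \<in> trs}"

lemma finite_letters: "finite letters"
proof (rule finite_subset)
  let ?S = "{s. set s \<subseteq> {..<symbols M} \<and> length s = k} \<times> {h. set h \<subseteq> (UNIV :: bool set) \<and> length h = k} \<times> trs"
  show "letters \<subseteq> (\<lambda>(s, h, d). Lt s h d) ` ?S"
  proof
    fix c assume "c \<in> letters"
    then have "(sy c, he c, tr c) \<in> ?S" unfolding letters_def by auto
    moreover have "c = (\<lambda>(s, h, d). Lt s h d) (sy c, he c, tr c)" by simp
    ultimately show "c \<in> (\<lambda>(s, h, d). Lt s h d) ` ?S" by (rule rev_image_eqI)
  qed
  show "finite ((\<lambda>(s, h, d). Lt s h d) ` ?S)"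
    by (intro finite_imageI finite_cartesian_product finite_lists_length_eq finite_trs) auto
qed

definition applicable :: "trans \<Rightarrow> config \<Rightarrow> bool" where
  "applicable d c \<longleftrightarrow> d \<in> trs \<and> tq d = fst c \<and> ts d = map read (snd c)"

definition app :: "trans \<Rightarrow> config \<Rightarrow> config" where
  "app d c = (tq' d, map2 act (ta d) (snd c))"

definition good :: "config \<Rightarrow> bool" where
  "good c \<longleftrightarrow> fst c < states M \<and> length (snd c) = k \<and> (\<forall>i<k. \<forall>z. snd (snd c ! i) z < symbols M)"

lemma app_nth: "d \<in> trs \<Longrightarrow> length (snd c) = k \<Longrightarrow> i < k \<Longrightarrow> snd (app d c) ! i = act (ta d ! i) (snd c ! i)"
  using trs_wf(2) unfolding app_def by simp

lemma good_app: "good c \<Longrightarrow> d \<in> trs \<Longrightarrow> good (app d c)"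
proof -
  assume c: "good c" and d: "d \<in> trs"
  have "fst (ta d ! i) < symbols M" if "i < k" for i
  proof -
    have "ta d ! i \<in> set (ta d)" using that trs_wf(2)[OF d] by simp
    then have "ta d ! i \<in> {..<symbols M} \<times> {-1, 0, 1}" using trs_wf(3)[OF d] by blast
    then show ?thesis by (simp add: mem_Times_iff)
  qed
  then have "snd (snd (app d c) ! i) z < symbols M" if "i < k" for i z
    using c that app_nth[OF d _ that] unfolding good_def act_def by simp
  moreover have "length (snd (app d c)) = k" "fst (app d c) < states M"
    using c trs_wf[OF d] unfolding good_def app_def by auto
  ultimately show ?thesis unfolding good_def by blast
qed

lemma good_init: "good (init_config M x)"
proof -
  have "length (snd (init_config M x)) = k" using k1 unfolding init_config_def by simp
  moreover have "snd (snd (init_config M x) ! i) z < symbols M" if "i < k" for i z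
    using that symbols3 unfolding init_config_def word_contents_def by (cases i) auto
  ultimately show ?thesis using states1 unfolding good_def init_config_def by simp
qed

lemma good_reads: "good c \<Longrightarrow> length (map read (snd c)) = k \<and> set (map read (snd c)) \<subseteq> {..<symbols M}"
proof -
  assume c: "good c"
  have rd: "read (snd c ! i) < symbols M" if "i < k" for i using c that unfolding good_def read_def by blast
  have "length (snd c) = k" using c unfolding good_def by simp
  have "w < symbols M" if w: "w \<in> set (map read (snd c))" for w
  proof -
    obtain i where "i < length (snd c)" "w = read (snd c ! i)" using w by (auto simp: in_set_conv_nth)
    then show ?thesis using \<open>length (snd c) = k\<close> rd[of i] by simp
  qed
  then show ?thesis using \<open>length (snd c) = k\<close> by auto
qed

lemma step_trans:
  assumes "good c" "step M c c'"
  obtains d where "applicable d c" "\<not> stay d" "c' = app d c"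
proof -
  obtain q' a where qa: "(q', a) \<in> delta M (fst c) (map read (snd c))" "c' = (q', map2 act a (snd c))"
    using assms(2) unfolding step_def by auto
  have "applicable (Tr (fst c) (map read (snd c)) q' a False) c"
    using qa good_reads[OF assms(1)] assms(1) unfolding applicable_def trs_def good_def by auto
  moreover have "c' = app (Tr (fst c) (map read (snd c)) q' a False) c" using qa(2) unfolding app_def by simp
  ultimately show ?thesis using that by (metis trans.sel(5))
qed

lemma trans_step: "applicable d c \<Longrightarrow> \<not> stay d \<Longrightarrow> step M c (app d c)"
  unfolding applicable_def trs_def step_def app_def by force

lemma stay_app: "applicable d c \<Longrightarrow> stay d \<Longrightarrow> app d c = c"
proof -
  assume "applicable d c" "stay d"
  then have d: "tq' d = fst c" "ta d = map (\<lambda>c. (c, 0)) (map read (snd c))"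
    unfolding applicable_def trs_def by auto
  have "map2 act (ta d) (snd c) = snd c" unfolding d(2)
    by (rule nth_equalityI) (auto simp: act_def read_def)
  then show ?thesis unfolding app_def d(1) by simp
qed

lemma stay_halted: "applicable d c \<Longrightarrow> stay d \<Longrightarrow> halted M c \<and> fst c \<in> accepting M"
  unfolding applicable_def trs_def halted_def step_def by auto

lemma halted_stay:
  assumes "good c" "halted M c" "fst c \<in> accepting M"
  obtains d where "applicable d c" "stay d"
proof -
  have "delta M (fst c) (map read (snd c)) = {}" using assms(2) unfolding halted_def step_def by auto
  then have "applicable (Tr (fst c) (map read (snd c)) (fst c) (map (\<lambda>c. (c, 0)) (map read (snd c))) True) c"
    using good_reads[OF assms(1)] assms(1,3) unfolding applicable_def trs_def good_def by auto
  then show ?thesis using that by (metis trans.sel(5))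
qed

definition computation :: "bool list \<Rightarrow> nat \<Rightarrow> (nat \<Rightarrow> config) \<Rightarrow> (nat \<Rightarrow> trans) \<Rightarrow> bool" where
  "computation x T C d \<longleftrightarrow> C 0 = init_config M x \<and> (\<forall>t\<le>T. applicable (d t) (C t)) \<and>
     (\<forall>t<T. C (Suc t) = app (d t) (C t)) \<and> stay (d T)"

lemma accepts_computation:
  assumes "(step M ^^ t0) (init_config M x) c" "halted M c" "fst c \<in> accepting M" "t0 \<le> T"
  obtains C d where "computation x T C d"
proof -
  obtain f where f: "f 0 = init_config M x" "f t0 = c" "\<And>i. i < t0 \<Longrightarrow> step M (f i) (f (Suc i))"
    using assms(1) unfolding relpowp_fun_conv by blast
  have gf: "good (f i)" if "i \<le> t0" for i
    using that
  proof (induction i)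
    case 0 then show ?case using f(1) good_init by simp
  next
    case (Suc i)
    then have g: "good (f i)" "step M (f i) (f (Suc i))" using f(3) by auto
    obtain d where "applicable d (f i)" "f (Suc i) = app d (f i)" using step_trans[OF g] by blast
    then show ?case using good_app[OF g(1)] unfolding applicable_def by simp
  qed
  \<comment> \<open>From time \<open>t0\<close> on the accepting configuration is repeated, by
    transitions with \<open>stay\<close>.\<close>
  define C where "C t = f (min t t0)" for t
  have ex: "\<exists>d. applicable d (C t) \<and> C (Suc t) = app d (C t) \<and> (t0 \<le> t \<longrightarrow> stay d)" for t
  proof (cases "t < t0")
    case True
    then have g: "good (f t)" "step M (f t) (f (Suc t))" using f(3) gf by auto
    obtain d where "applicable d (f t)" "f (Suc t) = app d (f t)" using step_trans[OF g] by blast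
    then show ?thesis using True unfolding C_def by (auto simp: min_def)
  next
    case False
    then have c: "C t = c" "C (Suc t) = c" using f(2) unfolding C_def by (auto simp: min_def)
    have "good c" using gf f(2) by blast
    then obtain d where d: "applicable d c" "stay d" using halted_stay assms(2,3) by blast
    then show ?thesis using stay_app[OF d] c by auto
  qed
  then obtain d where d: "\<And>t. applicable (d t) (C t) \<and> C (Suc t) = app (d t) (C t) \<and> (t0 \<le> t \<longrightarrow> stay (d t))" by metis
  have "computation x T C d" unfolding computation_def using d assms(4) f(1) by (auto simp: C_def)
  then show ?thesis using that by blast
qed

lemma computation_accepts:
  assumes "computation x T C d"
  shows "\<exists>t c. (step M ^^ t) (init_config M x) c \<and> halted M c \<and> fst c \<in> accepting M"
proof -
  have "\<exists>n. (step M ^^ n) (init_config M x) (C t)" if "t \<le> T" for t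
    using that
  proof (induction t)
    case 0 then show ?case using assms unfolding computation_def by (metis relpowp_0_I)
  next
    case (Suc t)
    then obtain n where n: "(step M ^^ n) (init_config M x) (C t)" by auto
    have d: "applicable (d t) (C t)" "C (Suc t) = app (d t) (C t)" using assms Suc.prems unfolding computation_def by auto
    show ?case
    proof (cases "stay (d t)")
      case True then show ?thesis using stay_app[OF d(1)] d(2) n by auto
    next
      case False then show ?thesis using trans_step[OF d(1)] d(2) n relpowp_Suc_I by metis
    qed
  qed
  moreover have "applicable (d T) (C T)" "stay (d T)" using assms unfolding computation_def by auto
  ultimately show ?thesis using stay_halted by blast
qed

lemma computation_good: "computation x T C d \<Longrightarrow> t \<le> T \<Longrightarrow> good (C t)"
proof (induction t)
  case 0 then show ?case using good_init unfolding computation_def by simp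
next
  case (Suc t) then show ?case using good_app[of "C t" "d t"] unfolding computation_def applicable_def by simp
qed

lemma move_bound:
  assumes "e \<in> trs" "i < k"
  shows "snd (ta e ! i) \<in> {-1, 0, 1}"
proof -
  have "ta e ! i \<in> set (ta e)" using assms(2) trs_wf(2)[OF assms(1)] by simp
  then have "ta e ! i \<in> {..<symbols M} \<times> {-1, 0, 1}" using trs_wf(3)[OF assms(1)] by blast
  then show ?thesis by (simp add: mem_Times_iff)
qed

text \<open>Position \<open>p\<close> of the tableau is tape cell \<open>p - T\<close>. Heads start
  at cell 0 and move at most once per step, so in \<open>T\<close> steps they never leave the
  positions 0 to \<open>2 * T\<close>.\<close>

definition inp :: "bool list \<Rightarrow> nat \<Rightarrow> nat \<Rightarrow> nat" where
  "inp x T p = (if T \<le> p then word_contents x (int (p - T)) else 0)"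

lemma inp_eq: "inp x T p = word_contents x (int p - int T)"
  unfolding inp_def by (auto simp: word_contents_def of_nat_diff)

text \<open>Each predicate of this group expresses a violation, by one letter (\<open>U0\<close>
  and, at time 0, \<open>I0\<close>, \<open>I1\<close>, \<open>I2\<close>) or by two
  (\<open>B1\<close> at the same time; \<open>B2\<close>, \<open>B3\<close>, \<open>B4\<close> at
  consecutive times in the same position, one to the right, one to the left). Forbidden letters and
  forbidden pairs are what the columns can express.\<close>

definition U0 :: "letter \<Rightarrow> bool" where "U0 c \<longleftrightarrow> (\<exists>i<k. he c ! i \<and> sy c ! i \<noteq> ts (tr c) ! i)"
definition I0 :: "letter \<Rightarrow> bool" where "I0 c \<longleftrightarrow> tq (tr c) \<noteq> 0 \<or> (\<exists>i<k. 0 < i \<and> sy c ! i \<noteq> 0)"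
definition I1 :: "letter \<Rightarrow> bool" where "I1 c \<longleftrightarrow> (\<exists>i<k. \<not> he c ! i)"
definition I2 :: "letter \<Rightarrow> bool" where "I2 c \<longleftrightarrow> (\<exists>i<k. he c ! i)"
definition B1 :: "letter \<Rightarrow> letter \<Rightarrow> bool" where "B1 c c' \<longleftrightarrow> tr c \<noteq> tr c' \<or> (\<exists>i<k. he c ! i \<and> he c' ! i)"
definition B2 :: "letter \<Rightarrow> letter \<Rightarrow> bool" where
  "B2 c c' \<longleftrightarrow> tq' (tr c) \<noteq> tq (tr c') \<or> (\<exists>i<k. sy c' ! i \<noteq> (if he c ! i then fst (ta (tr c) ! i) else sy c ! i)) \<or>
     (\<exists>i<k. he c ! i \<and> snd (ta (tr c) ! i) = 0 \<and> \<not> he c' ! i)"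
definition B3 :: "letter \<Rightarrow> letter \<Rightarrow> bool" where "B3 c c' \<longleftrightarrow> (\<exists>i<k. he c ! i \<and> snd (ta (tr c) ! i) = 1 \<and> \<not> he c' ! i)"
definition B4 :: "letter \<Rightarrow> letter \<Rightarrow> bool" where "B4 c c' \<longleftrightarrow> (\<exists>i<k. he c ! i \<and> snd (ta (tr c) ! i) = -1 \<and> \<not> he c' ! i)"

definition tableau :: "bool list \<Rightarrow> nat \<Rightarrow> (nat \<Rightarrow> nat \<Rightarrow> letter) \<Rightarrow> bool" where
  "tableau x T L \<longleftrightarrow> (\<forall>t\<le>T. \<forall>p\<le>2*T. L t p \<in> letters \<and> \<not> U0 (L t p)) \<and>
     (\<forall>p\<le>2*T. \<not> I0 (L 0 p) \<and> (p = T \<longrightarrow> \<not> I1 (L 0 p)) \<and> (p \<noteq> T \<longrightarrow> \<not> I2 (L 0 p)) \<and> sy (L 0 p) ! 0 = inp x T p \<and> stay (tr (L T p))) \<and>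
     (\<forall>t\<le>T. \<forall>p\<le>2*T. \<forall>p'\<le>2*T. p \<noteq> p' \<longrightarrow> \<not> B1 (L t p) (L t p')) \<and>
     (\<forall>t<T. \<forall>p\<le>2*T. \<not> B2 (L t p) (L (Suc t) p) \<and> (Suc p \<le> 2*T \<longrightarrow> \<not> B3 (L t p) (L (Suc t) (Suc p))) \<and>
        (Suc p \<le> 2*T \<longrightarrow> \<not> B4 (L t (Suc p)) (L (Suc t) p)))"

lemma init_tapes:
  "i < k \<Longrightarrow> snd (init_config M x) ! i = (0, if i = 0 then word_contents x else (\<lambda>_. 0))"
  unfolding init_config_def by (cases i) auto

lemma tableau_of_computation:
  assumes "computation x T C d"
  shows "\<exists>L. tableau x T L"
proof -
  have C: "C 0 = init_config M x" "\<And>t. t \<le> T \<Longrightarrow> applicable (d t) (C t)"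
    "\<And>t. t < T \<Longrightarrow> C (Suc t) = app (d t) (C t)" "stay (d T)" using assms unfolding computation_def by auto
  have g: "good (C t)" if "t \<le> T" for t using computation_good[OF assms that] .
  have dt: "d t \<in> trs" "tq (d t) = fst (C t)" "ts (d t) = map read (snd (C t))" if "t \<le> T" for t
    using C(2)[OF that] unfolding applicable_def by auto
  define hd where "hd t i = fst (snd (C t) ! i)" for t i
  define ct where "ct t i = snd (snd (C t) ! i)" for t i
  have len: "length (snd (C t)) = k" if "t \<le> T" for t using g[OF that] unfolding good_def by simp
  have hS: "hd (Suc t) i = hd t i + snd (ta (d t) ! i)" "ct (Suc t) i = (ct t i)(hd t i := fst (ta (d t) ! i))" if "t < T" "i < k" for t i
    using app_nth[OF dt(1) len that(2), of t t] that C(3)[OF that(1)] unfolding hd_def ct_def act_def by auto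
  have h0: "hd 0 i = 0" "ct 0 i = (if i = 0 then word_contents x else (\<lambda>_. 0))" if "i < k" for i
    using init_tapes[OF that, of x] C(1) unfolding hd_def ct_def by auto
  define L where "L t p = Lt (map (\<lambda>i. ct t i (int p - int T)) [0..<k]) (map (\<lambda>i. hd t i = int p - int T) [0..<k]) (d t)" for t p
  have sel: "sy (L t p) ! i = ct t i (int p - int T)" "he (L t p) ! i = (hd t i = int p - int T)" "tr (L t p) = d t" if "i < k" for t p i
    using that unfolding L_def by auto
  have trL: "tr (L t p) = d t" for t p unfolding L_def by simp
  have reads: "ts (d t) ! i = ct t i (hd t i)" if "t \<le> T" "i < k" for t i
    using dt(3)[OF that(1)] len[OF that(1)] that(2) unfolding read_def ct_def hd_def by simp
  have "tableau x T L"
    unfolding tableau_def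
  proof (intro conjI allI impI)
    fix t p assume t: "t \<le> T" and p: "p \<le> 2 * T"
    have "ct t i z < symbols M" if "i < k" for i z using g[OF t] that unfolding good_def ct_def by simp
    then show "L t p \<in> letters" unfolding letters_def L_def using dt(1)[OF t] by auto
    show "\<not> U0 (L t p)" unfolding U0_def using sel(1,2) trL reads[OF t] by metis
  next
    fix p assume p: "p \<le> 2 * T"
    show "\<not> I0 (L 0 p)"
    proof -
      have "tq (d 0) = 0" using dt(2)[of 0] C(1) unfolding init_config_def by simp
      moreover have "sy (L 0 p) ! i = 0" if "i < k" "0 < i" for i using sel(1)[OF that(1)] h0(2)[OF that(1)] that(2) by simp
      ultimately show ?thesis unfolding I0_def trL by (metis not_less_zero)
    qed
    show "\<not> I1 (L 0 p)" if "p = T" unfolding I1_def using sel(2) h0(1) that by simp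
    show "\<not> I2 (L 0 p)" if "p \<noteq> T" unfolding I2_def using sel(2) h0(1) that by simp
    show "sy (L 0 p) ! 0 = inp x T p" using sel(1)[of 0] h0(2)[of 0] k1 by (simp add: inp_eq)
    show "stay (tr (L T p))" unfolding trL by (rule C(4))
  next
    fix t p p' :: nat assume "p \<noteq> p'"
    then have "int p - int T \<noteq> int p' - int T" by simp
    then show "\<not> B1 (L t p) (L t p')" unfolding B1_def trL using sel(2) by metis
  next
    fix t p assume t: "t < T" and p: "p \<le> 2 * T"
    have q: "tq' (d t) = tq (d (Suc t))" using dt(2)[of "Suc t"] C(3)[OF t] t unfolding app_def by simp
    have "sy (L (Suc t) p) ! i = (if he (L t p) ! i then fst (ta (d t) ! i) else sy (L t p) ! i)" if "i < k" for i
      using sel[OF that] hS[OF t that] by auto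
    moreover have "he (L (Suc t) p) ! i" if "i < k" "he (L t p) ! i" "snd (ta (d t) ! i) = 0" for i
      using sel[OF that(1)] hS[OF t that(1)] that(2,3) by simp
    ultimately show "\<not> B2 (L t p) (L (Suc t) p)" unfolding B2_def trL using q by metis
    have "he (L (Suc t) (Suc p)) ! i" if "i < k" "he (L t p) ! i" "snd (ta (d t) ! i) = 1" for i
      using sel[OF that(1)] hS[OF t that(1)] that(2,3) by simp
    then show "\<not> B3 (L t p) (L (Suc t) (Suc p))" unfolding B3_def trL by metis
    have "he (L (Suc t) p) ! i" if "i < k" "he (L t (Suc p)) ! i" "snd (ta (d t) ! i) = -1" for i
      using sel[OF that(1)] hS[OF t that(1)] that(2,3) by simp
    then show "\<not> B4 (L t (Suc p)) (L (Suc t) p)" unfolding B4_def trL by metis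
  qed
  then show ?thesis by blast
qed

text \<open>The transitions are read off position 0 and applied to the initial configuration.
  \<open>B1\<close> only forbids a second head, so the presence of the head in its place has to be
  carried along by the induction, together with the tape contents and the state.\<close>

lemma computation_of_tableau:
  assumes "tableau x T L"
  shows "\<exists>C d. computation x T C d"
proof -
  define d where "d t = tr (L t 0)" for t
  have let': "L t p \<in> letters" "\<not> U0 (L t p)" if "t \<le> T" "p \<le> 2 * T" for t p using assms that unfolding tableau_def by auto
  have ini: "\<not> I0 (L 0 p)" "p = T \<Longrightarrow> \<not> I1 (L 0 p)" "sy (L 0 p) ! 0 = inp x T p" "stay (tr (L T p))" if "p \<le> 2 * T" for p
    using assms that unfolding tableau_def by blast+
  have b1: "\<not> B1 (L t p) (L t p')" if "t \<le> T" "p \<le> 2 * T" "p' \<le> 2 * T" "p \<noteq> p'" for t p p' using assms that unfolding tableau_def by auto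
  have b2: "\<not> B2 (L t p) (L (Suc t) p)" if "t < T" "p \<le> 2 * T" for t p using assms that unfolding tableau_def by auto
  have b3: "\<not> B3 (L t p) (L (Suc t) (Suc p))" if "t < T" "Suc p \<le> 2 * T" for t p
    using assms that Suc_leD[OF that(2)] unfolding tableau_def by simp
  have b4: "\<not> B4 (L t (Suc p)) (L (Suc t) p)" if "t < T" "Suc p \<le> 2 * T" for t p
    using assms that Suc_leD[OF that(2)] unfolding tableau_def by simp
  have trL: "tr (L t p) = d t" if "t \<le> T" "p \<le> 2 * T" for t p
    using b1[OF that(1), of p 0] that unfolding d_def B1_def by (cases "p = 0") auto
  have dtr: "d t \<in> trs" if "t \<le> T" for t using let'(1)[OF that, of 0] unfolding d_def letters_def by simp
  define C where "C = rec_nat (init_config M x) (\<lambda>t c. app (d t) c)"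
  have C: "C 0 = init_config M x" "C (Suc t) = app (d t) (C t)" for t unfolding C_def by auto
  define hd where "hd t i = fst (snd (C t) ! i)" for t i
  define ct where "ct t i = snd (snd (C t) ! i)" for t i
  have g: "good (C t)" if "t \<le> T" for t
    using that by (induction t) (auto simp: C good_init dtr intro!: good_app)
  have len: "length (snd (C t)) = k" if "t \<le> T" for t using g[OF that] unfolding good_def by simp
  have hS: "hd (Suc t) i = hd t i + snd (ta (d t) ! i)" "ct (Suc t) i = (ct t i)(hd t i := fst (ta (d t) ! i))" if "t < T" "i < k" for t i
    using app_nth[OF dtr len that(2), of t t] that C(2)[of t] unfolding hd_def ct_def act_def by auto
  have h0: "hd 0 i = 0" "ct 0 i = (if i = 0 then word_contents x else (\<lambda>_. 0))" if "i < k" for i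
    using init_tapes[OF that, of x] C(1) unfolding hd_def ct_def by auto
  have bound: "\<bar>hd t i\<bar> \<le> int t" if "t \<le> T" "i < k" for t i
    using that
  proof (induction t)
    case 0 then show ?case using h0 by simp
  next
    case (Suc t)
    have "snd (ta (d t) ! i) \<in> {-1, 0, 1}" using move_bound[OF dtr] Suc.prems by simp
    then show ?case using Suc.IH Suc.prems hS(1)[of t i] by auto
  qed
  define pos where "pos t i = nat (hd t i + int T)" for t i
  have pos: "pos t i \<le> 2 * T" "int (pos t i) = hd t i + int T" if "t \<le> T" "i < k" for t i
    using bound[OF that] that(1) unfolding pos_def by auto
  have inv: "(\<forall>i<k. he (L t (pos t i)) ! i) \<and> (\<forall>i<k. \<forall>p\<le>2*T. sy (L t p) ! i = ct t i (int p - int T)) \<and> tq (d t) = fst (C t)"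
    if "t \<le> T" for t
    using that
  proof (induction t)
    case 0
    have "pos 0 i = T" if "i < k" for i using h0(1)[OF that] unfolding pos_def by simp
    moreover have "he (L 0 T) ! i" if "i < k" for i using ini(2)[of T] that unfolding I1_def by auto
    moreover have "sy (L 0 p) ! i = ct 0 i (int p - int T)" if "i < k" "p \<le> 2 * T" for i p
      using ini(1,3)[OF that(2)] h0(2)[OF that(1)] that(1) unfolding I0_def inp_eq by auto
    moreover have "tq (d 0) = fst (C 0)" using ini(1)[of 0] trL[of 0 0] C(1) unfolding I0_def init_config_def by simp
    ultimately show ?case by simp
  next
    case (Suc t)
    then have t: "t < T" "t \<le> T" and IH: "\<And>i. i < k \<Longrightarrow> he (L t (pos t i)) ! i"
      "\<And>i p. i < k \<Longrightarrow> p \<le> 2 * T \<Longrightarrow> sy (L t p) ! i = ct t i (int p - int T)" by auto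
    \<comment> \<open>Presence of the head comes from the induction hypothesis, its uniqueness from
      \<open>B1\<close>.\<close>
    have uniq: "he (L t p) ! i \<longleftrightarrow> p = pos t i" if "i < k" "p \<le> 2 * T" for i p
      using IH(1)[OF that(1)] b1[OF t(2) that(2) pos(1)[OF t(2) that(1)]] that(1) unfolding B1_def by metis
    have "sy (L (Suc t) p) ! i = ct (Suc t) i (int p - int T)" if i: "i < k" and p: "p \<le> 2 * T" for i p
    proof -
      have "sy (L (Suc t) p) ! i = (if he (L t p) ! i then fst (ta (d t) ! i) else sy (L t p) ! i)"
        using b2[OF t(1) p] i trL[OF t(2) p] unfolding B2_def by metis
      moreover have "p = pos t i \<longleftrightarrow> int p - int T = hd t i" using pos(2)[OF t(2) i] by auto
      ultimately show ?thesis using uniq[OF i p] IH(2)[OF i p] hS(2)[OF t(1) i] by simp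
    qed
    moreover have "he (L (Suc t) (pos (Suc t) i)) ! i" if i: "i < k" for i
    proof -
      have h: "he (L t (pos t i)) ! i" "pos t i \<le> 2 * T" "tr (L t (pos t i)) = d t" using IH(1)[OF i] pos(1)[OF t(2) i] trL[OF t(2)] by auto
      have p': "pos (Suc t) i \<le> 2 * T" "int (pos (Suc t) i) = int (pos t i) + snd (ta (d t) ! i)"
        using pos[OF Suc.prems i] pos(2)[OF t(2) i] hS(1)[OF t(1) i] by auto
      have "snd (ta (d t) ! i) \<in> {-1, 0, 1}" using move_bound[OF dtr[OF t(2)] i] .
      then consider "snd (ta (d t) ! i) = 0" "pos (Suc t) i = pos t i" | "snd (ta (d t) ! i) = 1" "pos (Suc t) i = Suc (pos t i)"
        | "snd (ta (d t) ! i) = -1" "pos t i = Suc (pos (Suc t) i)" using p'(2) by fastforce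
      then show ?thesis
      proof cases
        case 1 then show ?thesis using b2[OF t(1) h(2)] h i unfolding B2_def by metis
      next
        case 2 then show ?thesis using b3[OF t(1), of "pos t i"] p'(1) h i unfolding B3_def by metis
      next
        case 3 then show ?thesis using b4[OF t(1), of "pos (Suc t) i"] h i unfolding B4_def by metis
      qed
    qed
    moreover have "tq (d (Suc t)) = fst (C (Suc t))"
      using b2[OF t(1), of 0] trL[OF t(2), of 0] trL[OF Suc.prems, of 0] unfolding B2_def C app_def by simp
    ultimately show ?case by blast
  qed
  have "applicable (d t) (C t)" if t: "t \<le> T" for t
  proof -
    have "ts (d t) = map read (snd (C t))"
    proof (rule nth_equalityI)
      show l: "length (ts (d t)) = length (map read (snd (C t)))" using dtr[OF t] len[OF t] unfolding trs_def by simp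
      fix i assume "i < length (ts (d t))"
      then have i: "i < k" using l len[OF t] by simp
      have p: "pos t i \<le> 2 * T" using pos(1)[OF t i] .
      have "sy (L t (pos t i)) ! i = ts (d t) ! i"
        using let'(2)[OF t p] inv[OF t] i trL[OF t p] unfolding U0_def by metis
      moreover have "sy (L t (pos t i)) ! i = ct t i (hd t i)" using inv[OF t] i p pos(2)[OF t i] by simp
      ultimately show "ts (d t) ! i = map read (snd (C t)) ! i" using i len[OF t] unfolding read_def ct_def hd_def by simp
    qed
    then show ?thesis using dtr[OF t] inv[OF t] unfolding applicable_def by simp
  qed
  moreover have "stay (d T)" using ini(4)[of 0] unfolding d_def by simp
  ultimately have "computation x T C d" unfolding computation_def using C by simp
  then show ?thesis by blast
qed

end

section \<open>Selections of letters\<close>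

context nondet
begin

definition cs :: "letter list" where "cs = (SOME cs. set cs = letters)"

lemma set_cs: "set cs = letters"
  unfolding cs_def using finite_list[OF finite_letters] by (rule someI_ex)

definition A :: nat where "A = Suc (length cs)"

text \<open>Letter number 0 is excluded everywhere; it provides an unselected row for columns without a conflict.\<close>

definition lt :: "nat \<Rightarrow> letter" where "lt a = cs ! (a - 1)"

lemma A_pos: "0 < A" unfolding A_def by simp

lemma lt_letters: "0 < a \<Longrightarrow> a < A \<Longrightarrow> lt a \<in> letters"
  unfolding lt_def A_def set_cs[symmetric] by simp

lemma letters_lt: "c \<in> letters \<Longrightarrow> \<exists>a. 0 < a \<and> a < A \<and> lt a = c"
proof -
  assume "c \<in> letters"
  then obtain i where "i < length cs" "cs ! i = c" unfolding set_cs[symmetric] in_set_conv_nth by blast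
  then show ?thesis unfolding lt_def A_def by (intro exI[of _ "Suc i"]) simp
qed

definition unary :: "bool list \<Rightarrow> nat \<Rightarrow> nat \<Rightarrow> nat \<Rightarrow> nat \<Rightarrow> bool" where
  "unary x T a t p \<longleftrightarrow> a = 0 \<or> U0 (lt a) \<or>
     t = 0 \<and> (I0 (lt a) \<or> p = T \<and> I1 (lt a) \<or> p \<noteq> T \<and> I2 (lt a) \<or> sy (lt a) ! 0 \<noteq> inp x T p) \<or> t = T \<and> \<not> stay (tr (lt a))"

definition binary :: "nat \<Rightarrow> nat \<Rightarrow> nat \<Rightarrow> nat \<Rightarrow> nat \<Rightarrow> nat \<Rightarrow> bool" where
  "binary a t p a' t' p' \<longleftrightarrow> t = t' \<and> p \<noteq> p' \<and> B1 (lt a) (lt a') \<or>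
     t' = Suc t \<and> (p' = p \<and> B2 (lt a) (lt a') \<or> p' = Suc p \<and> B3 (lt a) (lt a') \<or> p = Suc p' \<and> B4 (lt a) (lt a'))"

text \<open>Row \<open>v = (t * (2 * T + 1) + p) * A + a\<close> stands for letter \<open>a\<close>
  at time \<open>t\<close> and position \<open>p\<close>. A letter forbidden by itself is in
  conflict with itself.\<close>

definition conflict :: "bool list \<Rightarrow> nat \<Rightarrow> nat \<Rightarrow> nat \<Rightarrow> bool" where
  "conflict x T v v' \<longleftrightarrow>
     v = v' \<and> unary x T (v mod A) (v div A div (2 * T + 1)) (v div A mod (2 * T + 1)) \<or>
     binary (v mod A) (v div A div (2 * T + 1)) (v div A mod (2 * T + 1))
       (v' mod A) (v' div A div (2 * T + 1)) (v' div A mod (2 * T + 1))"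

definition rows :: "nat \<Rightarrow> nat" where "rows T = (T + 1) * (2 * T + 1) * A"

text \<open>Column \<open>j\<close> stands for the rows \<open>j div rows T\<close> and
  \<open>j mod rows T\<close> and asks that one of the two be unselected if they are in conflict.
  Without a conflict it taps all rows, so that the request is met by row 0.\<close>

definition tap :: "bool list \<Rightarrow> nat \<Rightarrow> nat \<Rightarrow> nat \<Rightarrow> bool" where
  "tap x T r j \<longleftrightarrow> r = j div rows T \<or> r = j mod rows T \<or> \<not> conflict x T (j div rows T) (j mod rows T)"

text \<open>More than one row of a group may be selected; since no two selected rows are in
  conflict, any choice of one per group describes a tableau.\<close>

definition selection :: "bool list \<Rightarrow> nat \<Rightarrow> nat set \<Rightarrow> bool" where
  "selection x T S \<longleftrightarrow> S \<subseteq> {..<rows T} \<and> (\<forall>g<(T + 1) * (2 * T + 1). \<exists>r\<in>S. r div A = g) \<and>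
     (\<forall>v\<in>S. \<forall>v'\<in>S. \<not> conflict x T v v')"

lemma rows_pos: "0 < rows T" unfolding rows_def using A_pos by simp

lemma rows_div: "rows T div A = (T + 1) * (2 * T + 1)"
  unfolding rows_def using A_pos by simp

lemma code_less: "a < h \<Longrightarrow> c < l \<Longrightarrow> a * l + c < h * (l::nat)"
proof -
  assume ac: "a < h" "c < l"
  then have "a * l + c < Suc a * l" by simp
  also have "\<dots> \<le> h * l" using ac by (intro mult_le_mono1) simp
  finally show ?thesis .
qed

lemma selection_of_solution:
  assumes S: "S \<subseteq> {..<rows T}" "\<forall>g<rows T div A. \<exists>r\<in>S. r div A = g"
    and c: "\<forall>j<rows T * rows T. \<exists>r<rows T. tap x T r j \<and> r \<notin> S"
  shows "selection x T S"
proof -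
  have "\<not> conflict x T v v'" if v: "v \<in> S" "v' \<in> S" for v v'
  proof -
    have l: "v < rows T" "v' < rows T" using v S(1) by auto
    have "v * rows T + v' < rows T * rows T" using code_less[OF l] .
    then obtain r where "tap x T r (v * rows T + v')" "r \<notin> S" using c by blast
    moreover have "(v * rows T + v') div rows T = v" "(v * rows T + v') mod rows T = v'" using l by auto
    ultimately show ?thesis using v unfolding tap_def by metis
  qed
  then show ?thesis using S unfolding selection_def rows_div by blast
qed

lemma solution_of_selection:
  assumes "selection x T S" "j < rows T * rows T"
  shows "\<exists>r<rows T. tap x T r j \<and> r \<notin> S"
proof -
  let ?v = "j div rows T" let ?w = "j mod rows T"
  have l: "?v < rows T" "?w < rows T" using assms(2) rows_pos by (auto simp: less_mult_imp_div_less)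
  have "conflict x T 0 0" unfolding conflict_def unary_def by simp
  then have "0 \<notin> S" using assms(1) unfolding selection_def by blast
  moreover have "tap x T 0 j \<or> conflict x T ?v ?w" "tap x T ?v j" "tap x T ?w j" unfolding tap_def by auto
  moreover have "?v \<notin> S \<or> ?w \<notin> S" if "conflict x T ?v ?w" using that assms(1) unfolding selection_def by blast
  ultimately show ?thesis using l rows_pos by blast
qed

lemma tableau_of_selection:
  assumes "selection x T S"
  shows "\<exists>L. tableau x T L"
proof -
  let ?w = "2 * T + 1"
  have S: "\<And>v. v \<in> S \<Longrightarrow> v < rows T" "\<And>g. g < (T + 1) * ?w \<Longrightarrow> \<exists>r\<in>S. r div A = g"
    "\<And>v v'. v \<in> S \<Longrightarrow> v' \<in> S \<Longrightarrow> \<not> conflict x T v v'"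
    using assms unfolding selection_def by blast+
  have "\<exists>a. t \<le> T \<longrightarrow> p \<le> 2 * T \<longrightarrow> a < A \<and> (t * ?w + p) * A + a \<in> S" for t p
  proof (cases "t \<le> T \<and> p \<le> 2 * T")
    case True
    then have "t * ?w + p < (T + 1) * ?w" by (intro code_less) auto
    then obtain r where r: "r \<in> S" "r div A = t * ?w + p" using S(2) by blast
    have "(t * ?w + p) * A + r mod A = r" using r(2) by (metis div_mult_mod_eq)
    then show ?thesis using r(1) A_pos by (intro exI[of _ "r mod A"]) simp
  qed blast
  then obtain a where a: "\<And>t p. t \<le> T \<Longrightarrow> p \<le> 2 * T \<Longrightarrow> a t p < A \<and> (t * ?w + p) * A + a t p \<in> S" by metis
  define v where "v t p = (t * ?w + p) * A + a t p" for t p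
  have v: "v t p \<in> S" "v t p mod A = a t p" "v t p div A div ?w = t" "v t p div A mod ?w = p" if "t \<le> T" "p \<le> 2 * T" for t p
  proof -
    have d: "v t p div A = t * ?w + p" "v t p mod A = a t p" using a[OF that] A_pos unfolding v_def by auto
    show "v t p \<in> S" "v t p mod A = a t p" using a[OF that] d unfolding v_def by auto
    have "(t * ?w + p) div ?w = t" "(t * ?w + p) mod ?w = p" using that(2) div_mult_self3[of ?w t p] mod_mult_self3[of t ?w p] by simp_all
    then show "v t p div A div ?w = t" "v t p div A mod ?w = p" unfolding d(1) .
  qed
  have u: "\<not> unary x T (a t p) t p" if "t \<le> T" "p \<le> 2 * T" for t p
    using S(3)[OF v(1)[OF that] v(1)[OF that]] v(2-4)[OF that] unfolding conflict_def by simp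
  have bi: "\<not> binary (a t p) t p (a t' p') t' p'" if "t \<le> T" "p \<le> 2 * T" "t' \<le> T" "p' \<le> 2 * T" for t p t' p'
    using S(3)[OF v(1)[OF that(1,2)] v(1)[OF that(3,4)]] v(2-4)[OF that(1,2)] v(2-4)[OF that(3,4)] unfolding conflict_def by simp
  have "tableau x T (\<lambda>t p. lt (a t p))"
    unfolding tableau_def
  proof (intro conjI allI impI)
    fix t p assume h: "t \<le> T" "p \<le> 2 * T"
    show "\<not> U0 (lt (a t p))" "lt (a t p) \<in> letters"
      using u[OF h] a[OF h] lt_letters[of "a t p"] unfolding unary_def by auto
  next
    fix p assume h: "p \<le> 2 * T"
    show "\<not> I0 (lt (a 0 p))" "sy (lt (a 0 p)) ! 0 = inp x T p" "stay (tr (lt (a T p)))"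
      using u[OF _ h, of 0] u[OF _ h, of T] unfolding unary_def by auto
    show "\<not> I1 (lt (a 0 p))" if "p = T" using u[OF _ h, of 0] that unfolding unary_def by auto
    show "\<not> I2 (lt (a 0 p))" if "p \<noteq> T" using u[OF _ h, of 0] that unfolding unary_def by auto
  next
    fix t p p' assume h: "t \<le> T" "p \<le> 2 * T" "p' \<le> 2 * T" "p \<noteq> p'"
    show "\<not> B1 (lt (a t p)) (lt (a t p'))" using bi[OF h(1,2) h(1,3)] h(4) unfolding binary_def by simp
  next
    fix t p assume h: "t < T" "p \<le> 2 * T"
    then have h': "t \<le> T" "Suc t \<le> T" by auto
    show "\<not> B2 (lt (a t p)) (lt (a (Suc t) p))" using bi[OF h'(1) h(2) h'(2) h(2)] unfolding binary_def by simp
    show "\<not> B3 (lt (a t p)) (lt (a (Suc t) (Suc p)))" if "Suc p \<le> 2 * T"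
      using bi[OF h'(1) h(2) h'(2) that] unfolding binary_def by simp
    show "\<not> B4 (lt (a t (Suc p))) (lt (a (Suc t) p))" if "Suc p \<le> 2 * T"
      using bi[OF h'(1) that h'(2) h(2)] unfolding binary_def by simp
  qed
  then show ?thesis by blast
qed

lemma selection_of_tableau:
  assumes "tableau x T L"
  shows "\<exists>S. selection x T S"
proof -
  let ?w = "2 * T + 1"
  \<comment> \<open>The list of letters may repeat a letter, so all positive numbers of the right
    letter are selected; a conflict between positive numbers depends only on their letters and
    sites.\<close>
  define S where "S = {r. r < rows T \<and> 0 < r mod A \<and> lt (r mod A) = L (r div A div ?w) (r div A mod ?w)}"
  have site: "r div A div ?w \<le> T" "r div A mod ?w \<le> 2 * T" if "r < rows T" for r
  proof -
    have "r div A < (T + 1) * ?w" using that unfolding rows_def by (rule less_mult_imp_div_less)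
    then have "r div A div ?w < T + 1" by (rule less_mult_imp_div_less)
    then show "r div A div ?w \<le> T" by simp
    have "r div A mod ?w < ?w" by simp
    then show "r div A mod ?w \<le> 2 * T" by linarith
  qed
  note c1 = assms[unfolded tableau_def, THEN conjunct1]
  note c' = assms[unfolded tableau_def, THEN conjunct2]
  note c2 = c'[THEN conjunct1] and c3 = c'[THEN conjunct2, THEN conjunct1] and c4 = c'[THEN conjunct2, THEN conjunct2]
  have tb: "L t p \<in> letters" "\<not> U0 (L t p)" if "t \<le> T" "p \<le> 2 * T" for t p using c1[rule_format, OF that] by auto
  have b1: "\<not> B1 (L t p) (L t p')" if "t \<le> T" "p \<le> 2 * T" "p' \<le> 2 * T" "p \<noteq> p'" for t p p'
    using c3[rule_format, OF that] .
  have b2: "\<not> B2 (L t p) (L (Suc t) p)" "Suc p \<le> 2*T \<longrightarrow> \<not> B3 (L t p) (L (Suc t) (Suc p))"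
    "Suc p \<le> 2*T \<longrightarrow> \<not> B4 (L t (Suc p)) (L (Suc t) p)" if "t < T" "p \<le> 2 * T" for t p
    using c4[THEN spec, THEN mp, OF that(1), THEN spec, THEN mp, OF that(2)] by auto
  have "\<not> conflict x T v v'" if h: "v \<in> S" "v' \<in> S" for v v'
  proof -
    define t p t' p' where d: "t = v div A div ?w" "p = v div A mod ?w" "t' = v' div A div ?w" "p' = v' div A mod ?w"
    have e: "lt (v mod A) = L t p" "lt (v' mod A) = L t' p'" "v mod A \<noteq> 0" using h unfolding S_def d by auto
    have l: "t \<le> T" "p \<le> 2 * T" "t' \<le> T" "p' \<le> 2 * T" using h site unfolding S_def d by auto
    have "\<not> unary x T (v mod A) t p"
      unfolding unary_def e(1) using tb(2)[OF l(1,2)] c2[THEN spec, THEN mp, OF l(2)] e(3) by metis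
    moreover have "\<not> binary (v mod A) t p (v' mod A) t' p'"
      unfolding binary_def e using b1[OF l(1,2,4)] b2[of t p, OF _ l(2)] b2[of t p', OF _ l(4)] l by (metis Suc_le_lessD)
    ultimately show ?thesis unfolding conflict_def d by simp
  qed
  moreover have "\<exists>r\<in>S. r div A = g" if g: "g < (T + 1) * ?w" for g
  proof -
    have gl: "g div ?w \<le> T" "g mod ?w \<le> 2 * T"
    proof -
      have "g div ?w < T + 1" using g by (rule less_mult_imp_div_less)
      then show "g div ?w \<le> T" by simp
      have "g mod ?w < ?w" by simp
      then show "g mod ?w \<le> 2 * T" by linarith
    qed
    obtain a where a: "0 < a" "a < A" "lt a = L (g div ?w) (g mod ?w)" using letters_lt[OF tb(1)[OF gl]] by blast
    have r: "(g * A + a) div A = g" "(g * A + a) mod A = a" using a(2) by auto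
    have "g * A + a < rows T" unfolding rows_def using g a(2) by (rule code_less)
    then have "g * A + a \<in> S" unfolding S_def using a r by simp
    then show ?thesis using r(1) by blast
  qed
  ultimately have "selection x T S" unfolding selection_def by (auto simp: S_def)
  then show ?thesis by blast
qed

end

section \<open>The reduction\<close>

lemma concat_map_matrix:
  "concat (map (\<lambda>i. map (F i) [0..<N]) [0..<k]) = map (\<lambda>c. F (c div N) (c mod N)) [0..<k * N]"
proof (induction k)
  case (Suc k)
  have "map (F k) [0..<N] = map (\<lambda>c. F (c div N) (c mod N)) [k * N..<Suc k * N]"
    by (rule nth_equalityI) auto
  moreover have "[0..<Suc k * N] = [0..<k * N] @ [k * N..<Suc k * N]" using upt_add_eq_append[of 0 "k * N" N] by (simp add: add.commute)
  ultimately show ?case using Suc by simp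
qed simp

text \<open>The unary prefix, the matrix and the binary number are ranges of positions; position
  \<open>N\<close> belongs to none of them and is the separator.\<close>

definition encode_bit :: "nat \<Rightarrow> (nat \<Rightarrow> nat \<Rightarrow> bool) \<Rightarrow> nat \<Rightarrow> nat \<Rightarrow> bool" where
  "encode_bit N R k i \<longleftrightarrow> i < N \<or> N < i \<and>
     (i < N + 1 + N * N \<and> R ((i - (N + 1)) div N) ((i - (N + 1)) mod N) \<or>
      N + 1 + N * N \<le> i \<and> bit_at k (i - (N + 1 + N * N)))"

lemma encode_eq_map:
  "encode N E k = map (encode_bit N (\<lambda>a c. {a, c} \<in> E) k) [0..<N + 1 + N * N + length (bits k)]"
proof (rule nth_equalityI)
  have e: "encode N E k = replicate N True @ [False] @ map (\<lambda>c. {c div N, c mod N} \<in> E) [0..<N * N] @ bits k"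
    unfolding encode_def concat_map_matrix ..
  show "length (encode N E k) = length (map (encode_bit N (\<lambda>a c. {a, c} \<in> E) k) [0..<N + 1 + N * N + length (bits k)])"
    unfolding e by simp
  fix i assume "i < length (encode N E k)"
  then have i: "i < N + 1 + N * N + length (bits k)" unfolding e by simp
  have "encode N E k ! i = encode_bit N (\<lambda>a c. {a, c} \<in> E) k i"
  proof -
    consider "i < N" | "i = N" | "N < i" "i < N + 1 + N * N" | "N + 1 + N * N \<le> i" by linarith
    then show ?thesis
    proof cases
      case 1 then show ?thesis unfolding e encode_bit_def by (simp add: nth_append)
    next
      case 2 then show ?thesis unfolding e encode_bit_def by (simp add: nth_append)
    next
      case 3
      then obtain c where c: "i = N + 1 + c" "c < N * N" by (metis Suc_eq_plus1 Suc_leI less_eqE nat_add_left_cancel_less)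
      then show ?thesis unfolding e encode_bit_def by (simp add: nth_append)
    next
      case 4
      then obtain c where c: "i = N + 1 + N * N + c" by (metis less_eqE)
      then have "c < length (bits k)" using i by simp
      then show ?thesis unfolding e encode_bit_def c using bit_at_iff by (simp add: nth_append)
    qed
  qed
  then show "encode N E k ! i = map (encode_bit N (\<lambda>a c. {a, c} \<in> E) k) [0..<N + 1 + N * N + length (bits k)] ! i"
    using i by (simp del: upt_Suc)
qed

lemma def_mem:
  assumes "finite S" "definable n f" "definable n g"
  shows "definableP n (\<lambda>x as. (f x as, g x as) \<in> S)"
proof -
  obtain cs where cs: "set cs = S" using finite_list[OF assms(1)] by blast
  have "definableP n (\<lambda>x as. \<exists>c\<in>set cs. f x as = fst c \<and> g x as = snd c)"
    by (intro def_exset def_and def_eq def_const assms(2,3))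
  moreover have "(\<exists>c\<in>set cs. f x as = fst c \<and> g x as = snd c) \<longleftrightarrow> (f x as, g x as) \<in> S" for x as
    unfolding cs by force
  ultimately show ?thesis by simp
qed

text \<open>The bound holds for all arguments, which removes the range test of
  \<open>def_table\<close>; it is essential that \<open>A\<close> does not depend on the
  input.\<close>

lemma def_rel:
  assumes "definable n f" "\<And>x as. f x as < (A::nat)"
  shows "definableP n (\<lambda>x as. R (f x as))"
  using def_table[OF assms(1), of A R] assms(2) by simp

lemma def_rel2:
  assumes "definable n f" "definable n g" "\<And>x as. f x as < (A::nat)" "\<And>x as. g x as < A"
  shows "definableP n (\<lambda>x as. R (f x as) (g x as))"
  using def_table2[OF assms(1,2), of A R] assms(3,4) by simp

locale reduction = nondet +
  fixes pl :: "nat poly" and b :: nat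
  assumes b2: "2 \<le> b"
begin

definition tm :: "bool list \<Rightarrow> nat" where "tm x = poly pl (length x)"
definition nr :: "bool list \<Rightarrow> nat" where "nr x = rows (tm x)"
definition nc :: "bool list \<Rightarrow> nat" where "nc x = nr x * nr x"
definition tp :: "bool list \<Rightarrow> nat \<Rightarrow> nat \<Rightarrow> bool" where "tp x = tap x (tm x)"

sublocale g: grid "nc x" "nr x" A b "tp x" for x :: "bool list"
  using rows_pos A_pos b2 by unfold_locales (auto simp: nc_def nr_def rows_def)

lemma solvable_iff: "(\<exists>S. g.solution x S) \<longleftrightarrow> (\<exists>C d. computation x (tm x) C d)"
proof
  assume "\<exists>S. g.solution x S"
  then obtain S where S: "g.solution x S" by blast
  have "selection x (tm x) S"
    using S[unfolded g.solution_def, unfolded nc_def nr_def tp_def] by (intro selection_of_solution) auto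
  then obtain L where "tableau x (tm x) L" using tableau_of_selection by blast
  then show "\<exists>C d. computation x (tm x) C d" by (rule computation_of_tableau)
next
  assume "\<exists>C d. computation x (tm x) C d"
  then obtain L where "tableau x (tm x) L" using tableau_of_computation by blast
  then obtain S where S: "selection x (tm x) S" using selection_of_tableau by blast
  then have "g.solution x S"
    using solution_of_selection[OF S] unfolding g.solution_def unfolding nc_def nr_def tp_def rows_div
    by (simp add: selection_def)
  then show "\<exists>S. g.solution x S" by blast
qed

lemma def_tm: "definable n (\<lambda>x as. tm x)"
  unfolding tm_def by (rule def_poly)

lemma def_nr: "definable n (\<lambda>x as. nr x)"
  unfolding nr_def rows_def by (intro def_intros def_tm)

lemma def_nc: "definable n (\<lambda>x as. nc x)"
  unfolding nc_def by (intro def_mul def_nr)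

lemma inp_less: "inp x T p < 3"
  unfolding inp_def word_contents_def by simp

lemma def_inp_site:
  assumes "definable n p"
  shows "definable n (\<lambda>x as. inp x (tm x) (p x as))"
  unfolding inp_def by (intro def_intros def_tm assms)

lemma def_conflict:
  assumes f: "definable n f" and g: "definable n g"
  shows "definableP n (\<lambda>x as. conflict x (tm x) (f x as) (g x as))"
proof -
  have a: "definable n (\<lambda>x as. f x as mod A)" "definable n (\<lambda>x as. g x as mod A)"
    by (intro def_intros assms)+
  have al: "f x as mod A < A" "g x as mod A < A" for x as using A_pos by auto
  note tp = def_div[OF def_div[OF f def_const[of n A]] def_add[OF def_mul[OF def_const[of n 2] def_tm] def_const[of n 1]]]
    def_mod[OF def_div[OF f def_const[of n A]] def_add[OF def_mul[OF def_const[of n 2] def_tm] def_const[of n 1]]]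
    def_div[OF def_div[OF g def_const[of n A]] def_add[OF def_mul[OF def_const[of n 2] def_tm] def_const[of n 1]]]
    def_mod[OF def_div[OF g def_const[of n A]] def_add[OF def_mul[OF def_const[of n 2] def_tm] def_const[of n 1]]]
  note u = def_rel[OF a(1) al(1)] and r = def_rel2[OF a al]
  \<comment> \<open>Here a letter number is compared with an input symbol; \<open>A + 3\<close>
    bounds both, as the input symbols are below 3.\<close>
  have i: "definableP n (\<lambda>x as. sy (lt (f x as mod A)) ! 0 \<noteq> inp x (tm x) (f x as div A mod (2 * tm x + 1)))"
    by (rule def_rel2[OF a(1) def_inp_site[OF tp(2)], where A = "A + 3" and R = "\<lambda>a s. sy (lt a) ! 0 \<noteq> s"])
      (use al(1) inp_less in \<open>auto intro: less_trans trans_less_add1 trans_less_add2\<close>)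
  have un: "definableP n (\<lambda>x as. unary x (tm x) (f x as mod A) (f x as div A div (2 * tm x + 1)) (f x as div A mod (2 * tm x + 1)))"
    unfolding unary_def
    by (intro def_and def_or def_eq[OF tp(1)] def_eq[OF tp(2)] def_not[OF def_eq[OF tp(2)]] def_tm def_const i
        u[of "\<lambda>a. a = 0"] u[of "\<lambda>a. U0 (lt a)"] u[of "\<lambda>a. I0 (lt a)"] u[of "\<lambda>a. I1 (lt a)"] u[of "\<lambda>a. I2 (lt a)"]
        u[of "\<lambda>a. \<not> stay (tr (lt a))"])
  have bi: "definableP n (\<lambda>x as. binary (f x as mod A) (f x as div A div (2 * tm x + 1)) (f x as div A mod (2 * tm x + 1))
      (g x as mod A) (g x as div A div (2 * tm x + 1)) (g x as div A mod (2 * tm x + 1)))"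
    unfolding binary_def
    by (intro def_and def_or def_eq def_not[OF def_eq] def_Suc tp r[of "\<lambda>a a'. B1 (lt a) (lt a')"]
        r[of "\<lambda>a a'. B2 (lt a) (lt a')"] r[of "\<lambda>a a'. B3 (lt a) (lt a')"] r[of "\<lambda>a a'. B4 (lt a) (lt a')"])
  show ?thesis unfolding conflict_def by (intro def_or def_and def_eq un bi assms)
qed

lemma def_tp:
  assumes "definable n f" "definable n g"
  shows "definableP n (\<lambda>x as. tp x (f x as) (g x as))"
  unfolding tp_def tap_def nr_def[symmetric]
  by (intro def_or def_eq def_not def_conflict def_div def_mod assms def_nr)

lemma def_Hwall:
  assumes "definable n f" "definable n g"
  shows "definableP n (\<lambda>x as. g.Hwall x (f x as) (g x as))"
  unfolding g.Hwall_def Let_def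
  by (intro def_or def_and def_less def_le def_eq def_mem def_tp def_div def_mod def_Suc assms def_nr def_nc def_const finite.intros)

lemma def_Vwall:
  assumes "definable n f" "definable n g"
  shows "definableP n (\<lambda>x as. g.Vwall x (f x as) (g x as))"
  unfolding g.Vwall_def Let_def
  by (intro def_or def_and def_not def_less def_le def_eq def_mem def_tp def_div def_mod def_Suc assms def_nr def_nc def_const finite.intros)

lemma def_Wd: "definable n (\<lambda>x as. g.Wd x)"
  unfolding g.Wd_def by (intro def_add def_mul def_const def_nr def_nc)

lemma def_loc_code:
  assumes "definable n f" "definable n g" "definable n h" "definable n s"
  shows "definable n (\<lambda>x as. g.loc_code x (f x as) (g x as) (h x as) (s x as))"
  unfolding g.loc_code_def by (intro def_add def_mul def_sub def_const def_nr def_Wd assms)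

lemma def_link_code:
  assumes "definable n f" "definable n g" "definable n h" "definable n u" "definable n v"
  shows "definableP n (\<lambda>x as. g.link_code x (f x as) (g x as) (h x as) (u x as) (v x as))"
  unfolding g.link_code_def
  by (intro def_or def_and def_eq def_less def_loc_code def_Hwall def_Vwall def_Suc assms def_const)

lemma def_edge:
  assumes "definable n f" "definable n g"
  shows "definableP n (\<lambda>x as. {f x as, g x as} \<in> g.E x)"
  unfolding g.edge_code
  by (intro def_ex def_or def_link_code def_add def_mul def_const def_nc def_nr def_last def_weaken[OF def_last]
      def_weaken[OF def_weaken[OF def_last]] def_weaken[OF def_weaken[OF def_weaken[OF assms(1)]]]
      def_weaken[OF def_weaken[OF def_weaken[OF assms(2)]]])

lemma def_target: "definable n (\<lambda>x as. g.target x)"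
  unfolding g.target_def g.card_P g.card_blocks
  by (intro def_add def_mul def_sub def_sum def_const def_nc def_nr def_Hwall def_Vwall def_tp def_le def_last def_weaken[OF def_last])

definition size :: "bool list \<Rightarrow> nat" where "size x = g.Wd x * (b * (5 * nr x + 1))"

lemma def_size: "definable n (\<lambda>x as. size x)"
  unfolding size_def by (intro def_add def_mul def_const def_nr def_Wd)

lemma def_bit: "definableP (Suc n) (\<lambda>x as. encode_bit (size x) (\<lambda>a c. {a, c} \<in> g.E x) (g.target x) (last as))"
  unfolding encode_bit_def
  by (intro def_or def_and def_less def_le def_edge def_bit_at def_div def_mod def_sub def_add def_mul def_const def_size
      def_target def_last)

lemma computable: "poly_time_computable (\<lambda>x. encode (size x) (g.E x) (g.target x))"
proof -
  obtain eb where eb: "\<And>x \<rho>. aval x \<rho> eb = of_bool (encode_bit (size x) (\<lambda>a c. {a, c} \<in> g.E x) (g.target x) (last (map \<rho> [0..<Suc 0])))"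
    using def_bit[of 0] unfolding definable_def by blast
  have "definable 0 (\<lambda>x as. size x + 1 + size x * size x + length (bits (g.target x)))"
    by (intro def_add def_mul def_const def_size def_length_bits def_target)
  then obtain el where el: "\<And>x \<rho>. aval x \<rho> el = size x + 1 + size x * size x + length (bits (g.target x))"
    unfolding definable_def by blast
  have "encode (size x) (g.E x) (g.target x) = map (\<lambda>i. aval x ((\<lambda>_. 0)(0 := i)) eb \<noteq> 0) [0..<aval x (\<lambda>_. 0) el]" for x
    unfolding encode_eq_map el eb by simp
  then show ?thesis using poly_time_computable_map[of eb el] by simp
qed

end

theorem theorem1:
  fixes l :: nat
  assumes "l \<ge> 3"
  shows "NP_hard (acyclic_matching_problem
    {G. planar G \<and> perfect_elimination_bipartite G \<and> max_degree G = 3 \<and> girth G \<ge> enat l})"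
  unfolding NP_hard_def
proof
  fix L assume "L \<in> NP"
  then obtain M and p :: "nat poly" where wf: "wf_ntm M"
    and time: "\<And>x t c. (step M ^^ t) (init_config M x) c \<Longrightarrow> t \<le> poly p (length x)"
    and acc: "\<And>x. x \<in> L \<longleftrightarrow> (\<exists>t c. (step M ^^ t) (init_config M x) c \<and> halted M c \<and> fst c \<in> accepting M)"
    unfolding NP_def by blast
  \<comment> \<open>Cycles are only shown to have length at least \<open>b - 1\<close>, hence the
    choice \<open>b = l + 1\<close>.\<close>
  interpret reduction M p "Suc l" using wf assms by unfold_locales auto
  let ?C = "{G. planar G \<and> perfect_elimination_bipartite G \<and> max_degree G = 3 \<and> girth G \<ge> enat l}"
  let ?P = "acyclic_matching_problem ?C"
  let ?f = "\<lambda>x. encode (size x) (g.E x) (g.target x)"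
  have sol: "x \<in> L \<longleftrightarrow> (\<exists>N. acyclic_matching (g.G x) N \<and> card N = g.target x)" for x
  proof -
    have "x \<in> L \<longleftrightarrow> (\<exists>C d. computation x (tm x) C d)"
    proof
      assume "x \<in> L"
      then obtain t c where c: "(step M ^^ t) (init_config M x) c" "halted M c" "fst c \<in> accepting M" using acc by blast
      \<comment> \<open>The time bound in \<open>NP\<close> covers every computation, so an
        accepting one fits into the tableau.\<close>
      have "t \<le> tm x" using time[OF c(1)] unfolding tm_def .
      then show "\<exists>C d. computation x (tm x) C d" using accepts_computation[OF c] by blast
    next
      assume "\<exists>C d. computation x (tm x) C d"
      then show "x \<in> L" using computation_accepts acc by blast
    qed
    then show ?thesis using solvable_iff[of x] g.matching_iff_solution[of x] by blast
  qed
  have G: "\<lparr>verts = {..<size x}, edges = g.E x\<rparr> = g.G x" for x unfolding g.G_def size_def ..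
  have "g.G x \<in> ?C" for x
    using g.planar_G[of x] g.perfect_elimination_G[of x] g.max_degree_3[of x] g.girth_G[of l x] by blast
  then have inst: "simple_graph (g.G x) \<and> g.G x \<in> ?C \<and> 0 < g.target x" for x
    using g.simple_G[of x] g.target_pos[of x] by blast
  have yes: "?f x \<in> fst ?P" if "x \<in> L" for x
    unfolding acyclic_matching_problem_def fst_conv Let_def mem_Collect_eq
    using inst[of x] sol[of x] that unfolding G[symmetric] by blast
  have no: "?f x \<in> snd ?P" if "x \<notin> L" for x
    unfolding acyclic_matching_problem_def snd_conv Let_def mem_Collect_eq
    using inst[of x] sol[of x] that unfolding G[symmetric] by blast
  show "\<exists>f. poly_time_computable f \<and> (\<forall>x. (x \<in> L \<longrightarrow> f x \<in> fst ?P) \<and> (x \<notin> L \<longrightarrow> f x \<in> snd ?P))"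
    using computable yes no by blast
qed

end
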